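(* Assume conditions $(\mathbf u)$, $(\mathbf{fg})$, $(\boldsymbol\partial)$ hold. Let the pair $(x^0,u^0)\in C_{loc}(\mathbb T,\mathbb X)\times\mathfrak U$ be uniformly overtaking optimal for the problem of maximizing $\lim_{T\to\infty}J_T(u)$ over $u\in\mathfrak U$, and let the (joint) limit $$\lim_{t\to\infty,\ \xi\to0_{\mathbb X}}I_\xi(t)=\int_{\mathbb T}\frac{\partial g(t,x^0(t),u^0(t))}{\partial x}A_*(t)\,dt\in\mathbb X$$ be well-defined and finite. Then there exists a unique solution $(x^0,u^0,\lambda^0,\psi^0)\in\mathfrak Z$ (with this $x^0,u^0$) of all relations of the Maximum Principle satisfying the transversality condition $$\lim_{t\to\infty}\psi^0(t)A_*(t)=0.$$ Moreover, up to a positive factor (i.e. after multiplying the pair $(\lambda^0,\psi^0)$ by a positive constant), $$\lambda^0=1,\qquad \psi^0(T)=\int_{[T,\infty)}\frac{\partial g(t,x^0(t),u^0(t))}{\partial x}A_*(t)\,dt\;A_*^{-1}(T)\qquad\forall T\in\mathbb T.$$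
   Context: Notation. $\mathbb T=\mathbb R_{\ge0}$, $\mathbb X=\mathbb R^m$, $\mathbb L$ is the space of real $m\times m$ matrices with unit matrix $1_{\mathbb L}$, $\mathbb U$ is a finite-dimensional Euclidean space, $U:\mathbb T\rightsquigarrow\mathbb U$ is a set-valued map with graph $\mathrm{Gr}\,U$, and $\mathfrak U$ is the set of all Borel measurable selectors of $U$. $C_{loc}(\mathbb T,E)$ is the set of continuous functions $\mathbb T\to E$ with the compact-open topology. $\mathcal L^1_{loc}(\mathbb T,\mathbb T)$ is the set of nonnegative locally summable functions on $\mathbb T$. Integrals over $\mathbb T$ or $[T,\infty)$ are improper: limits of integrals over $[0,T']$, $[T,T']$ as $T'\to\infty$. A function $a:\mathbb T\times E'\times\mathbb U\to E''$ is called: (1) Carathéodory if $a(\cdot,y,u)$ is measurable for all $y\in E'$ and all $u$ belonging to some $U(t)$, and $a(t,\cdot,\cdot):E'\times U(t)\to E''$ is continuous for all $t\in\mathbb T$; (2) locally Lipschitz continuous if for each compact $K\subset\mathbb T\times E'$ there is $L^a_K\in\mathcal L^1_{loc}(\mathbb T,\mathbb T)$ with $\|a(t,x',u)-a(t,x'',u)\|\le L^a_K(t)\|x'-x''\|$ for all $(t,x'),(t,x'')\in K$, $u\in U(t)$; (3) integrally bounded (on each compact subset) if for each compact $K\subset\mathbb T\times E'$ there is $M^a_K\in\mathcal L^1_{loc}(\mathbb T,\mathbb T)$ with $\|a(t,x,u)\|\le M^a_K(t)$ for all $(t,x)\in K$, $u\in U(t)$; (4) satisfying the continuability condition if it is locally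 Lipschitz continuous with $L^a_K$ independent of $K$ and it is integrally bounded on each compact subset. Condition $(\mathbf u)$: $U$ is compact-valued, integrally bounded on each compact subset of $\mathbb T$ (norms of elements of $U(t)$ are dominated by a locally summable function of $t$), and $\mathrm{Gr}\,U$ is a Borel subset of $\mathbb T\times\mathbb U$. Condition $(\mathbf{fg})$: $f:\mathbb T\times\mathbb X\times\mathbb U\to\mathbb X$ and $g:\mathbb T\times\mathbb X\times\mathbb U\to\mathbb R$ are locally Lipschitz continuous Carathéodory maps, integrally bounded on each compact subset, and $f$ satisfies the continuability condition. Condition $(\boldsymbol\partial)$: $f$ and $g$ have partial derivatives in $x$ that are locally Lipschitz continuous Carathéodory maps, integrally bounded on each compact subset. For $u\in\mathfrak U$, $\varphi[u]$ is the unique solution on $\mathbb T$ of $\dot x=f(t,x,u(t))$, $x(0)=0$, and $J_T(u)=\int_0^Tg(t,\varphi[u](t),u(t))\,dt$. A control $u^0\in\mathfrak U$ is uniformly overtaking optimal if for each $\varepsilon>0$ there is $T>0$ such that $J_t(u^0)\ge J_t(u)-\varepsilon$ for all $u\in\mathfrak U$, $t\ge T$; the pair $(x^0,u^0)$ is then called uniformly overtaking optimal, where $x^0=\varphi[u^0]$. $\mathcal H(x,t,u,\lambda,\psi)=\psi f(t,x,u)+\lambda g(t,x,u)$ ($\psi$ a row vector). $\mathfrak Z$ is the set of $(x,u,\lambda,\psi)\in C_{loc}(\mathbb T,\mathbb X)\times\mathfrak U\times[0,1]\times C_{loc}(\mathbb T,\mathbb X)$ ($x,\psi$ locally absolutely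 continuous) with $x(0)=0$, $\|\psi(0)\|_{\mathbb X}+\lambda=1$ and, a.e. on $\mathbb T$: $\dot x=f(t,x,u(t))$, $\dot\psi=-\frac{\partial\mathcal H}{\partial x}(x(t),t,u(t),\lambda,\psi(t))$, $\sup_{p\in U(t)}\mathcal H(x(t),t,p,\lambda,\psi(t))=\mathcal H(x(t),t,u(t),\lambda,\psi(t))$ (the relations of the Maximum Principle). For $\xi\in\mathbb X$, $x_\xi$ is the solution of $\dot x=f(t,x,u^0(t))$, $x(0)=\xi$; $A_\xi:\mathbb T\to\mathbb L$ is the solution of $\dot A_\xi(t)=\frac{\partial f(t,x_\xi(t),u^0(t))}{\partial x}A_\xi(t)$, $A_\xi(0)=1_{\mathbb L}$; $A_*=A_{0_{\mathbb X}}$ (so it corresponds to $x_0=x^0$); and $I_\xi(T)=\int_0^T\frac{\partial g(t,x_\xi(t),u^0(t))}{\partial x}A_\xi(t)\,dt$ (a row vector) for $T\in\mathbb T$. *)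

theory Defs
  imports "HOL-Analysis.Analysis"
begin

text \<open>
  The time axis is the set \<open>{0..}\<close> of nonnegative reals. Functions of time are total functions on
  \<open>real\<close>; their values at negative times are irrelevant, and every condition below is guarded
  accordingly. Row vectors are elements of \<open>real ^ 'm\<close> that are multiplied by a matrix from the
  left (\<open>v*\<close>).
\<close>

definition locally_summable :: "(real \<Rightarrow> real) \<Rightarrow> bool" where
  "locally_summable M \<longleftrightarrow>
     (\<forall>t\<ge>0. 0 \<le> M t) \<and> (\<forall>T\<ge>0. M absolutely_integrable_on {0..T})"

definition selectors :: "(real \<Rightarrow> 'u::euclidean_space set) \<Rightarrow> (real \<Rightarrow> 'u) set" where
  "selectors U =
     {u. u \<in> borel_measurable (restrict_space borel {0..}) \<and> (\<forall>t\<ge>0. u t \<in> U t)}"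

text \<open>
  Pitfall: since continuity in \<open>u\<close> is only required on \<open>U t\<close>, a Caratheodory map in this sense
  need not have measurable compositions \<open>\<lambda>t. a t y (u t)\<close> with selectors \<open>u\<close>. Hence these
  conditions alone do not guarantee that trajectories and payoffs exist.
\<close>

definition caratheodory ::
  "(real \<Rightarrow> 'u::euclidean_space set) \<Rightarrow> (real \<Rightarrow> 'x::euclidean_space \<Rightarrow> 'u \<Rightarrow> 'y::euclidean_space) \<Rightarrow> bool"
where
  "caratheodory U a \<longleftrightarrow>
     (\<forall>y. \<forall>u\<in>(\<Union>s\<in>{0..}. U s). (\<lambda>t. a t y u) \<in> borel_measurable (lebesgue_on {0..})) \<and>
     (\<forall>t\<ge>0. continuous_on (UNIV \<times> U t) (\<lambda>(y, u). a t y u))"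

definition lipschitz_bound ::
  "(real \<Rightarrow> 'u set) \<Rightarrow> (real \<Rightarrow> 'x::euclidean_space \<Rightarrow> 'u \<Rightarrow> 'y::euclidean_space) \<Rightarrow>
   (real \<times> 'x) set \<Rightarrow> (real \<Rightarrow> real) \<Rightarrow> bool"
where
  "lipschitz_bound U a K L \<longleftrightarrow>
     (\<forall>t x x'. (t, x) \<in> K \<longrightarrow> (t, x') \<in> K \<longrightarrow>
        (\<forall>u\<in>U t. norm (a t x u - a t x' u) \<le> L t * norm (x - x')))"

definition locally_lipschitz ::
  "(real \<Rightarrow> 'u set) \<Rightarrow> (real \<Rightarrow> 'x::euclidean_space \<Rightarrow> 'u \<Rightarrow> 'y::euclidean_space) \<Rightarrow> bool"
where
  "locally_lipschitz U a \<longleftrightarrow>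
     (\<forall>K. compact K \<and> K \<subseteq> {0..} \<times> UNIV \<longrightarrow>
        (\<exists>L. locally_summable L \<and> lipschitz_bound U a K L))"

definition integrally_bounded ::
  "(real \<Rightarrow> 'u set) \<Rightarrow> (real \<Rightarrow> 'x::euclidean_space \<Rightarrow> 'u \<Rightarrow> 'y::euclidean_space) \<Rightarrow> bool"
where
  "integrally_bounded U a \<longleftrightarrow>
     (\<forall>K. compact K \<and> K \<subseteq> {0..} \<times> UNIV \<longrightarrow>
        (\<exists>M. locally_summable M \<and> (\<forall>(t, x)\<in>K. \<forall>u\<in>U t. norm (a t x u) \<le> M t)))"

definition continuability ::
  "(real \<Rightarrow> 'u set) \<Rightarrow> (real \<Rightarrow> 'x::euclidean_space \<Rightarrow> 'u \<Rightarrow> 'y::euclidean_space) \<Rightarrow> bool"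
where
  "continuability U a \<longleftrightarrow>
     (\<exists>L. locally_summable L \<and>
        (\<forall>K. compact K \<and> K \<subseteq> {0..} \<times> UNIV \<longrightarrow> lipschitz_bound U a K L)) \<and>
     integrally_bounded U a"

definition condition_u :: "(real \<Rightarrow> 'u::euclidean_space set) \<Rightarrow> bool" where
  "condition_u U \<longleftrightarrow>
     (\<forall>t\<ge>0. compact (U t)) \<and>
     (\<forall>K. compact K \<and> K \<subseteq> {0..} \<longrightarrow>
        (\<exists>M. locally_summable M \<and> (\<forall>t\<in>K. \<forall>u\<in>U t. norm u \<le> M t))) \<and>
     {(t, u). 0 \<le> t \<and> u \<in> U t} \<in> sets borel"

definition condition_fg ::
  "(real \<Rightarrow> 'u::euclidean_space set) \<Rightarrow> (real \<Rightarrow> real ^ 'm \<Rightarrow> 'u \<Rightarrow> real ^ 'm) \<Rightarrow>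
   (real \<Rightarrow> real ^ 'm \<Rightarrow> 'u \<Rightarrow> real) \<Rightarrow> bool"
where
  "condition_fg U f g \<longleftrightarrow>
     caratheodory U f \<and> locally_lipschitz U f \<and> integrally_bounded U f \<and>
     caratheodory U g \<and> locally_lipschitz U g \<and> integrally_bounded U g \<and>
     continuability U f"

text \<open>
  \<open>fx\<close> and \<open>gx\<close> are the derivatives of \<open>f\<close> and \<open>g\<close> in the state variable (Jacobian matrix and
  gradient). As in the other conditions, only control values in \<open>U t\<close> matter at time \<open>t\<close>.
\<close>

definition condition_partial ::
  "(real \<Rightarrow> 'u::euclidean_space set) \<Rightarrow> (real \<Rightarrow> real ^ 'm \<Rightarrow> 'u \<Rightarrow> real ^ 'm) \<Rightarrow>
   (real \<Rightarrow> real ^ 'm \<Rightarrow> 'u \<Rightarrow> real) \<Rightarrow> (real \<Rightarrow> real ^ 'm \<Rightarrow> 'u \<Rightarrow> real ^ 'm ^ 'm) \<Rightarrow>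
   (real \<Rightarrow> real ^ 'm \<Rightarrow> 'u \<Rightarrow> real ^ 'm) \<Rightarrow> bool"
where
  "condition_partial U f g fx gx \<longleftrightarrow>
     (\<forall>t\<ge>0. \<forall>x. \<forall>u\<in>U t.
        ((\<lambda>y. f t y u) has_derivative (\<lambda>h. fx t x u *v h)) (at x) \<and>
        GDERIV (\<lambda>y. g t y u) x :> gx t x u) \<and>
     caratheodory U fx \<and> locally_lipschitz U fx \<and> integrally_bounded U fx \<and>
     caratheodory U gx \<and> locally_lipschitz U gx \<and> integrally_bounded U gx"

text \<open>
  Absolute continuity in the epsilon-delta sense: \<open>D\<close> ranges over finite families of
  nonoverlapping compact intervals \<open>K = {Inf K..Sup K}\<close>.
\<close>

definition absolutely_continuous_on_interval ::
  "real \<Rightarrow> real \<Rightarrow> (real \<Rightarrow> 'x::real_normed_vector) \<Rightarrow> bool"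
where
  "absolutely_continuous_on_interval a b x \<longleftrightarrow>
     (\<forall>e>0. \<exists>d>0. \<forall>D. D division_of (\<Union>D) \<and> \<Union>D \<subseteq> {a..b} \<and> (\<Sum>K\<in>D. Sup K - Inf K) < d \<longrightarrow>
        (\<Sum>K\<in>D. norm (x (Sup K) - x (Inf K))) < e)"

definition locally_absolutely_continuous :: "(real \<Rightarrow> 'x::real_normed_vector) \<Rightarrow> bool" where
  "locally_absolutely_continuous x \<longleftrightarrow> (\<forall>T\<ge>0. absolutely_continuous_on_interval 0 T x)"

definition solves_ode ::
  "(real \<Rightarrow> 'x::real_normed_vector \<Rightarrow> 'x) \<Rightarrow> 'x \<Rightarrow> (real \<Rightarrow> 'x) \<Rightarrow> bool"
where
  "solves_ode F \<xi> x \<longleftrightarrow>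
     locally_absolutely_continuous x \<and> x 0 = \<xi> \<and>
     (AE t in lebesgue_on {0..}. (x has_vector_derivative F t (x t)) (at t within {0..}))"

definition payoff ::
  "(real \<Rightarrow> 'x \<Rightarrow> 'u \<Rightarrow> real) \<Rightarrow> real \<Rightarrow> (real \<Rightarrow> 'x) \<Rightarrow> (real \<Rightarrow> 'u) \<Rightarrow> real"
where
  "payoff g T x u = integral {0..T} (\<lambda>t. g t (x t) (u t))"

text \<open>\<open>\<phi> u\<close> is the trajectory generated by the control \<open>u\<close>.\<close>

definition uniformly_overtaking_optimal ::
  "(real \<Rightarrow> 'u::euclidean_space set) \<Rightarrow> (real \<Rightarrow> 'x \<Rightarrow> 'u \<Rightarrow> real) \<Rightarrow>
   ((real \<Rightarrow> 'u) \<Rightarrow> real \<Rightarrow> 'x) \<Rightarrow> (real \<Rightarrow> 'u) \<Rightarrow> bool"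
where
  "uniformly_overtaking_optimal U g \<phi> u0 \<longleftrightarrow>
     u0 \<in> selectors U \<and>
     (\<forall>\<epsilon>>0. \<exists>T>0. \<forall>u\<in>selectors U. \<forall>t\<ge>T. payoff g t (\<phi> u0) u0 \<ge> payoff g t (\<phi> u) u - \<epsilon>)"

definition hamiltonian ::
  "(real \<Rightarrow> real ^ 'm \<Rightarrow> 'u \<Rightarrow> real ^ 'm) \<Rightarrow> (real \<Rightarrow> real ^ 'm \<Rightarrow> 'u \<Rightarrow> real) \<Rightarrow>
   real ^ 'm \<Rightarrow> real \<Rightarrow> 'u \<Rightarrow> real \<Rightarrow> real ^ 'm \<Rightarrow> real"
where
  "hamiltonian f g x t u l \<psi> = \<psi> \<bullet> f t x u + l * g t x u"

text \<open>
  The supremum below is taken in \<open>real\<close>; it is the true supremum whenever \<open>U t\<close> is compact and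
  nonempty and \<open>f\<close>, \<open>g\<close> are continuous in the control.
\<close>

definition maximum_principle_solutions ::
  "(real \<Rightarrow> 'u::euclidean_space set) \<Rightarrow> (real \<Rightarrow> real ^ 'm \<Rightarrow> 'u \<Rightarrow> real ^ 'm) \<Rightarrow>
   (real \<Rightarrow> real ^ 'm \<Rightarrow> 'u \<Rightarrow> real) \<Rightarrow>
   ((real \<Rightarrow> real ^ 'm) \<times> (real \<Rightarrow> 'u) \<times> real \<times> (real \<Rightarrow> real ^ 'm)) set"
where
  "maximum_principle_solutions U f g =
     {(x, u, l, \<psi>).
        u \<in> selectors U \<and> 0 \<le> l \<and> l \<le> 1 \<and>
        locally_absolutely_continuous x \<and> locally_absolutely_continuous \<psi> \<and>
        x 0 = 0 \<and> norm (\<psi> 0) + l = 1 \<and>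
        (AE t in lebesgue_on {0..}.
           (x has_vector_derivative f t (x t) (u t)) (at t within {0..}) \<and>
           (\<exists>Hx. GDERIV (\<lambda>y. hamiltonian f g y t (u t) l (\<psi> t)) (x t) :> Hx \<and>
                 (\<psi> has_vector_derivative - Hx) (at t within {0..})) \<and>
           (SUP p\<in>U t. hamiltonian f g (x t) t p l (\<psi> t)) =
             hamiltonian f g (x t) t (u t) l (\<psi> t))}"

definition has_improper_integral ::
  "(real \<Rightarrow> 'x::euclidean_space) \<Rightarrow> 'x \<Rightarrow> real \<Rightarrow> bool"
where
  "has_improper_integral h v T \<longleftrightarrow>
     (\<forall>T'\<ge>T. h absolutely_integrable_on {T..T'}) \<and>
     ((\<lambda>T'. integral {T..T'} h) \<longlongrightarrow> v) at_top"

end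

theory Submission
  imports Defs
begin

text \<open>
  Everything is read off from the function \<open>p(t) = (L - I\<^sub>0(t)) A\<^sub>*(t)\<^sup>-\<^sup>1\<close> (\<open>costate\<close>), where
  \<open>I\<^sub>0(t)\<close> is the integral of \<open>\<partial>g/\<partial>x A\<^sub>*\<close> over \<open>[0,t]\<close> and \<open>L\<close> its limit. The adjoint equation
  with multiplier \<open>\<lambda>\<close> says that \<open>(\<psi> A\<^sub>*)' = - \<lambda> \<partial>g/\<partial>x A\<^sub>*\<close>, hence \<open>\<psi> A\<^sub>* = \<psi>(0) - \<lambda> I\<^sub>0\<close>, and
  this tends to zero only if \<open>\<psi>(0) = \<lambda> L\<close>, that is, \<open>\<psi> = \<lambda> p\<close>. Since \<open>\<bar>\<psi>(0)\<bar> + \<lambda> = 1\<close>, also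
  \<open>\<lambda> = 1 / (1 + \<bar>L\<bar>)\<close>. Uniqueness and the formula are thus linear algebra
  (\<open>maximum_principle_solution_unique\<close>). What has to be proved is that \<open>p\<close>, with multiplier \<open>1\<close>,
  satisfies the maximum condition.

  That is done by needle variations directly on the half-line. Replace \<open>u\<^sub>0\<close> by another control
  \<open>u\<close> on \<open>[\<tau>, \<tau> + h)\<close>. From time \<open>\<tau> + h\<close> on, the perturbed trajectory is again driven by
  \<open>u\<^sub>0\<close>, and it equals \<open>X\<^sub>\<xi>\<close> for some initial value \<open>\<xi>\<close> of order \<open>h\<close>, because the flow map at a
  fixed time is bi-Lipschitz and therefore onto, by invariance of domain (\<open>flow_surj\<close>). The
  payoff gained after the needle is thus the difference of the payoffs of \<open>X\<^sub>\<xi>\<close> and \<open>X\<^sub>0\<close> over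
  \<open>[0,T]\<close>, less the same difference over \<open>[0, \<tau> + h]\<close>. The derivative along \<open>s \<mapsto> s \<xi>\<close> of the
  payoff over \<open>[0,T]\<close> is \<open>I\<^bsub>s\<xi>\<^esub>(T) \<xi>\<close>, so the joint limit gives \<open>L \<xi> + o(\<bar>\<xi>\<bar>)\<close> for the first
  difference, uniformly in all large \<open>T\<close> (\<open>payoff_near_limit\<close>). This uniformity allows
  \<open>T \<rightarrow> \<infinity>\<close>, where optimality is used, before \<open>h \<rightarrow> 0\<close>. The second difference is
  \<open>I\<^sub>0(\<tau> + h) \<xi>\<close> up to second order. Since \<open>p A\<^sub>* = L - I\<^sub>0\<close>, the result is
  \<open>h \<Delta>g + p(\<tau> + h) \<bullet> h \<Delta>f \<le> o(h)\<close> at Lebesgue points (\<open>needle_inequality\<close>), which compares the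
  Hamiltonian at \<open>u(\<tau>)\<close> and at \<open>u\<^sub>0(\<tau>)\<close>.

  Two measurability questions remain. First, the compositions \<open>f(t, x\<^sub>0(t), u(t))\<close> are not
  measurable by the Caratheodory conditions alone; they are limits of the corresponding
  compositions along trajectories that leave \<open>x\<^sub>0\<close> at grid times, which are measurable because
  these trajectories exist (\<open>along_reference\<close>). Second, the
  inequality holds off a null set that depends on the control \<open>u\<close>. Countably many selectors whose
  values are dense in \<open>U(t)\<close> for almost every \<open>t\<close> suffice to reach every point of \<open>U(t)\<close>
  (\<open>dense_selectors\<close>). They come from the measurability of projections of Borel sets, which is
  proved by Choquet's capacity argument (\<open>souslin_projection_inner\<close>).
\<close>

section \<open>Absolutely continuous functions and Lebesgue differentiation\<close>

lemma ac_D: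
  assumes "absolutely_continuous_on_interval a b x" "e > 0"
  obtains d where "d > 0"
    "\<forall>D. D division_of (\<Union>D) \<longrightarrow> \<Union>D \<subseteq> {a..b} \<longrightarrow> (\<Sum>K\<in>D. Sup K - Inf K) < d \<longrightarrow>
        (\<Sum>K\<in>D. norm (x (Sup K) - x (Inf K))) < e"
  using assms unfolding absolutely_continuous_on_interval_def by meson

lemma division_of_real_interval:
  fixes D :: "real set set"
  assumes "D division_of S" "S \<subseteq> {a..b}" "K \<in> D"
  shows "K = {Inf K..Sup K}" "Inf K \<le> Sup K" "Inf K \<in> {a..b}" "Sup K \<in> {a..b}"
proof -
  obtain u v where K: "K = {u..v}" "K \<noteq> {}" "K \<subseteq> {a..b}"
    using division_ofD(2-4)[OF assms(1,3)] assms(2) by (metis box_real(2) subset_trans)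
  then show "K = {Inf K..Sup K}" "Inf K \<le> Sup K" "Inf K \<in> {a..b}" "Sup K \<in> {a..b}"
    by auto
qed

text \<open>
  Absolute continuity passes to anything whose increments are controlled by those of absolutely
  continuous functions. Products, Lipschitz images and matrix inverses are all handled this way.
  The prefix \<open>ac\<close> refers to absolute continuity on an interval, \<open>lac\<close> to its local version on the
  half-line.
\<close>

lemma ac_dominated:
  assumes x: "absolutely_continuous_on_interval a b x"
    and y: "absolutely_continuous_on_interval a b y"
    and C: "C \<ge> 0"
    and le: "\<And>s t. a \<le> s \<Longrightarrow> s \<le> t \<Longrightarrow> t \<le> b \<Longrightarrow>
       norm (z t - z s) \<le> C * (norm (x t - x s) + norm (y t - y s))"
  shows "absolutely_continuous_on_interval a b z"
  unfolding absolutely_continuous_on_interval_def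
proof (intro allI impI)
  fix e :: real assume e: "e > 0"
  define e' where "e' = (e / 2) / (C + 1)"
  have e': "e' > 0" using e C by (simp add: e'_def)
  have "C + 1 \<noteq> 0" using C by simp
  then have e'_eq: "(C + 1) * e' = e / 2"
    unfolding e'_def by (metis nonzero_mult_div_cancel_left times_divide_eq_right)
  obtain d1 where d1: "d1 > 0" "\<forall>D. D division_of (\<Union>D) \<longrightarrow> \<Union>D \<subseteq> {a..b} \<longrightarrow> (\<Sum>K\<in>D. Sup K - Inf K) < d1 \<longrightarrow>
        (\<Sum>K\<in>D. norm (x (Sup K) - x (Inf K))) < e'"
    using ac_D[OF x e'] by blast
  obtain d2 where d2: "d2 > 0" "\<forall>D. D division_of (\<Union>D) \<longrightarrow> \<Union>D \<subseteq> {a..b} \<longrightarrow> (\<Sum>K\<in>D. Sup K - Inf K) < d2 \<longrightarrow>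
        (\<Sum>K\<in>D. norm (y (Sup K) - y (Inf K))) < e'"
    using ac_D[OF y e'] by blast
  show "\<exists>d>0. \<forall>D. D division_of \<Union> D \<and> \<Union> D \<subseteq> {a..b} \<and> (\<Sum>K\<in>D. Sup K - Inf K) < d \<longrightarrow>
              (\<Sum>K\<in>D. norm (z (Sup K) - z (Inf K))) < e"
  proof (intro exI[of _ "min d1 d2"] conjI allI impI)
    fix D assume D: "D division_of \<Union> D \<and> \<Union> D \<subseteq> {a..b} \<and> (\<Sum>K\<in>D. Sup K - Inf K) < min d1 d2"
    have "(\<Sum>K\<in>D. norm (z (Sup K) - z (Inf K))) \<le>
        (\<Sum>K\<in>D. C * (norm (x (Sup K) - x (Inf K)) + norm (y (Sup K) - y (Inf K))))"
    proof (intro sum_mono le)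
      fix K assume K: "K \<in> D"
      show "a \<le> Inf K" "Inf K \<le> Sup K" "Sup K \<le> b"
        using division_of_real_interval[of D "\<Union>D" a b K] D K by auto
    qed
    also have "\<dots> = C * ((\<Sum>K\<in>D. norm (x (Sup K) - x (Inf K))) + (\<Sum>K\<in>D. norm (y (Sup K) - y (Inf K))))"
      by (simp add: sum_distrib_left sum.distrib distrib_left)
    also have "\<dots> \<le> C * (e' + e')"
      using d1(2)[rule_format, of D] d2(2)[rule_format, of D] D C by (intro mult_left_mono add_mono) auto
    also have "\<dots> < (C + 1) * e' + (C + 1) * e'" using e' by (simp add: algebra_simps)
    also have "\<dots> = e" unfolding e'_eq by simp
    finally show "(\<Sum>K\<in>D. norm (z (Sup K) - z (Inf K))) < e" .
  qed (use d1 d2 in auto)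
qed

lemma ac_const: "absolutely_continuous_on_interval a b (\<lambda>t. c)"
  unfolding absolutely_continuous_on_interval_def by (auto intro: exI[of _ 1])

lemma ac_subinterval:
  assumes "absolutely_continuous_on_interval a b x" "a \<le> c" "d \<le> b"
  shows "absolutely_continuous_on_interval c d x"
  using assms unfolding absolutely_continuous_on_interval_def
  by (meson atLeastatMost_subset_iff subset_trans)

lemma ac_cong:
  assumes "\<And>t. t \<in> {a..b} \<Longrightarrow> x t = y t" "absolutely_continuous_on_interval a b x"
  shows "absolutely_continuous_on_interval a b y"
  by (rule ac_dominated[OF assms(2) assms(2), where C=1]) (use assms(1) in auto)

lemma ac_continuous:
  assumes x: "absolutely_continuous_on_interval a b x"
  shows "continuous_on {a..b} x"
  unfolding continuous_on_iff
proof (intro ballI allI impI)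
  fix s e :: real assume s: "s \<in> {a..b}" and e: "e > 0"
  obtain d where d: "d > 0" "\<forall>D. D division_of (\<Union>D) \<longrightarrow> \<Union>D \<subseteq> {a..b} \<longrightarrow> (\<Sum>K\<in>D. Sup K - Inf K) < d \<longrightarrow>
        (\<Sum>K\<in>D. norm (x (Sup K) - x (Inf K))) < e"
    using ac_D[OF x e] by blast
  have *: "norm (x v - x u) < e" if "a \<le> u" "u \<le> v" "v \<le> b" "v - u < d" for u v
  proof -
    have "{{u..v}} division_of \<Union>{{u..v}}"
      using division_of_self[of u v] that by simp
    from d(2)[rule_format, OF this] that show ?thesis by simp
  qed
  show "\<exists>d>0. \<forall>t\<in>{a..b}. dist t s < d \<longrightarrow> dist (x t) (x s) < e"
  proof (intro exI[of _ d] conjI ballI impI)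
    fix t assume t: "t \<in> {a..b}" "dist t s < d"
    show "dist (x t) (x s) < e"
      using *[of s t] *[of t s] s t by (cases "s \<le> t") (auto simp: dist_norm norm_minus_commute dist_real_def)
  qed (use d in auto)
qed

lemma ac_prod:
  assumes x: "absolutely_continuous_on_interval a b x"
    and y: "absolutely_continuous_on_interval a b y"
    and p: "bounded_bilinear p"
  shows "absolutely_continuous_on_interval a b (\<lambda>t. p (x t) (y t))"
proof -
  interpret p: bounded_bilinear p by fact
  obtain K where K: "K > 0" "\<And>u v. norm (p u v) \<le> norm u * norm v * K" using p.pos_bounded by blast
  have "bounded (x ` {a..b})" "bounded (y ` {a..b})"
    using x y by (auto intro!: compact_imp_bounded compact_continuous_image ac_continuous)
  then obtain B1 B2 where B: "\<And>t. t \<in> {a..b} \<Longrightarrow> norm (x t) \<le> B1" "\<And>t. t \<in> {a..b} \<Longrightarrow> norm (y t) \<le> B2"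
    unfolding bounded_iff by blast
  define C where "C = K * (\<bar>B1\<bar> + \<bar>B2\<bar>)"
  show ?thesis
  proof (rule ac_dominated[OF x y, where C=C])
    show "C \<ge> 0" using K by (simp add: C_def)
  next
    fix s t assume st: "a \<le> s" "s \<le> t" "t \<le> b"
    have bd: "norm (x t) \<le> \<bar>B1\<bar> + \<bar>B2\<bar>" "norm (y s) \<le> \<bar>B1\<bar> + \<bar>B2\<bar>"
      using B(1)[of t] B(2)[of s] st by auto
    have "p (x t) (y t) - p (x s) (y s) = p (x t - x s) (y s) + p (x t) (y t - y s)"
      by (simp add: p.diff_left p.diff_right)
    then have "norm (p (x t) (y t) - p (x s) (y s)) \<le> norm (x t - x s) * norm (y s) * K + norm (x t) * norm (y t - y s) * K"
      by (metis K(2) norm_triangle_mono)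
    also have "\<dots> \<le> norm (x t - x s) * (\<bar>B1\<bar> + \<bar>B2\<bar>) * K + (\<bar>B1\<bar> + \<bar>B2\<bar>) * norm (y t - y s) * K"
      using bd K by (intro add_mono mult_mono) auto
    also have "\<dots> = C * (norm (x t - x s) + norm (y t - y s))"
      by (simp add: C_def algebra_simps)
    finally show "norm (p (x t) (y t) - p (x s) (y s)) \<le> C * (norm (x t - x s) + norm (y t - y s))" .
  qed
qed

text \<open>
  The part of an integrable function above height \<open>n\<close> has small integral; this reduces uniform
  smallness of integrals over small sets to the bounded case.
\<close>

lemma integral_excess_tendsto_0:
  fixes h :: "real \<Rightarrow> real"
  assumes h: "h integrable_on S" and pos: "\<And>t. t \<in> S \<Longrightarrow> h t \<ge> 0"
  shows "S \<in> lmeasurable \<Longrightarrow> (\<lambda>n. integral S (\<lambda>t. h t - min (h t) (real n))) \<longlonglongrightarrow> 0"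
    and "\<And>n. S \<in> lmeasurable \<Longrightarrow> (\<lambda>t. h t - min (h t) (real n)) integrable_on S"
proof -
  show int: "(\<lambda>t. h t - min (h t) (real n)) integrable_on S" if "S \<in> lmeasurable" for n
  proof -
    have "h absolutely_integrable_on S" "(\<lambda>t. real n) absolutely_integrable_on S"
      using h pos that by (auto intro: nonnegative_absolutely_integrable_1 absolutely_integrable_on_const)
    then have "(\<lambda>t. min (h t) (real n)) absolutely_integrable_on S"
      by (rule absolutely_integrable_min_1)
    with h show ?thesis by (intro integrable_diff) (auto simp: absolutely_integrable_on_def)
  qed
  assume S: "S \<in> lmeasurable"
  have "(\<lambda>n. integral S (\<lambda>t. h t - min (h t) (real n))) \<longlonglongrightarrow> integral S (\<lambda>t. 0)"
  proof (rule dominated_convergence(2)[OF int[OF S] h])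
    fix t assume t: "t \<in> S"
    show "norm (h t - min (h t) (real n)) \<le> h t" for n using pos[OF t] by auto
    obtain m :: nat where m: "h t \<le> real m" using real_arch_simple by blast
    have "\<forall>\<^sub>F n in sequentially. h t - min (h t) (real n) = 0"
      using eventually_ge_at_top[of m] by eventually_elim (use m in auto)
    then show "(\<lambda>n. h t - min (h t) (real n)) \<longlonglongrightarrow> 0" by (rule tendsto_eventually)
  qed
  then show "(\<lambda>n. integral S (\<lambda>t. h t - min (h t) (real n))) \<longlonglongrightarrow> 0" by simp
qed

lemma ac_indefinite_integral:
  fixes f :: "real \<Rightarrow> 'b::euclidean_space"
  assumes f: "f absolutely_integrable_on {a..b}"
  shows "absolutely_continuous_on_interval a b (\<lambda>t. integral {a..t} f)"
  unfolding absolutely_continuous_on_interval_def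
proof (intro allI impI)
  fix e :: real assume e: "e > 0"
  define h where "h n t = norm (f t) - min (norm (f t)) (real n)" for n t
  have int: "f integrable_on {a..b}" and intn: "(\<lambda>t. norm (f t)) integrable_on {a..b}"
    using f by (auto simp: absolutely_integrable_on_def)
  have hi: "h n integrable_on {a..b}" and hc: "(\<lambda>n. integral {a..b} (h n)) \<longlonglongrightarrow> 0" for n
    unfolding h_def using integral_excess_tendsto_0[OF intn] by auto
  obtain n where n: "integral {a..b} (h n) < e/2"
    using order_tendstoD(2)[OF hc, of "e/2"] e by (auto simp: eventually_sequentially)
  define d where "d = e / (2 * (real n + 1))"
  show "\<exists>d>0. \<forall>D. D division_of \<Union> D \<and> \<Union> D \<subseteq> {a..b} \<and> (\<Sum>K\<in>D. Sup K - Inf K) < d \<longrightarrow>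
              (\<Sum>K\<in>D. norm (integral {a..Sup K} f - integral {a..Inf K} f)) < e"
  proof (intro exI[of _ d] conjI allI impI)
    show "d > 0" using e by (simp add: d_def)
    fix D assume "D division_of \<Union> D \<and> \<Union> D \<subseteq> {a..b} \<and> (\<Sum>K\<in>D. Sup K - Inf K) < d"
    then have D: "D division_of \<Union> D" "\<Union> D \<subseteq> {a..b}" "(\<Sum>K\<in>D. Sup K - Inf K) < d" by auto
    have "(\<Sum>K\<in>D. norm (integral {a..Sup K} f - integral {a..Inf K} f)) \<le>
          (\<Sum>K\<in>D. real n * (Sup K - Inf K) + integral K (h n))"
    proof (rule sum_mono)
      fix K assume K: "K \<in> D"
      note I = division_of_real_interval[OF D(1,2) K]
      have sub: "{Inf K..Sup K} \<subseteq> {a..b}" using I(3,4) by (auto simp: atLeastatMost_subset_iff)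
      have "integral {a..Sup K} f - integral {a..Inf K} f = integral {Inf K..Sup K} f"
        using Henstock_Kurzweil_Integration.integral_combine[of a "Inf K" "Sup K" f] I integrable_on_subinterval[OF int, of a "Sup K"]
        by (auto simp: algebra_simps)
      also have "norm \<dots> \<le> integral {Inf K..Sup K} (\<lambda>t. real n + h n t)"
        using int hi sub
        by (intro integral_norm_bound_integral integrable_add integrable_const_ivl)
           (auto intro: integrable_on_subinterval[OF int] integrable_on_subinterval[OF hi] simp: h_def[symmetric], auto simp: h_def)
      also have "\<dots> = real n * (Sup K - Inf K) + integral {Inf K..Sup K} (h n)"
        using integrable_on_subinterval[OF hi sub] I(2) by (subst Henstock_Kurzweil_Integration.integral_add) auto
      finally show "norm (integral {a..Sup K} f - integral {a..Inf K} f) \<le> real n * (Sup K - Inf K) + integral K (h n)"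
        using I(1) by simp
    qed
    also have "\<dots> = real n * (\<Sum>K\<in>D. Sup K - Inf K) + (\<Sum>K\<in>D. integral K (h n))"
      by (simp add: sum.distrib sum_distrib_left)
    also have "(\<Sum>K\<in>D. integral K (h n)) = integral (\<Union>D) (h n)"
      using integral_unique[OF has_integral_combine_division_topdown[OF hi D(1,2)]] by simp
    also have "integral (\<Union>D) (h n) \<le> integral {a..b} (h n)"
      using has_integral_combine_division_topdown[OF hi D(1,2)] hi D(2)
      by (intro integral_subset_le) (auto simp: h_def)
    also have "real n * (\<Sum>K\<in>D. Sup K - Inf K) \<le> real n * d" using D by (intro mult_left_mono) auto
    also have "real n * d \<le> e/2" using e by (simp add: d_def field_simps)
    finally show "(\<Sum>K\<in>D. norm (integral {a..Sup K} f - integral {a..Inf K} f)) < e" using n by linarith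
  qed
qed

text \<open>
  The fundamental theorem of calculus for an absolutely continuous function with a known derivative
  off a null set. In a fine tagged division, the intervals with tag in the null set lie in an open
  set of small measure, so absolute continuity bounds the variation of \<open>x\<close> over them; on all other
  intervals the derivative approximates the increment.
\<close>

lemma ac_has_integral_derivative:
  fixes x :: "real \<Rightarrow> 'b::euclidean_space"
  assumes ab: "a \<le> b" and ac: "absolutely_continuous_on_interval a b x"
    and N: "negligible N"
    and der: "\<And>t. t \<in> {a..b} - N \<Longrightarrow> (x has_vector_derivative f t) (at t within {a..b})"
  shows "(f has_integral x b - x a) {a..b}"
proof -
  define f' where "f' t = (if t \<in> N then 0 else f t)" for t
  have "(f' has_integral x b - x a) {a..b}"
    unfolding has_integral_real
  proof (intro allI impI)
    fix e :: real assume e: "e > 0"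
    \<comment> \<open>Half of the error is spent on tags off \<open>N\<close>; adding 1 avoids division by zero if \<open>a = b\<close>.\<close>
    define e1 where "e1 = e / (2 * (b - a + 1))"
    have e1: "e1 > 0" using e ab by (simp add: e1_def)
    obtain d where d: "d > 0" "\<forall>D. D division_of (\<Union>D) \<longrightarrow> \<Union>D \<subseteq> {a..b} \<longrightarrow> (\<Sum>K\<in>D. Sup K - Inf K) < d \<longrightarrow>
        (\<Sum>K\<in>D. norm (x (Sup K) - x (Inf K))) < e/2"
      using ac_D[OF ac half_gt_zero[OF e]] by blast
    obtain V where V: "open V" "N \<subseteq> V" "V \<in> lmeasurable" "measure lebesgue V < d"
    proof -
      have N0: "N \<in> null_sets lebesgue" using N by (simp add: negligible_iff_null_sets)
      obtain V where V: "open V" "N \<subseteq> V" "V - N \<in> lmeasurable" "emeasure lebesgue (V - N) < ennreal d"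
        using sets_lebesgue_outer_open[of N d] N0 d by auto
      have "emeasure lebesgue V = emeasure lebesgue (V - N)"
        using N0 V by (simp add: emeasure_Diff_null_set)
      with V have "emeasure lebesgue V < ennreal d" by simp
      moreover from this have "V \<in> lmeasurable"
        using V(1) by (intro fmeasurableI) (auto simp: top.not_eq_extremum intro: less_trans)
      ultimately show thesis
        using that[of V] V d by (metis emeasure_eq_measure2 ennreal_less_iff measure_nonneg)
    qed
    have "\<forall>t. \<exists>\<delta>>0. t \<in> {a..b} - N \<longrightarrow>
        (\<forall>s\<in>{a..b}. \<bar>s - t\<bar> < \<delta> \<longrightarrow> norm (x s - x t - (s - t) *\<^sub>R f t) \<le> e1 * \<bar>s - t\<bar>)"
    proof
      fix t show "\<exists>\<delta>>0. t \<in> {a..b} - N \<longrightarrow>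
        (\<forall>s\<in>{a..b}. \<bar>s - t\<bar> < \<delta> \<longrightarrow> norm (x s - x t - (s - t) *\<^sub>R f t) \<le> e1 * \<bar>s - t\<bar>)"
      proof (cases "t \<in> {a..b} - N")
        case True
        from der[OF this] e1 show ?thesis
          unfolding has_vector_derivative_def has_derivative_within_alt real_norm_def by blast
      qed (auto intro: exI[of _ 1])
    qed
    then obtain \<delta> where \<delta>: "\<And>t. \<delta> t > 0"
      "\<And>t s. t \<in> {a..b} - N \<Longrightarrow> s\<in>{a..b} \<Longrightarrow> \<bar>s - t\<bar> < \<delta> t \<Longrightarrow> norm (x s - x t - (s - t) *\<^sub>R f t) \<le> e1 * \<bar>s - t\<bar>"
      by metis
    \<comment> \<open>Tags in \<open>N\<close> are confined to the small open set, all others to where the derivative is accurate.\<close>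
    define \<gamma> where "\<gamma> t = (if t \<in> N then V else ball t (\<delta> t))" for t
    show "\<exists>\<gamma>. gauge \<gamma> \<and> (\<forall>D. D tagged_division_of {a..b} \<and> \<gamma> fine D \<longrightarrow>
            norm ((\<Sum>(t, K)\<in>D. measure lborel K *\<^sub>R f' t) - (x b - x a)) < e)"
    proof (intro exI[of _ \<gamma>] conjI allI impI)
      show "gauge \<gamma>" using V \<delta> by (auto simp: gauge_def \<gamma>_def)
      fix p assume p: "p tagged_division_of {a..b} \<and> \<gamma> fine p"
      then have td: "p tagged_division_of {a..b}" and fine: "\<gamma> fine p" by auto
      have fin: "finite p" using td by blast
      have K: "K = {Inf K..Sup K}" "t \<in> K" "a \<le> Inf K" "Inf K \<le> Sup K" "Sup K \<le> b" "K \<subseteq> \<gamma> t"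
        "measure lborel K = Sup K - Inf K"
        if tK: "(t, K) \<in> p" for t K
      proof -
        obtain u v where uv: "K = {u..v}" using tagged_division_ofD(4)[OF td tK] by auto
        have t: "t \<in> K" "K \<subseteq> {a..b}" using tagged_division_ofD(2,3)[OF td tK] by auto
        with uv have "u \<le> v" "a \<le> u" "v \<le> b" by (auto simp: atLeastatMost_subset_iff)
        with uv t show "K = {Inf K..Sup K}" "t \<in> K" "a \<le> Inf K" "Inf K \<le> Sup K" "Sup K \<le> b"
          "measure lborel K = Sup K - Inf K" by auto
        show "K \<subseteq> \<gamma> t" using fine tK by (auto simp: fine_def)
      qed
      define q where "q = {(t, K) \<in> p. t \<in> N}"
      have qp: "q \<subseteq> p" by (auto simp: q_def)
      define D where "D = snd ` q"
      have tq: "q tagged_division_of (\<Union>D)"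
        unfolding D_def
        by (rule tagged_partial_division_of_Union_self[OF tagged_partial_division_subset[OF _ qp, of "{a..b}"]])
           (use td in \<open>simp add: tagged_division_of_def\<close>)
      have divD: "D division_of \<Union>D" unfolding D_def using division_of_tagged_division[OF tq] D_def by simp
      have Dab: "\<Union>D \<subseteq> {a..b}" unfolding D_def using qp td tagged_division_ofD(3) by fastforce
      have DV: "\<Union>D \<subseteq> V" 
      proof
        fix y assume "y \<in> \<Union>D"
        then obtain t K where tK: "(t, K) \<in> p" "t \<in> N" "y \<in> K" by (auto simp: D_def q_def)
        then show "y \<in> V" using K(6)[OF tK(1)] by (auto simp: \<gamma>_def)
      qed
      have finD: "finite D" using divD by blast
      have over: "(\<Sum>(t,K)\<in>q. norm (x (Sup K) - x (Inf K))) = (\<Sum>K\<in>D. norm (x (Sup K) - x (Inf K)))"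
      proof -
        \<comment> \<open>Guarded against the empty interval, whose \<open>Sup\<close> and \<open>Inf\<close> are junk.\<close>
        define \<nu> where "\<nu> K = (if K = {} then 0 else norm (x (Sup K) - x (Inf K)))" for K
        have "(\<Sum>(t,K)\<in>q. \<nu> K) = (\<Sum>K\<in>D. \<nu> K)"
          unfolding D_def
          by (rule sum.over_tagged_division_lemma[OF tq]) (auto simp: \<nu>_def)
        moreover have "(\<Sum>(t,K)\<in>q. \<nu> K) = (\<Sum>(t,K)\<in>q. norm (x (Sup K) - x (Inf K)))"
          using K(2) qp by (intro sum.cong) (fastforce simp: \<nu>_def)+
        moreover have "(\<Sum>K\<in>D. \<nu> K) = (\<Sum>K\<in>D. norm (x (Sup K) - x (Inf K)))"
          using division_ofD(3)[OF divD] by (intro sum.cong) (auto simp: \<nu>_def)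
        ultimately show ?thesis by simp
      qed
      have len: "(\<Sum>K\<in>D. Sup K - Inf K) < d"
      proof -
        have "(\<Sum>K\<in>D. Sup K - Inf K) = (\<Sum>K\<in>D. measure lebesgue K)"
        proof (rule sum.cong[OF refl])
          fix J assume "J \<in> D"
          note I = division_of_real_interval[OF divD Dab this]
          have "measure lebesgue {Inf J..Sup J} = Sup J - Inf J" using I(2) by simp
          then show "Sup J - Inf J = measure lebesgue J" using I(1) by simp
        qed
        also have "\<dots> = measure lebesgue (\<Union>D)" by (rule content_division[OF divD])
        also have "\<dots> \<le> measure lebesgue V"
          using lmeasurable_division[OF divD] V by (intro measure_mono_fmeasurable DV) auto
        finally show ?thesis using V by simp
      qed
      have Nsum: "(\<Sum>(t,K)\<in>q. norm (x (Sup K) - x (Inf K))) < e/2"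
        unfolding over using d(2) divD Dab len by blast
      have rest: "(\<Sum>(t,K)\<in>p-q. norm (measure lborel K *\<^sub>R f' t - (x (Sup K) - x (Inf K)))) \<le> e1 * (b - a)"
      proof -
        have "(\<Sum>(t,K)\<in>p-q. norm (measure lborel K *\<^sub>R f' t - (x (Sup K) - x (Inf K)))) \<le> (\<Sum>(t,K)\<in>p-q. e1 * measure lborel K)"
        proof (rule sum_mono, clarify)
          fix t K assume tK: "(t,K) \<in> p" "(t,K) \<notin> q"
          then have tN: "t \<notin> N" by (auto simp: q_def)
          note k = K[OF tK(1)]
          have t: "Inf K \<le> t" "t \<le> Sup K" using k(1,2) by (metis atLeastAtMost_iff)+
          then have tab: "t \<in> {a..b} - N" using k tN by auto
          have "Inf K \<in> K" "Sup K \<in> K" using k(1,4) by (metis atLeastAtMost_iff order_refl)+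
          then have "dist t (Inf K) < \<delta> t" "dist t (Sup K) < \<delta> t" using k(6) tN by (auto simp: \<gamma>_def)
          then have 1: "norm (x (Sup K) - x t - (Sup K - t) *\<^sub>R f t) \<le> e1 * (Sup K - t)"
            and 2: "norm (x (Inf K) - x t - (Inf K - t) *\<^sub>R f t) \<le> e1 * (t - Inf K)"
            using \<delta>(2)[OF tab, of "Sup K"] \<delta>(2)[OF tab, of "Inf K"] k t by (auto simp: dist_real_def)
          have "measure lborel K *\<^sub>R f' t - (x (Sup K) - x (Inf K)) =
             (x (Inf K) - x t - (Inf K - t) *\<^sub>R f t) - (x (Sup K) - x t - (Sup K - t) *\<^sub>R f t)"
            unfolding k(7) using tN by (simp add: f'_def algebra_simps)
          also have "norm \<dots> \<le> e1 * (t - Inf K) + e1 * (Sup K - t)"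
            by (rule order_trans[OF norm_triangle_ineq4 add_mono[OF 2 1]])
          finally show "norm (measure lborel K *\<^sub>R f' t - (x (Sup K) - x (Inf K))) \<le> e1 * measure lborel K"
            unfolding k(7) by (simp add: algebra_simps)
        qed
        also have "\<dots> \<le> (\<Sum>(t,K)\<in>p. e1 * measure lborel K)"
          using fin e1 by (intro sum_mono2) auto
        also have "\<dots> = e1 * (\<Sum>(t,K)\<in>p. measure lborel K)"
          by (simp add: sum_distrib_left case_prod_unfold)
        also have "(\<Sum>(t,K)\<in>p. measure lborel K) = b - a"
          using additive_content_tagged_division[of p a b] td ab by simp
        finally show ?thesis .
      qed
      have "(\<Sum>(t, K)\<in>p. measure lborel K *\<^sub>R f' t) - (x b - x a)
          = (\<Sum>(t, K)\<in>p. measure lborel K *\<^sub>R f' t - (x (Sup K) - x (Inf K)))"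
        using additive_tagged_division_1[OF ab td, of x] by (simp add: sum_subtractf case_prod_unfold)
      also have "norm \<dots> \<le> (\<Sum>(t, K)\<in>p. norm (measure lborel K *\<^sub>R f' t - (x (Sup K) - x (Inf K))))"
        by (simp add: case_prod_unfold sum_norm_le)
      also have "\<dots> = (\<Sum>(t, K)\<in>p - q. norm (measure lborel K *\<^sub>R f' t - (x (Sup K) - x (Inf K))))
           + (\<Sum>(t, K)\<in>q. norm (measure lborel K *\<^sub>R f' t - (x (Sup K) - x (Inf K))))"
        by (rule sum.subset_diff[OF qp fin])
      also have "(\<Sum>(t, K)\<in>q. norm (measure lborel K *\<^sub>R f' t - (x (Sup K) - x (Inf K))))
          = (\<Sum>(t, K)\<in>q. norm (x (Sup K) - x (Inf K)))"
        by (rule sum.cong) (auto simp: q_def f'_def norm_minus_commute)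
      also note rest
      also have "e1 * (b - a) \<le> e/2" using e ab by (simp add: e1_def field_simps)
      finally show "norm ((\<Sum>(t, K)\<in>p. measure lborel K *\<^sub>R f' t) - (x b - x a)) < e" using Nsum by linarith
    qed
  qed
  then show ?thesis by (rule has_integral_spike[OF N, rotated]) (auto simp: f'_def)
qed

text \<open>
  Lebesgue's differentiation theorem. At a point where the derivative fails at scale \<open>1/(k+1)\<close> there
  are arbitrarily short intervals on which the Riemann approximation is off by more than
  \<open>1/(k+1)\<close> times their length. By Vitali, disjoint such intervals cover the bad set up to a null
  set, while the Henstock lemma makes the sum of these errors as small as desired.
\<close>

lemma indefinite_integral_has_vector_derivative_ae:
  fixes f :: "real \<Rightarrow> 'b::euclidean_space"
  assumes f: "f integrable_on {a..b}"
  shows "\<exists>N. negligible N \<and> (\<forall>t\<in>{a..b} - N.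
     ((\<lambda>s. integral {a..s} f) has_vector_derivative f t) (at t within {a..b}))"
proof -
  define F where "F s = integral {a..s} f" for s
  have Fdiff: "F s - F t = integral {t..s} f" if "a \<le> t" "t \<le> s" "s \<le> b" for s t
    using Henstock_Kurzweil_Integration.integral_combine[of a t s f] that integrable_on_subinterval[OF f, of a s]
    by (auto simp: F_def algebra_simps)
  define bad where "bad k = {t\<in>{a..b}. \<forall>\<delta>>0. \<exists>s\<in>{a..b}. \<bar>s - t\<bar> < \<delta> \<and> s \<noteq> t \<and>
       norm (F s - F t - (s - t) *\<^sub>R f t) > \<bar>s - t\<bar> / (real k + 1)}" for k :: nat
  have "negligible (bad k)" for k
    unfolding negligible_outer_le
  proof (intro allI impI)
    fix e :: real assume e: "e > 0"
    have "f integrable_on cbox a b" "e / (real k + 1) > 0" using f e by auto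
    then obtain \<gamma> where \<gamma>: "gauge \<gamma>" "\<And>p. \<lbrakk>p tagged_partial_division_of (cbox a b); \<gamma> fine p\<rbrakk> \<Longrightarrow>
             sum (\<lambda>(x,K). norm(measure lborel K *\<^sub>R f x - integral K f)) p < e / (real k + 1)"
      by (rule Henstock_lemma) blast
    \<comment> \<open>A pair consists of a bad point \<open>t\<close> and a second point \<open>s\<close>, on either side, at which the quotient fails.\<close>
    define J where "J i = {min (fst i) (snd i)..max (fst i) (snd i)}" for i :: "real \<times> real"
    define Ix where "Ix = {(t, s). t \<in> bad k \<and> s \<in> {a..b} \<and> s \<noteq> t \<and> J (t, s) \<subseteq> \<gamma> t \<and>
        norm (F s - F t - (s - t) *\<^sub>R f t) > \<bar>s - t\<bar> / (real k + 1)}"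
    define c r where "c i = (fst i + snd i) / 2" and "r i = \<bar>snd i - fst i\<bar> / 2" for i :: "real \<times> real"
    have J: "cball (c i) (r i) = J i" for i
      by (auto simp: c_def r_def J_def cball_eq_atLeastAtMost min_def max_def field_simps abs_if)
    have "\<exists>i. i \<in> Ix \<and> t \<in> cball (c i) (r i) \<and> r i < d" if t: "t \<in> bad k" and d: "0 < d" for t d
    proof -
      have "open (\<gamma> t)" "t \<in> \<gamma> t" using \<gamma>(1) by (auto simp: gauge_def)
      then obtain \<rho> where \<rho>: "\<rho> > 0" "ball t \<rho> \<subseteq> \<gamma> t" using openE by blast
      have "min \<rho> d > 0" using \<rho> d by simp
      then obtain s where s: "s\<in>{a..b}" "\<bar>s - t\<bar> < min \<rho> d" "s \<noteq> t"
        "norm (F s - F t - (s - t) *\<^sub>R f t) > \<bar>s - t\<bar> / (real k + 1)"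
        using t unfolding bad_def by blast
      have "J (t, s) \<subseteq> ball t \<rho>" using s(2) by (auto simp: J_def dist_real_def min_def max_def split: if_splits)
      with \<rho> s t have "(t, s) \<in> Ix" by (auto simp: Ix_def)
      moreover have "t \<in> cball (c (t, s)) (r (t, s))" unfolding J by (auto simp: J_def)
      moreover have "r (t, s) < d" using s by (auto simp: r_def)
      ultimately show ?thesis by blast
    qed
    moreover have "0 < r i" if "i \<in> Ix" for i using that by (auto simp: Ix_def r_def)
    ultimately obtain C where C: "countable C" "C \<subseteq> Ix"
       "pairwise (\<lambda>i j. disjnt (cball (c i) (r i)) (cball (c j) (r j))) C"
       "negligible (bad k - (\<Union>i\<in>C. cball (c i) (r i)))"
      using Vitali_covering_theorem_cballs[of Ix r "bad k" c] by blast
    have Jm: "J i \<in> lmeasurable" for i by (simp add: J_def)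
    have fin_bound: "measure lebesgue (\<Union>i\<in>C'. J i) \<le> e" if C': "C' \<subseteq> C" "finite C'" for C'
    proof -
      define p where "p = (\<lambda>i. (fst i, J i)) ` C'"
      have mem: "fst i \<in> {a..b}" "snd i \<in> {a..b}" "snd i \<noteq> fst i" "J i \<subseteq> \<gamma> (fst i)"
         "norm (F (snd i) - F (fst i) - (snd i - fst i) *\<^sub>R f (fst i)) > \<bar>snd i - fst i\<bar> / (real k + 1)"
         if "i \<in> C'" for i
      proof -
        have "i \<in> Ix" using that C' C(2) by blast
        then show "fst i \<in> {a..b}" "snd i \<in> {a..b}" "snd i \<noteq> fst i" "J i \<subseteq> \<gamma> (fst i)"
         "norm (F (snd i) - F (fst i) - (snd i - fst i) *\<^sub>R f (fst i)) > \<bar>snd i - fst i\<bar> / (real k + 1)"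
          unfolding Ix_def bad_def by (cases i; force)+
      qed
      have disj: "J i \<inter> J j = {}" if "i \<in> C'" "j \<in> C'" "i \<noteq> j" for i j
        using that C(3) C' unfolding pairwise_def disjnt_def J by blast
      have ne: "J i \<noteq> {}" "fst i \<in> J i" for i by (auto simp: J_def)
      have inj: "inj_on (\<lambda>i. (fst i, J i)) C'"
        using disj ne by (intro inj_onI) (metis Int_absorb Pair_inject)
      have "p tagged_partial_division_of (cbox a b)"
        unfolding tagged_partial_division_of_def
      proof (intro conjI allI impI)
        show "finite p" using C' by (simp add: p_def)
        show "x \<in> K" "K \<subseteq> cbox a b" "\<exists>a b. K = cbox a b" if "(x, K) \<in> p" for x K
        proof -
          have "(x, K) \<in> (\<lambda>i. (fst i, J i)) ` C'" using that by (simp only: p_def)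
          then obtain i where i': "i \<in> C'" "(x, K) = (fst i, J i)" by (elim imageE) (rule that)
          then have i: "i \<in> C'" "x = fst i" "K = J i" by simp_all
          show "x \<in> K" using i ne by simp
          show "K \<subseteq> cbox a b" using i mem[of i] by (auto simp: J_def)
          show "\<exists>a b. K = cbox a b" using i by (metis J_def box_real(2))
        qed
        show "interior K1 \<inter> interior K2 = {}" if two: "(x1, K1) \<in> p \<and> (x2, K2) \<in> p \<and> (x1, K1) \<noteq> (x2, K2)" for x1 K1 x2 K2
        proof -
          from two have "(x1, K1) \<in> (\<lambda>i. (fst i, J i)) ` C'" "(x2, K2) \<in> (\<lambda>i. (fst i, J i)) ` C'"
            by (simp_all only: p_def)
          then obtain i j where "i \<in> C'" "(x1, K1) = (fst i, J i)" "j \<in> C'" "(x2, K2) = (fst j, J j)"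
            by (elim imageE) (rule that)
          with two disj[of i j] have "K1 \<inter> K2 = {}" by auto
          then show ?thesis using interior_subset by blast
        qed
      qed
      moreover have "\<gamma> fine p" using mem by (auto simp: fine_def p_def)
      ultimately have "sum (\<lambda>(x,K). norm(measure lborel K *\<^sub>R f x - integral K f)) p < e / (real k + 1)"
        by (rule \<gamma>(2))
      also have "sum (\<lambda>(x,K). norm(measure lborel K *\<^sub>R f x - integral K f)) p
          = (\<Sum>i\<in>C'. norm(measure lborel (J i) *\<^sub>R f (fst i) - integral (J i) f))"
        unfolding p_def by (subst sum.reindex[OF inj]) (simp add: o_def)
      also have "\<dots> = (\<Sum>i\<in>C'. norm (F (snd i) - F (fst i) - (snd i - fst i) *\<^sub>R f (fst i)))"
      proof (rule sum.cong[OF refl])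
        fix i assume i: "i \<in> C'"
        note m = mem[OF i]
        show "norm(measure lborel (J i) *\<^sub>R f (fst i) - integral (J i) f) = norm (F (snd i) - F (fst i) - (snd i - fst i) *\<^sub>R f (fst i))"
        proof (cases "fst i < snd i")
          case True
          then have "J i = {fst i..snd i}" by (simp add: J_def)
          with True Fdiff[of "fst i" "snd i"] m show ?thesis by (simp add: norm_minus_commute)
        next
          case False
          then have "J i = {snd i..fst i}" "snd i < fst i" using m by (auto simp: J_def)
          with Fdiff[of "snd i" "fst i"] m
          have "measure lborel (J i) *\<^sub>R f (fst i) - integral (J i) f = F (snd i) - F (fst i) - (snd i - fst i) *\<^sub>R f (fst i)"
            by (simp add: algebra_simps flip: Fdiff)
          then show ?thesis by simp
        qed
      qed
      finally have *: "(\<Sum>i\<in>C'. norm (F (snd i) - F (fst i) - (snd i - fst i) *\<^sub>R f (fst i))) < e / (real k + 1)" .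
      have "measure lebesgue (\<Union>i\<in>C'. J i) \<le> (\<Sum>i\<in>C'. measure lebesgue (J i))"
        using C' Jm by (intro measure_UNION_le) auto
      also have "\<dots> = (\<Sum>i\<in>C'. \<bar>snd i - fst i\<bar>)"
        by (rule sum.cong) (auto simp: J_def min_def max_def)
      also have "\<dots> \<le> (\<Sum>i\<in>C'. (real k + 1) * norm (F (snd i) - F (fst i) - (snd i - fst i) *\<^sub>R f (fst i)))"
      proof (rule sum_mono)
        fix i assume "i \<in> C'"
        from mem(5)[OF this] show "\<bar>snd i - fst i\<bar> \<le> (real k + 1) * norm (F (snd i) - F (fst i) - (snd i - fst i) *\<^sub>R f (fst i))"
          by (simp add: field_simps)
      qed
      also have "\<dots> \<le> (real k + 1) * (e / (real k + 1))"
        unfolding sum_distrib_left[symmetric] using * by (intro mult_left_mono) auto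
      also have "\<dots> = e" by simp
      finally show ?thesis .
    qed
    have "(\<Union>i\<in>C. J i) \<in> lmeasurable" "measure lebesgue (\<Union>i\<in>C. J i) \<le> e"
      using fmeasurable_UN_bound[OF C(1) Jm fin_bound] measure_UN_bound[OF C(1) Jm fin_bound] by auto
    note CB = this
    define R where "R = bad k - (\<Union>i\<in>C. J i)"
    have "negligible R" using C(4) by (simp add: J R_def)
    then have R: "R \<in> lmeasurable" "measure lebesgue R = 0"
      by (auto simp: negligible_imp_measurable negligible_imp_measure0)
    have "measure lebesgue (R \<union> (\<Union>i\<in>C. J i)) \<le> e"
      using measure_Un_le[of R lebesgue "\<Union>i\<in>C. J i"] R CB by auto
    then show "\<exists>T. bad k \<subseteq> T \<and> T \<in> lmeasurable \<and> measure lebesgue T \<le> e"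
      using R CB by (intro exI[of _ "R \<union> (\<Union>i\<in>C. J i)"] conjI fmeasurable.Un) (auto simp: R_def)
  qed
  then have "negligible (\<Union>k. bad k)" by (intro negligible_countable_Union) auto
  moreover have "(F has_vector_derivative f t) (at t within {a..b})" if t: "t \<in> {a..b} - (\<Union>k. bad k)" for t
    unfolding has_vector_derivative_def has_derivative_within_alt real_norm_def
  proof (intro conjI allI impI bounded_linear_scaleR_left)
    fix e :: real assume "e > 0"
    then obtain k :: nat where k: "1 / (real k + 1) < e" using nat_approx_posE by (metis Suc_eq_plus1 of_nat_Suc add.commute)
    from t have "t \<notin> bad k" "t \<in> {a..b}" by auto
    then obtain \<delta> where \<delta>: "\<delta> > 0" "\<And>s. s\<in>{a..b} \<Longrightarrow> \<bar>s - t\<bar> < \<delta> \<Longrightarrow> s \<noteq> t \<Longrightarrow> norm (F s - F t - (s - t) *\<^sub>R f t) \<le> \<bar>s - t\<bar> / (real k + 1)"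
      unfolding bad_def mem_Collect_eq not_all not_imp by (metis not_le)
    show "\<exists>d>0. \<forall>s\<in>{a..b}. \<bar>s - t\<bar> < d \<longrightarrow> norm (F s - F t - (s - t) *\<^sub>R f t) \<le> e * \<bar>s - t\<bar>"
    proof (intro exI[of _ \<delta>] conjI ballI impI \<delta>(1))
      fix s assume s: "s \<in> {a..b}" "\<bar>s - t\<bar> < \<delta>"
      show "norm (F s - F t - (s - t) *\<^sub>R f t) \<le> e * \<bar>s - t\<bar>"
      proof (cases "s = t")
        case False
        have "norm (F s - F t - (s - t) *\<^sub>R f t) \<le> (1 / (real k + 1)) * \<bar>s - t\<bar>" using \<delta>(2)[OF s False] by simp
        also have "\<dots> \<le> e * \<bar>s - t\<bar>" using k by (intro mult_right_mono) auto
        finally show ?thesis .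
      qed simp
    qed
  qed
  ultimately show ?thesis unfolding F_def by blast
qed

section \<open>Gronwall estimates\<close>

lemma exp_minus_lipschitz:
  fixes x y :: real
  assumes "x \<ge> 0" "y \<ge> 0"
  shows "\<bar>exp (- x) - exp (- y)\<bar> \<le> \<bar>x - y\<bar>"
proof -
  have *: "exp (- x) - exp (- y) \<le> y - x" if "0 \<le> x" "x \<le> y" for x y :: real
  proof -
    have "exp (- x) - exp (- y) = exp (- x) * (1 - exp (x - y))"
      by (simp add: algebra_simps flip: exp_add)
    also have "\<dots> \<le> 1 * (y - x)"
      using that exp_ge_add_one_self[of "x - y"] by (intro mult_mono) (auto simp del: exp_ge_add_one_self)
    finally show ?thesis by simp
  qed
  show ?thesis using *[of x y] *[of y x] assms by (cases "x \<le> y") (auto simp: abs_if)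
qed

text \<open>
  With \<open>v(t) = c + \<integral> L n\<close>, the product \<open>v exp(- \<integral> L)\<close> is absolutely continuous with
  derivative \<open>L (n - v) exp(- \<integral> L) \<le> 0\<close>.
\<close>

lemma gronwall:
  fixes n L :: "real \<Rightarrow> real"
  assumes n: "continuous_on {a..b} n" and L: "L absolutely_integrable_on {a..b}"
    and pos: "\<And>t. t \<in> {a..b} \<Longrightarrow> L t \<ge> 0"
    and le: "\<And>t. t \<in> {a..b} \<Longrightarrow> n t \<le> c + integral {a..t} (\<lambda>s. L s * n s)"
    and t: "t \<in> {a..b}"
  shows "n t \<le> c * exp (integral {a..t} L)"
proof -
  have ab: "a \<le> b" using t by auto
  define h where "h s = L s * n s" for s
  have h: "h absolutely_integrable_on {a..b}"
    unfolding h_def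
    using absolutely_integrable_bounded_measurable_product_real[OF _ _ _ L, of n] n
    by (auto simp: mult.commute continuous_imp_measurable_on_sets_lebesgue
         intro!: compact_imp_bounded compact_continuous_image)
  define v where "v s = c + integral {a..s} h" for s
  define \<Lambda> where "\<Lambda> s = integral {a..s} L" for s
  define E where "E s = exp (- \<Lambda> s)" for s
  have Li: "L integrable_on {a..b}" and hi: "h integrable_on {a..b}"
    using L h by (auto simp: absolutely_integrable_on_def)
  have \<Lambda>0: "\<Lambda> s \<ge> 0" if "s \<in> {a..b}" for s
    unfolding \<Lambda>_def using that pos by (intro integral_nonneg integrable_on_subinterval[OF Li]) auto
  obtain N1 where N1: "negligible N1" "\<And>s. s \<in> {a..b} - N1 \<Longrightarrow> ((\<lambda>s. integral {a..s} h) has_vector_derivative h s) (at s within {a..b})"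
    using indefinite_integral_has_vector_derivative_ae[OF hi] by blast
  obtain N2 where N2: "negligible N2" "\<And>s. s \<in> {a..b} - N2 \<Longrightarrow> (\<Lambda> has_vector_derivative L s) (at s within {a..b})"
    using indefinite_integral_has_vector_derivative_ae[OF Li] unfolding \<Lambda>_def by blast
  have acv: "absolutely_continuous_on_interval a b v"
    unfolding v_def by (rule ac_dominated[OF ac_indefinite_integral[OF h] ac_const[of _ _ "0::real"], where C=1]) auto
  have acE: "absolutely_continuous_on_interval a b E"
  proof (rule ac_dominated[OF ac_indefinite_integral[OF L] ac_const[of _ _ "0::real"], where C=1])
    fix s t assume "a \<le> s" "s \<le> t" "t \<le> b"
    then show "norm (E t - E s) \<le> 1 * (norm (integral {a..t} L - integral {a..s} L) + norm (0 - (0::real)))"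
      unfolding E_def using exp_minus_lipschitz[OF \<Lambda>0 \<Lambda>0, of t s] by (auto simp: \<Lambda>_def)
  qed simp
  define w where "w s = v s * E s" for s
  define w' where "w' s = L s * (n s - v s) * E s" for s
  have acw: "absolutely_continuous_on_interval a t w"
    unfolding w_def using ac_prod[OF acv acE bounded_bilinear_mult] t by (rule_tac ac_subinterval) auto
  have "(w' has_integral w t - w a) {a..t}"
  proof (rule ac_has_integral_derivative[OF _ acw negligible_Un[OF N1(1) N2(1)]])
    fix s assume s: "s \<in> {a..t} - (N1 \<union> N2)"
    have v: "(v has_real_derivative h s) (at s within {a..b})"
      unfolding v_def has_real_derivative_iff_has_vector_derivative
      using N1(2)[of s] s t by (auto intro!: derivative_eq_intros)
    have \<Lambda>: "(\<Lambda> has_real_derivative L s) (at s within {a..b})"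
      unfolding has_real_derivative_iff_has_vector_derivative using N2(2)[of s] s t by auto
    have "(w has_real_derivative w' s) (at s within {a..b})"
      unfolding w_def E_def by (rule derivative_eq_intros v \<Lambda> refl)+ (simp add: w'_def h_def E_def algebra_simps)
    then show "(w has_vector_derivative w' s) (at s within {a..t})"
      unfolding has_real_derivative_iff_has_vector_derivative
      by (rule has_vector_derivative_within_subset) (use t in auto)
  qed (use t in auto)
  moreover have "w' s \<le> 0" if "s \<in> {a..t}" for s
  proof -
    have "n s \<le> v s" using le[of s] that t unfolding v_def h_def by auto
    moreover have "L s \<ge> 0" using pos that t by auto
    ultimately show ?thesis
      unfolding w'_def E_def by (intro mult_nonpos_nonneg mult_nonneg_nonpos) auto
  qed
  ultimately have "w t - w a \<le> 0" by (rule has_integral_le[OF _ has_integral_0])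
  then have "v t * E t \<le> c" by (simp add: w_def v_def E_def \<Lambda>_def)
  then have "v t \<le> c * exp (\<Lambda> t)" by (simp add: E_def exp_minus field_simps)
  then show ?thesis using le[OF t] unfolding v_def h_def \<Lambda>_def by linarith
qed

lemma linear_growth_forward:
  fixes z Z :: "real \<Rightarrow> 'b::euclidean_space" and L r :: "real \<Rightarrow> real"
  assumes int: "\<And>s t. a \<le> s \<Longrightarrow> s \<le> t \<Longrightarrow> t \<le> b \<Longrightarrow> (Z has_integral z t - z s) {s..t}"
    and L: "L absolutely_integrable_on {a..b}" "\<And>t. t \<in> {a..b} \<Longrightarrow> L t \<ge> 0"
    and r: "r absolutely_integrable_on {a..b}" "\<And>t. t \<in> {a..b} \<Longrightarrow> r t \<ge> 0"
    and bd: "\<And>t. t \<in> {a..b} \<Longrightarrow> norm (Z t) \<le> L t * norm (z t) + r t"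
    and st: "a \<le> s" "s \<le> t" "t \<le> b"
  shows "norm (z t) \<le> (norm (z s) + integral {a..b} r) * exp (integral {a..b} L)"
proof -
  have Zi: "Z integrable_on {a..b}" using int[of a b] st by (auto intro: has_integral_integrable)
  have Li: "L integrable_on {a..b}" and ri: "r integrable_on {a..b}"
    using L r by (auto simp: absolutely_integrable_on_def)
  have zc: "continuous_on {a..b} z"
  proof -
    have "z a + integral {a..t} Z = z t" if "t \<in> {a..b}" for t
      using int[of a t] that by (auto simp: integral_unique)
    moreover have "continuous_on {a..b} (\<lambda>t. z a + integral {a..t} Z)"
      by (intro continuous_intros indefinite_integral_continuous_1 Zi)
    ultimately show ?thesis by (rule continuous_on_eq[rotated])
  qed
  have sub: "{s..b} \<subseteq> {a..b}" using st by auto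
  define c where "c = norm (z s) + integral {a..b} r"
  have c0: "c \<ge> 0" unfolding c_def using r(2) ri by (intro add_nonneg_nonneg integral_nonneg) auto
  have L': "L absolutely_integrable_on {s..b}" using L sub absolutely_integrable_on_subinterval by blast
  have zc': "continuous_on {s..b} (\<lambda>t. norm (z t))"
    using zc sub by (intro continuous_intros) (rule continuous_on_subset)
  have Ln: "(\<lambda>x. L x * norm (z x)) integrable_on {s..b}"
    using absolutely_integrable_bounded_measurable_product_real[OF _ _ _ L', of "\<lambda>t. norm (z t)"] zc'
    by (auto simp: mult.commute continuous_imp_measurable_on_sets_lebesgue absolutely_integrable_on_def
         intro!: compact_imp_bounded compact_continuous_image)
  have "norm (z t) \<le> c * exp (integral {s..t} L)"
  proof (rule gronwall[OF zc' L'])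
    fix u assume u: "u \<in> {s..b}"
    have ru: "r integrable_on {s..u}" using ri u st by (auto intro: integrable_on_subinterval)
    have Lu: "(\<lambda>x. L x * norm (z x)) integrable_on {s..u}" using Ln u by (auto intro: integrable_on_subinterval)
    have "norm (z u - z s) \<le> integral {s..u} (\<lambda>x. L x * norm (z x) + r x)"
    proof -
      have I: "(Z has_integral z u - z s) {s..u}" using int[of s u] u st by auto
      have "norm (integral {s..u} Z) \<le> integral {s..u} (\<lambda>x. L x * norm (z x) + r x)"
        using I ru Lu bd u st by (intro integral_norm_bound_integral integrable_add) (auto intro: has_integral_integrable)
      then show ?thesis using I by (simp add: integral_unique)
    qed
    also have "\<dots> = integral {s..u} (\<lambda>x. L x * norm (z x)) + integral {s..u} r"
      by (rule Henstock_Kurzweil_Integration.integral_add[OF Lu ru])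
    also have "integral {s..u} r \<le> integral {a..b} r"
      using ru ri r(2) u st by (intro integral_subset_le) auto
    finally show "norm (z u) \<le> c + integral {s..u} (\<lambda>s. L s * norm (z s))"
      using norm_triangle_sub[of "z u" "z s"] by (simp add: c_def)
  qed (use st L in auto)
  also have "\<dots> \<le> c * exp (integral {a..b} L)"
  proof -
    have "integral {s..t} L \<le> integral {a..b} L"
      using Li L(2) st by (intro integral_subset_le) (auto intro: integrable_on_subinterval)
    then show ?thesis using c0 by (intro mult_left_mono) auto
  qed
  finally show ?thesis by (simp add: c_def)
qed

text \<open>
  The symmetry in \<open>s\<close> and \<open>t\<close> is essential: the estimate is used forward in time for stability,
  and backward in time to invert the flow and the fundamental matrix. The backward direction is the
  forward one after time reflection.
\<close>

lemma linear_growth_bound: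
  fixes z Z :: "real \<Rightarrow> 'b::euclidean_space" and L r :: "real \<Rightarrow> real"
  assumes int: "\<And>s t. a \<le> s \<Longrightarrow> s \<le> t \<Longrightarrow> t \<le> b \<Longrightarrow> (Z has_integral z t - z s) {s..t}"
    and L: "L absolutely_integrable_on {a..b}" "\<And>t. t \<in> {a..b} \<Longrightarrow> L t \<ge> 0"
    and r: "r absolutely_integrable_on {a..b}" "\<And>t. t \<in> {a..b} \<Longrightarrow> r t \<ge> 0"
    and bd: "\<And>t. t \<in> {a..b} \<Longrightarrow> norm (Z t) \<le> L t * norm (z t) + r t"
    and st: "s \<in> {a..b}" "t \<in> {a..b}"
  shows "norm (z t) \<le> (norm (z s) + integral {a..b} r) * exp (integral {a..b} L)"
proof (cases "s \<le> t")
  case True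
  then show ?thesis using linear_growth_forward[OF int L r bd, where s=s and t=t] st by auto
next
  case False
  have "norm (z (- (- t))) \<le> (norm (z (- (- s))) + integral {-b..-a} (\<lambda>x. r (- x))) * exp (integral {-b..-a} (\<lambda>x. L (- x)))"
  proof (rule linear_growth_forward[where z="\<lambda>x. z (- x)" and Z="\<lambda>x. - Z (- x)"])
    fix u v assume uv: "- b \<le> u" "u \<le> v" "v \<le> - a"
    have "(Z has_integral z (-u) - z (-v)) {- v.. - u}" using int[of "-v" "-u"] uv by auto
    then have "((\<lambda>x. Z (-x)) has_integral z (-u) - z (-v)) {u..v}"
      by (rule iffD2[OF has_integral_reflect_real[of Z _ "-u" "-v", unfolded minus_minus]])
    from has_integral_neg[OF this]
    show "((\<lambda>x. - Z (- x)) has_integral z (- v) - z (- u)) {u..v}"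
      by (simp only: minus_diff_eq)
  next
    show "(\<lambda>x. L (- x)) absolutely_integrable_on {- b..- a}" "(\<lambda>x. r (- x)) absolutely_integrable_on {- b..- a}"
      using L r by (simp_all add: absolutely_integrable_reflect_real)
  qed (use False st L r bd in auto)
  then show ?thesis by simp
qed

section \<open>Measurable projection and dense families of selectors\<close>

text \<open>
  Projections of closed sets along the Baire space \<open>nat \<Rightarrow> nat\<close>, that is, analytic sets.
\<close>

definition souslin :: "'a::topological_space set \<Rightarrow> bool" where
  "souslin S \<longleftrightarrow> (\<exists>F :: ('a \<times> (nat \<Rightarrow> nat)) set. closed F \<and> S = fst ` F)"

lemma souslin_closed:
  assumes "closed S"
  shows "souslin S"
  unfolding souslin_def
proof (intro exI conjI)
  show "closed (S \<times> (UNIV :: (nat \<Rightarrow> nat) set))" by (intro closed_Times assms) auto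
qed simp

lemma closed_vimage_reindex:
  fixes F :: "('a::topological_space \<times> (nat \<Rightarrow> nat)) set" and \<sigma> :: "nat \<Rightarrow> nat"
  assumes "closed F"
  shows "closed {p. (fst p, \<lambda>i. snd p (\<sigma> i)) \<in> F}"
proof -
  have "continuous_on UNIV (\<lambda>p::'a \<times> (nat \<Rightarrow> nat). (fst p, \<lambda>i. snd p (\<sigma> i)))"
    by (intro continuous_on_Pair continuous_on_coordinatewise_then_product continuous_on_fst continuous_on_id
          continuous_on_compose2[OF continuous_on_product_coordinates continuous_on_snd]) auto
  from closed_vimage[OF assms this] show ?thesis by (simp add: vimage_def)
qed

text \<open>
  The first entry of the sequence chooses the member of the union, the remaining entries are its
  witness.
\<close>

lemma souslin_Union:
  assumes "\<And>n::nat. souslin (S n)"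
  shows "souslin (\<Union>n. S n)"
proof -
  have "\<forall>n. \<exists>F :: ('a \<times> (nat \<Rightarrow> nat)) set. closed F \<and> S n = fst ` F"
    using assms by (simp add: souslin_def)
  then obtain F :: "nat \<Rightarrow> ('a \<times> (nat \<Rightarrow> nat)) set" where F: "\<And>n. closed (F n)" "\<And>n. S n = fst ` F n"
    by metis
  define G where "G = {p. (fst p, \<lambda>i. snd p (Suc i)) \<in> F (snd p 0)}"
  have "G = (\<Inter>n. {p. snd p 0 \<noteq> n} \<union> {p. (fst p, \<lambda>i. snd p (Suc i)) \<in> F n})"
    by (auto simp: G_def)
  moreover have "closed {p::'a \<times> (nat \<Rightarrow> nat). snd p 0 \<noteq> n}" for n
  proof -
    have "continuous_on UNIV (\<lambda>p::'a \<times> (nat \<Rightarrow> nat). snd p 0)"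
      by (intro continuous_on_compose2[OF continuous_on_product_coordinates continuous_on_snd]) auto
    moreover have "closed (- {n})" by (simp add: closed_def open_discrete)
    ultimately have "closed ((\<lambda>p::'a \<times> (nat \<Rightarrow> nat). snd p 0) -` (- {n}))" by (intro closed_vimage)
    then show ?thesis by (simp add: vimage_def)
  qed
  ultimately have "closed G"
    using closed_vimage_reindex[OF F(1)] by (auto intro!: closed_INT closed_Un)
  moreover have "(\<Union>n. S n) = fst ` G"
  proof (intro set_eqI iffI)
    fix z assume "z \<in> (\<Union>n. S n)"
    then obtain n x where "(z, x) \<in> F n" using F(2) by auto
    then have "(z, case_nat n x) \<in> G" by (simp add: G_def)
    then show "z \<in> fst ` G" by force
  next
    fix z assume "z \<in> fst ` G"
    then obtain x where "(z, x) \<in> G" by auto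
    then have "(z, \<lambda>i. x (Suc i)) \<in> F (x 0)" by (simp add: G_def)
    then have "z \<in> S (x 0)" unfolding F(2) by force
    then show "z \<in> (\<Union>n. S n)" by blast
  qed
  ultimately show ?thesis unfolding souslin_def by blast
qed

text \<open>
  One sequence codes a witness for every member of the intersection, by the pairing of naturals.
\<close>

lemma souslin_Inter:
  assumes "\<And>n::nat. souslin (S n)"
  shows "souslin (\<Inter>n. S n)"
proof -
  have "\<forall>n. \<exists>F :: ('a \<times> (nat \<Rightarrow> nat)) set. closed F \<and> S n = fst ` F"
    using assms by (simp add: souslin_def)
  then obtain F :: "nat \<Rightarrow> ('a \<times> (nat \<Rightarrow> nat)) set" where F: "\<And>n. closed (F n)" "\<And>n. S n = fst ` F n"
    by metis
  define G where "G = (\<Inter>n. {p. (fst p, \<lambda>i. snd p (prod_encode (n, i))) \<in> F n})"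
  have "closed G"
    unfolding G_def by (intro closed_INT ballI closed_vimage_reindex F)
  moreover have "(\<Inter>n. S n) = fst ` G"
  proof (intro set_eqI iffI)
    fix z assume "z \<in> (\<Inter>n. S n)"
    then have "\<forall>n. \<exists>x. (z, x) \<in> F n" using F(2) by force
    then obtain x where x: "\<And>n. (z, x n) \<in> F n" by metis
    have "(z, \<lambda>k. x (fst (prod_decode k)) (snd (prod_decode k))) \<in> G" using x by (simp add: G_def)
    then show "z \<in> fst ` G" by force
  next
    fix z assume "z \<in> fst ` G"
    then obtain x where "(z, x) \<in> G" by auto
    then have "(z, \<lambda>i. x (prod_encode (n, i))) \<in> F n" for n by (simp add: G_def)
    then have "z \<in> S n" for n unfolding F(2) by force
    then show "z \<in> (\<Inter>n. S n)" by blast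
  qed
  ultimately show ?thesis unfolding souslin_def by blast
qed

lemma open_souslin:
  fixes S :: "'a::metric_space set"
  assumes "open S"
  shows "souslin S"
proof (cases "S = UNIV")
  case False
  have "S = (\<Union>n. {x. infdist x (- S) \<ge> 1 / (real n + 1)})"
  proof (intro set_eqI iffI)
    fix x assume "x \<in> S"
    then have "infdist x (- S) > 0"
      using False assms by (intro infdist_pos_not_in_closed) (auto simp: closed_def)
    then obtain n where "1 / (real n + 1) < infdist x (- S)"
      using nat_approx_posE by (metis Suc_eq_plus1 of_nat_Suc add.commute)
    then have "x \<in> {x. infdist x (- S) \<ge> 1 / (real n + 1)}" by simp
    then show "x \<in> (\<Union>n. {x. infdist x (- S) \<ge> 1 / (real n + 1)})" by blast
  next
    fix x assume "x \<in> (\<Union>n. {x. infdist x (- S) \<ge> 1 / (real n + 1)})"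
    then obtain n where "infdist x (- S) \<ge> 1 / (real n + 1)" by auto
    moreover have "1 / (real n + 1) > 0" by simp
    ultimately have "infdist x (- S) \<noteq> 0" by linarith
    then show "x \<in> S" by (metis ComplI infdist_zero)
  qed
  moreover
  have "closed {x. infdist x (- S) \<ge> 1 / (real n + 1)}" for n
    by (intro closed_Collect_le continuous_intros)
  then have "souslin (\<Union>n. {x. infdist x (- S) \<ge> 1 / (real n + 1)})"
    by (intro souslin_Union souslin_closed)
  ultimately show ?thesis by (simp only:)
qed (simp add: souslin_closed)

text \<open>
  The class of analytic sets is not closed under complements; the sets that are analytic together
  with their complement form a sigma-algebra.
\<close>

lemma borel_souslin:
  fixes S :: "'a::metric_space set"
  assumes "S \<in> sets borel"
  shows "souslin S"
proof -
  have "S \<in> sigma_sets UNIV {S. open S}" using assms by (simp add: borel_def)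
  then have "souslin S \<and> souslin (- S)"
  proof (induction rule: sigma_sets.induct)
    case (Basic S)
    then show ?case by (auto intro: open_souslin souslin_closed)
  next
    case Empty
    then show ?case by (auto intro: souslin_closed)
  next
    case (Compl S)
    then show ?case by (simp add: Compl_eq_Diff_UNIV[symmetric])
  next
    case (Union S)
    then show ?case by (auto intro: souslin_Union souslin_Inter simp: Compl_UN)
  qed
  then show ?thesis by simp
qed

lemma tendsto_fun_iff:
  fixes f :: "nat \<Rightarrow> 'i \<Rightarrow> 'b::topological_space"
  shows "f \<longlonglongrightarrow> l \<longleftrightarrow> (\<forall>i. (\<lambda>k. f k i) \<longlonglongrightarrow> l i)"
proof -
  have "limitin (product_topology (\<lambda>i. euclidean) UNIV) f l sequentially \<longleftrightarrow> (\<forall>i. (\<lambda>k. f k i) \<longlonglongrightarrow> l i)"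
    by (simp add: limitin_componentwise)
  then show ?thesis by (simp add: euclidean_product_topology)
qed

lemma compact_fun_le: "compact {x::nat \<Rightarrow> nat. \<forall>i. x i \<le> n i}"
proof -
  have "compactin (product_topology (\<lambda>i. euclidean) UNIV) (PiE UNIV (\<lambda>i. {..n i}))"
    by (simp add: compactin_PiE finite_imp_compact)
  then have "compact (PiE UNIV (\<lambda>i. {..n i}))" by (simp add: euclidean_product_topology)
  moreover have "PiE UNIV (\<lambda>i. {..n i}) = {x::nat \<Rightarrow> nat. \<forall>i. x i \<le> n i}"
    by (auto simp: PiE_UNIV_domain)
  ultimately show ?thesis by simp
qed

text \<open>
  Choquet's capacitability argument. Outer measure is continuous along increasing unions, so the
  coordinates of the witness sequence can be bounded one after another, by \<open>n 0\<close>, \<open>n 1\<close>, ...,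
  keeping the outer measure of the projection above \<open>M\<close>. The sequences bounded by \<open>n\<close> form a
  compact set, and compactness shows that every open neighbourhood of the resulting compact set
  \<open>K\<close> already contains one of the finite stages.
\<close>

lemma souslin_projection_inner:
  fixes A :: "('a::euclidean_space \<times> 'b::euclidean_space) set"
  assumes A: "souslin A" and B: "A \<subseteq> B" "compact B" and M: "M < outer_measure_of lebesgue (fst ` A)"
  shows "\<exists>K. compact K \<and> K \<subseteq> A \<and> M \<le> emeasure lebesgue (fst ` K)"
proof -
  obtain F :: "(('a \<times> 'b) \<times> (nat \<Rightarrow> nat)) set" where F: "closed F" "A = fst ` F"
    using A unfolding souslin_def by auto
  define S where "S k n = {z. \<exists>x. (z, x) \<in> F \<and> (\<forall>i<k. x i \<le> n i)}" for k and n :: "nat \<Rightarrow> nat"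
  have S0: "S 0 n = A" for n unfolding S_def F(2) by force
  have step: "\<exists>n'. M < outer_measure_of lebesgue (fst ` S (Suc k) n') \<and> (\<forall>i<k. n' i = n i)"
    if *: "M < outer_measure_of lebesgue (fst ` S k n)" for k n
  proof -
    have eq: "fst ` S k n = (\<Union>m. fst ` S (Suc k) (n(k := m)))"
    proof -
      have "S k n = (\<Union>m. S (Suc k) (n(k := m)))"
      proof (intro set_eqI iffI)
        fix z assume "z \<in> S k n"
        then obtain x where "(z, x) \<in> F" "\<forall>i<k. x i \<le> n i" by (auto simp: S_def)
        then have "z \<in> S (Suc k) (n(k := x k))" by (auto simp: S_def less_Suc_eq)
        then show "z \<in> (\<Union>m. S (Suc k) (n(k := m)))" by blast
      next
        fix z assume "z \<in> (\<Union>m. S (Suc k) (n(k := m)))"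
        then obtain m x where x: "(z, x) \<in> F" "\<forall>i<Suc k. x i \<le> (n(k := m)) i" by (auto simp: S_def)
        have "x i \<le> n i" if "i < k" for i using x(2)[rule_format, of i] that by simp
        with x show "z \<in> S k n" unfolding S_def by blast
      qed
      then show ?thesis by (simp add: image_UN)
    qed
    have "incseq (\<lambda>m. fst ` S (Suc k) (n(k := m)))"
    proof (intro incseq_SucI image_mono)
      show "S (Suc k) (n(k := m)) \<subseteq> S (Suc k) (n(k := Suc m))" for m
      proof
        fix z assume "z \<in> S (Suc k) (n(k := m))"
        then obtain x where x: "(z, x) \<in> F" "\<forall>i<Suc k. x i \<le> (n(k := m)) i" by (auto simp: S_def)
        have "x i \<le> (n(k := Suc m)) i" if "i < Suc k" for i
          using x(2)[rule_format, OF that] by (auto split: if_splits)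
        with x(1) show "z \<in> S (Suc k) (n(k := Suc m))" unfolding S_def by blast
      qed
    qed
    then have "M < (SUP m. outer_measure_of lebesgue (fst ` S (Suc k) (n(k := m))))"
      using * unfolding eq by (subst SUP_outer_measure_of_incseq) auto
    then obtain m where "M < outer_measure_of lebesgue (fst ` S (Suc k) (n(k := m)))"
      by (auto simp: less_SUP_iff)
    then show ?thesis by (intro exI[of _ "n(k := m)"]) auto
  qed
  have "\<exists>N. \<forall>k. M < outer_measure_of lebesgue (fst ` S k (N k)) \<and> (\<forall>i<k. N (Suc k) i = N k i)"
  proof (rule dependent_nat_choice)
    show "\<exists>n. M < outer_measure_of lebesgue (fst ` S 0 n)" using M S0 by simp
  qed (use step in blast)
  then obtain N where N: "\<And>k. M < outer_measure_of lebesgue (fst ` S k (N k))" "\<And>k i. i < k \<Longrightarrow> N (Suc k) i = N k i"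
    by blast
  define n where "n i = N (Suc i) i" for i
  have Nn: "N k i = n i" if "i < k" for k i
    using that
  proof (induction k)
    case (Suc k)
    then show ?case using N(2)[of i k] by (cases "i = k") (auto simp: n_def)
  qed simp
  have Sn: "S k (N k) = S k n" for k using Nn by (simp add: S_def)
  define C where "C = {x::nat \<Rightarrow> nat. \<forall>i. x i \<le> n i}"
  define K where "K = fst ` (F \<inter> (B \<times> C))"
  have KA: "K \<subseteq> A" unfolding K_def F(2) by blast
  have Kc: "compact K" unfolding K_def
    by (intro compact_continuous_image closed_Int_compact F(1) compact_Times B(2) continuous_on_fst continuous_on_id)
       (simp add: C_def compact_fun_le)
  have fKc: "compact (fst ` K)" by (intro compact_continuous_image Kc continuous_on_fst continuous_on_id)
  have "M \<le> emeasure lebesgue (fst ` K)"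
  proof (rule ccontr)
    assume "\<not> M \<le> emeasure lebesgue (fst ` K)"
    then have less: "emeasure lebesgue (fst ` K) < M" by simp
    have fKb: "fst ` K \<in> sets borel" using fKc by (simp add: borel_compact)
    obtain W where W: "open W" "fst ` K \<subseteq> W" "emeasure lborel W < M"
    proof -
      have eq: "emeasure lebesgue (fst ` K) = emeasure lborel (fst ` K)" using fKb by simp
      obtain q where q: "emeasure lborel (fst ` K) < q" "q < M" using less eq dense by metis
      have qfin: "q < top" by (rule less_le_trans[OF q(2) top_greatest])
      then have Kfin: "emeasure lborel (fst ` K) < top" using q(1) by (rule less_trans[rotated])
      obtain q' where q': "q = ennreal q'" "q' \<ge> 0" using qfin by (cases q) auto
      obtain a' where a': "emeasure lborel (fst ` K) = ennreal a'" "a' \<ge> 0"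
        using Kfin by (cases "emeasure lborel (fst ` K)") auto
      have "a' < q'" using q a' q' by (simp add: ennreal_less_iff)
      then obtain W where W: "open W" "fst ` K \<subseteq> W" "emeasure lborel (W - fst ` K) < ennreal (q' - a')"
        using outer_regular_lborel[OF fKb, of "q' - a'"] by auto
      have "emeasure lborel W = emeasure lborel (fst ` K) + emeasure lborel (W - fst ` K)"
        using W fKb by (subst plus_emeasure) (auto simp: Un_absorb1)
      also have "\<dots> \<le> ennreal a' + ennreal (q' - a')" using W a' by (intro add_mono) auto
      also have "\<dots> = q" using a' q' \<open>a' < q'\<close> by (simp flip: ennreal_plus)
      finally show thesis using that W q by (meson le_less_trans)
    qed
    have "\<exists>k. fst ` S k n \<subseteq> W"
    proof (rule ccontr)
      assume neg: "\<not> (\<exists>k. fst ` S k n \<subseteq> W)"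
      have "\<exists>p. p \<in> F \<and> (\<forall>i<k. snd p i \<le> n i) \<and> fst (fst p) \<notin> W" for k
      proof -
        obtain z where z: "z \<in> S k n" "fst z \<notin> W" using neg by blast
        then obtain x where "(z, x) \<in> F" "\<forall>i<k. x i \<le> n i" by (auto simp: S_def)
        with z(2) show ?thesis by (intro exI[of _ "(z, x)"]) auto
      qed
      then obtain p where p: "\<And>k. p k \<in> F \<and> (\<forall>i<k. snd (p k) i \<le> n i) \<and> fst (fst (p k)) \<notin> W"
        by metis
      define z where "z k = fst (p k)" for k
      define x where "x k = snd (p k)" for k
      have zx: "\<And>k. (z k, x k) \<in> F" "\<And>k i. i < k \<Longrightarrow> x k i \<le> n i" "\<And>k. fst (z k) \<notin> W"
        using p by (auto simp: z_def x_def)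
      \<comment> \<open>The stage \<open>k\<close> bounds only the first \<open>k\<close> coordinates; truncation moves the witnesses into the compact set \<open>C\<close> and does not change their limits.\<close>
      define y where "y k i = (if i < k then x k i else 0)" for k i
      have "(z k, y k) \<in> B \<times> C" for k
      proof -
        have "z k \<in> A" unfolding F(2) using zx(1)[of k] by (metis fst_conv imageI)
        then show ?thesis using B zx(2) by (auto simp: y_def C_def)
      qed
      then have all: "\<forall>k. (z k, y k) \<in> B \<times> C" by blast
      have "seq_compact (B \<times> C)"
        by (intro compact_imp_seq_compact compact_Times B(2)) (simp add: C_def compact_fun_le)
      from this all obtain l r where l: "l \<in> B \<times> C" "strict_mono (r :: nat \<Rightarrow> nat)" "((\<lambda>k. (z k, y k)) \<circ> r) \<longlonglongrightarrow> l"
        by (rule seq_compactE)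
      have lz: "(\<lambda>k. z (r k)) \<longlonglongrightarrow> fst l" and ly: "(\<lambda>k. y (r k)) \<longlonglongrightarrow> snd l"
        using tendsto_fst[OF l(3)] tendsto_snd[OF l(3)] by (simp_all add: o_def)
      have lx: "(\<lambda>k. x (r k)) \<longlonglongrightarrow> snd l"
        unfolding tendsto_fun_iff
      proof
        fix i
        have yi: "(\<lambda>k. y (r k) i) \<longlonglongrightarrow> snd l i" using ly by (simp add: tendsto_fun_iff)
        have ev: "\<forall>\<^sub>F k in sequentially. y (r k) i = x (r k) i"
          using eventually_gt_at_top[of i]
        proof eventually_elim
          case (elim k)
          then have "i < r k" using seq_suble[OF l(2), of k] by simp
          then show ?case by (simp add: y_def)
        qed
        show "(\<lambda>k. x (r k) i) \<longlonglongrightarrow> snd l i" by (rule Lim_transform_eventually[OF yi ev])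
      qed
      have "(\<lambda>k. (z (r k), x (r k))) \<longlonglongrightarrow> (fst l, snd l)" by (intro tendsto_Pair lz lx)
      then have "(fst l, snd l) \<in> F" by (rule closed_sequentially[OF F(1), rotated]) (rule zx(1))
      with l(1) have "fst l \<in> K" unfolding K_def by (intro image_eqI[of _ _ l]) auto
      then have "fst (fst l) \<in> W" using W by blast
      moreover have "fst (fst l) \<in> - W"
        
        by (rule closed_sequentially[OF _ _ tendsto_fst[OF lz]]) (use zx(3) W(1) in auto)
      ultimately show False by simp
    qed
    then obtain k where "fst ` S k n \<subseteq> W" ..
    then have "outer_measure_of lebesgue (fst ` S k n) \<le> emeasure lebesgue W"
      using outer_measure_of_mono[of _ W lebesgue] W(1) by simp
    with N(1)[of k] W show False unfolding Sn by (simp add: W(1))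
  qed
  with Kc KA show ?thesis by blast
qed

text \<open>
  Compact subsets of a bounded piece of \<open>A\<close> have projections whose measures approach the outer
  measure of the whole projection, so the latter is a countable union of compact sets up to a null
  set.
\<close>

theorem borel_projection_lebesgue:
  fixes A :: "('a::euclidean_space \<times> 'b::euclidean_space) set"
  assumes A: "A \<in> sets borel"
  shows "fst ` A \<in> sets lebesgue"
proof -
  have bdd: "fst ` (A \<inter> B) \<in> sets lebesgue" if B: "compact B" for B
  proof -
    define P where "P = fst ` (A \<inter> B)"
    define c where "c = outer_measure_of lebesgue P"
    have sAB: "souslin (A \<inter> B)"
      using A B by (intro borel_souslin sets.Int) (auto simp: borel_compact)
    obtain E where E: "E \<in> sets lebesgue" "P \<subseteq> E" "c = emeasure lebesgue E"
      unfolding c_def using outer_measure_of_attain[of P lebesgue] by auto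
    have cfin: "c < \<infinity>"
    proof -
      have cB: "compact (fst ` B)" by (intro compact_continuous_image B continuous_on_fst continuous_on_id)
      have "c \<le> emeasure lebesgue (fst ` B)"
        unfolding c_def P_def using outer_measure_of_mono[of "fst ` (A \<inter> B)" "fst ` B" lebesgue] cB
        by (auto simp: outer_measure_of_eq lmeasurable_compact fmeasurableD)
      also have "\<dots> < \<infinity>" using lmeasurable_compact[OF cB] unfolding fmeasurable_def by (simp del: emeasure_completion)
      finally show ?thesis .
    qed
    have inner: "\<exists>K. K \<in> sets lebesgue \<and> K \<subseteq> P \<and> M \<le> emeasure lebesgue K" if "M < c" for M
    proof -
      have "M < outer_measure_of lebesgue (fst ` (A \<inter> B))" using that by (simp only: c_def P_def)
      from souslin_projection_inner[OF sAB Int_lower2 B this]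
      obtain K where K: "compact K" "K \<subseteq> A \<inter> B" "M \<le> emeasure lebesgue (fst ` K)" by blast
      have "compact (fst ` K)" by (intro compact_continuous_image K continuous_on_fst continuous_on_id)
      then show ?thesis using K by (intro exI[of _ "fst ` K"]) (auto simp: P_def lmeasurable_compact fmeasurableD)
    qed
    have "\<exists>Q. Q \<in> sets lebesgue \<and> Q \<subseteq> P \<and> c \<le> emeasure lebesgue Q"
    proof (cases "c = 0")
      case False
      obtain c' where c': "c = ennreal c'" "c' \<ge> 0" using cfin by (cases c) auto
      with False have "c' > 0" by (cases "c' = 0") auto
      then have "ennreal (c' - 1 / real (Suc n)) < c" for n
        unfolding c' by (intro ennreal_lessI) auto
      then have "\<forall>n. \<exists>K. K \<in> sets lebesgue \<and> K \<subseteq> P \<and> ennreal (c' - 1 / real (Suc n)) \<le> emeasure lebesgue K"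
        using inner by blast
      then obtain K where K: "\<And>n. K n \<in> sets lebesgue" "\<And>n. K n \<subseteq> P" "\<And>n. ennreal (c' - 1 / real (Suc n)) \<le> emeasure lebesgue (K n)"
        by metis
      have "ennreal (c' - 1 / real (Suc n)) \<le> emeasure lebesgue (\<Union>n. K n)" for n
        using K(1) by (intro order_trans[OF K(3) emeasure_mono]) auto
      moreover have "(\<lambda>n. ennreal (c' - 1 / real (Suc n))) \<longlonglongrightarrow> ennreal (c' - 0)"
        by (intro tendsto_ennrealI tendsto_diff tendsto_const LIMSEQ_Suc lim_1_over_n)
      ultimately have "c \<le> emeasure lebesgue (\<Union>n. K n)"
        unfolding c' by (intro LIMSEQ_le_const2[of _ "ennreal c'"]) auto
      then show ?thesis using K by (intro exI[of _ "\<Union>n. K n"]) auto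
    qed (auto intro: exI[of _ "{}"])
    then obtain Q where Q: "Q \<in> sets lebesgue" "Q \<subseteq> P" "c \<le> emeasure lebesgue Q" by blast
    have "emeasure lebesgue (E - Q) = emeasure lebesgue E - emeasure lebesgue Q"
      using Q E cfin emeasure_mono[of Q E lebesgue] by (intro emeasure_Diff) (auto simp: less_top[symmetric])
    then have "emeasure lebesgue (E - Q) = 0" using Q E cfin by (simp add: diff_eq_0_iff_ennreal)
    then have "E - Q \<in> null_sets lebesgue" using E Q by auto
    then have "P - Q \<in> sets lebesgue"
      using null_sets_completion_subset[of "P - Q" "E - Q" lborel] E by auto
    then have "Q \<union> (P - Q) \<in> sets lebesgue" using Q by blast
    moreover have "Q \<union> (P - Q) = P" using Q by blast
    ultimately show ?thesis by (simp add: P_def)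
  qed
  have "fst ` A = (\<Union>n::nat. fst ` (A \<inter> cball 0 (real n)))"
  proof -
    have "A = (\<Union>n::nat. A \<inter> cball 0 (real n))"
      using real_arch_simple by auto
    then show ?thesis by (metis image_UN)
  qed
  moreover have "(\<Union>n::nat. fst ` (A \<inter> cball 0 (real n))) \<in> sets lebesgue"
    by (intro sets.countable_UN') (auto intro: bdd)
  ultimately show ?thesis by simp
qed

lemma dense_sequence_exists:
  "\<exists>d :: nat \<Rightarrow> 'a::{metric_space, second_countable_topology}. \<forall>x e. 0 < e \<longrightarrow> (\<exists>j. dist x (d j) < e)"
proof -
  obtain D :: "'a set" where D: "countable D" "\<And>X. open X \<Longrightarrow> X \<noteq> {} \<Longrightarrow> \<exists>d\<in>D. d \<in> X"
    using countable_dense_setE by blast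
  have "D \<noteq> {}" using D(2)[of UNIV] by auto
  with D(1) have range: "range (from_nat_into D) = D" by (rule range_from_nat_into[rotated])
  have "\<exists>j. dist x (from_nat_into D j) < e" if "0 < e" for x e
  proof -
    have "ball x e \<noteq> {}" using that by simp
    then obtain y where "y \<in> D" "y \<in> ball x e" using D(2)[of "ball x e"] by auto
    then show ?thesis using range by (metis imageE mem_ball)
  qed
  then show ?thesis by blast
qed

lemma lebesgue_measurable_eq_borel_ae:
  fixes f :: "real \<Rightarrow> 'u::euclidean_space"
  assumes f: "f \<in> borel_measurable lebesgue"
  shows "\<exists>g\<in>borel_measurable borel. AE t in lborel. f t = g t"
proof -
  have "\<exists>g'\<in>borel_measurable lborel. AE t in lborel. f t \<bullet> b = g' t" for b
    using f by (intro completion_ex_borel_measurable_real) simp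
  then have "\<forall>b. \<exists>g'. g' \<in> borel_measurable lborel \<and> (AE t in lborel. f t \<bullet> b = g' t)" by blast
  from choice[OF this] obtain g where "\<forall>b. g b \<in> borel_measurable lborel \<and> (AE t in lborel. f t \<bullet> b = g b t)" ..
  then have g: "\<And>b. g b \<in> borel_measurable lborel" "\<And>b. AE t in lborel. f t \<bullet> b = g b t"
    by blast+
  define h where "h t = (\<Sum>b\<in>Basis. g b t *\<^sub>R b)" for t
  have "AE t in lborel. \<forall>b\<in>Basis. f t \<bullet> b = g b t"
    using g(2) by (intro AE_finite_allI) auto
  then have "AE t in lborel. f t = h t"
  proof eventually_elim
    case (elim t)
    have "f t = (\<Sum>b\<in>Basis. (f t \<bullet> b) *\<^sub>R b)" by (rule euclidean_representation[symmetric])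
    also have "\<dots> = h t" unfolding h_def using elim by (intro sum.cong) auto
    finally show ?case .
  qed
  moreover have "h \<in> borel_measurable borel" using g(1) unfolding h_def by simp
  ultimately show ?thesis by blast
qed

text \<open>
  A Lebesgue measurable selection agrees almost everywhere with a Borel one; on the exceptional
  Borel null set the given selector \<open>u0\<close> is used, so that the values stay in \<open>U t\<close>.
\<close>

lemma selectors_modify:
  fixes U :: "real \<Rightarrow> 'u::euclidean_space set"
  assumes u0: "u0 \<in> selectors U" and w: "w \<in> borel_measurable lebesgue"
    and wU: "\<And>t. 0 \<le> t \<Longrightarrow> w t \<in> U t"
  shows "\<exists>u\<in>selectors U. AE t in lborel. 0 \<le> t \<longrightarrow> u t = w t"
proof -
  obtain g where g: "g \<in> borel_measurable borel" "AE t in lborel. w t = g t"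
    using lebesgue_measurable_eq_borel_ae[OF w] by blast
  obtain N where N0: "{t \<in> space lborel. \<not> w t = g t} \<subseteq> N" "N \<in> null_sets lborel"
    using g(2) unfolding eventually_ae_filter by blast
  then have N: "w t = g t" if "t \<notin> N" for t using that by auto
  have Nb: "N \<in> sets borel" using N0(2) by auto
  define u where "u t = (if t \<in> N then u0 t else g t)" for t
  have "u \<in> selectors U"
    unfolding selectors_def
  proof (intro CollectI conjI allI impI)
    show "u \<in> borel_measurable (restrict_space borel {0..})"
      unfolding u_def
    proof (rule measurable_If_set)
      show "u0 \<in> borel_measurable (restrict_space borel {0..})" using u0 by (simp add: selectors_def)
      show "g \<in> borel_measurable (restrict_space borel {0..})" using g by (intro measurable_restrict_space1)
      show "N \<inter> space (restrict_space borel {0..}) \<in> sets (restrict_space borel {0..})"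
        using Nb by (auto simp: sets_restrict_space space_restrict_space)
    qed
    show "u t \<in> U t" if "0 \<le> t" for t
      using that u0 wU[OF that] N[of t] by (auto simp: u_def selectors_def)
  qed
  moreover have "AE t in lborel. t \<notin> N" using N0 by (intro AE_not_in) auto
  then have "AE t in lborel. 0 \<le> t \<longrightarrow> u t = w t" using g(2) by eventually_elim (auto simp: u_def)
  ultimately show ?thesis by blast
qed

text \<open>
  The construction of Kuratowski and Ryll-Nardzewski: approximate selections \<open>v n\<close> with values in
  a dense sequence, each within \<open>2\<^sup>-\<^sup>n\<close> of \<open>V t\<close> and close to its predecessor, converge to a
  selection. Choosing the first admissible index keeps everything measurable.
\<close>

lemma measurable_selection:
  fixes V :: "real \<Rightarrow> 'u::euclidean_space set"
  assumes graph: "{(t, u). u \<in> V t} \<in> sets borel" and cl: "\<And>t. closed (V t)"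
  shows "\<exists>v\<in>borel_measurable lebesgue. \<forall>t. V t \<noteq> {} \<longrightarrow> v t \<in> V t"
proof -
  have proj: "{t. V t \<inter> C \<noteq> {}} \<in> sets lebesgue" if "closed C" for C
  proof -
    have "{(t, u). u \<in> V t} \<inter> (UNIV \<times> C) \<in> sets borel"
      using that by (intro sets.Int graph borel_closed closed_Times) auto
    then have "fst ` ({(t, u). u \<in> V t} \<inter> (UNIV \<times> C)) \<in> sets lebesgue" by (rule borel_projection_lebesgue)
    also have "fst ` ({(t, u). u \<in> V t} \<inter> (UNIV \<times> C)) = {t. V t \<inter> C \<noteq> {}}" by force
    finally show ?thesis .
  qed
  obtain d :: "nat \<Rightarrow> 'u" where dense: "\<And>x e. e > 0 \<Longrightarrow> \<exists>j. dist x (d j) < e"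
    using dense_sequence_exists by metis
  define B where "B n j = cball (d j) ((1/2)^n)" for n j
  define idx where "idx = rec_nat (\<lambda>t. LEAST j. V t \<inter> B 0 j \<noteq> {})
     (\<lambda>n i t. LEAST j. V t \<inter> (B n (i t) \<inter> B (Suc n) j) \<noteq> {})"
  have idx0: "idx 0 t = (LEAST j. V t \<inter> B 0 j \<noteq> {})" for t by (simp add: idx_def)
  have idxS: "idx (Suc n) t = (LEAST j. V t \<inter> (B n (idx n t) \<inter> B (Suc n) j) \<noteq> {})" for n t
    by (simp add: idx_def)
  have meas: "idx n \<in> measurable lebesgue (count_space UNIV)" for n
  proof (induction n)
    case 0
    have "Measurable.pred lebesgue (\<lambda>t. V t \<inter> B 0 j \<noteq> {})" for j
      unfolding pred_def using proj[of "B 0 j"] by (simp add: B_def)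
    then show ?case unfolding idx0 by (intro measurable_Least)
  next
    case (Suc n)
    have "Measurable.pred lebesgue (\<lambda>t. V t \<inter> (B n i \<inter> B (Suc n) j) \<noteq> {})" for i j
      unfolding pred_def using proj[of "B n i \<inter> B (Suc n) j"] by (simp add: B_def closed_Int)
    then have "Measurable.pred lebesgue (\<lambda>t. V t \<inter> (B n (idx n t) \<inter> B (Suc n) j) \<noteq> {})" for j
      by (rule measurable_compose_countable[OF _ Suc])
    then show ?case unfolding idxS by (intro measurable_Least)
  qed
  define v where "v n t = d (idx n t)" for n t
  have vm: "v n \<in> borel_measurable lebesgue" for n
    unfolding v_def by (rule measurable_compose[OF meas]) simp
  have hit: "V t \<inter> B n (idx n t) \<noteq> {}" if ne: "V t \<noteq> {}" for t n
  proof (induction n)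
    case 0
    obtain y where y: "y \<in> V t" using ne by blast
    obtain j where "dist y (d j) < 1" using dense[of 1 y] by auto
    then have "V t \<inter> B 0 j \<noteq> {}" using y by (auto simp: B_def dist_commute)
    then show ?case unfolding idx0 by (rule LeastI)
  next
    case (Suc n)
    then obtain y where y: "y \<in> V t" "y \<in> B n (idx n t)" by blast
    obtain j where "dist y (d j) < (1/2)^Suc n" using dense[of "(1/2)^Suc n" y] by auto
    then have "V t \<inter> (B n (idx n t) \<inter> B (Suc n) j) \<noteq> {}" using y by (auto simp: B_def dist_commute)
    then have "V t \<inter> (B n (idx n t) \<inter> B (Suc n) (idx (Suc n) t)) \<noteq> {}" unfolding idxS by (rule LeastI)
    then show ?case by blast
  qed
  have near: "dist (v n t) (v (Suc n) t) \<le> 2 * (1/2)^n" if ne: "V t \<noteq> {}" for t n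
  proof -
    obtain y where y: "y \<in> V t" "y \<in> B n (idx n t)" using hit[OF ne, of n] by blast
    obtain j where "dist y (d j) < (1/2)^Suc n" using dense[of "(1/2)^Suc n" y] by auto
    then have "V t \<inter> (B n (idx n t) \<inter> B (Suc n) j) \<noteq> {}" using y by (auto simp: B_def dist_commute)
    then have "V t \<inter> (B n (idx n t) \<inter> B (Suc n) (idx (Suc n) t)) \<noteq> {}" unfolding idxS by (rule LeastI)
    then obtain y where "dist (v n t) y \<le> (1/2)^n" "dist (v (Suc n) t) y \<le> (1/2)^Suc n"
      by (auto simp: B_def v_def)
    then have "dist (v n t) (v (Suc n) t) \<le> (1/2)^n + (1/2)^Suc n"
      using dist_triangle2[of "v n t" "v (Suc n) t" y] by linarith
    also have "\<dots> \<le> 2 * (1/2)^n" by simp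
    finally show ?thesis .
  qed
  have conv: "convergent (\<lambda>n. v n t)" if ne: "V t \<noteq> {}" for t
  proof -
    have "summable (\<lambda>n. v (Suc n) t - v n t)"
    proof (rule summable_comparison_test')
      show "summable (\<lambda>n. 2 * (1/2::real)^n)" by (intro summable_mult summable_geometric) simp
      show "norm (v (Suc n) t - v n t) \<le> 2 * (1/2)^n" for n
        using near[OF ne, of n] by (simp add: dist_norm norm_minus_commute)
    qed
    then have "convergent (\<lambda>n. \<Sum>i<n. v (Suc i) t - v i t)" by (simp add: summable_iff_convergent)
    then have "convergent (\<lambda>n. v n t - v 0 t)"
      unfolding sum_lessThan_telescope[of "\<lambda>n. v n t"] .
    from convergent_add[OF this convergent_const[of "v 0 t"]] show ?thesis by (simp add: fun_eq_iff)
  qed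
  have lim_in: "lim (\<lambda>n. v n t) \<in> V t" if ne: "V t \<noteq> {}" for t
  proof -
    have "\<forall>n. \<exists>y. y \<in> V t \<and> dist (v n t) y \<le> (1/2)^n"
    proof
      fix n
      obtain y where "y \<in> V t \<inter> B n (idx n t)" using hit[OF ne, of n] by blast
      then show "\<exists>y. y \<in> V t \<and> dist (v n t) y \<le> (1/2)^n" by (auto simp: B_def v_def)
    qed
    from choice[OF this] obtain y where "\<forall>n. y n \<in> V t \<and> dist (v n t) (y n) \<le> (1/2)^n" ..
    then have y: "\<And>n. y n \<in> V t" "\<And>n. dist (v n t) (y n) \<le> (1/2)^n" by blast+
    have l: "(\<lambda>n. v n t) \<longlonglongrightarrow> lim (\<lambda>n. v n t)" using conv[OF ne] by (simp add: convergent_LIMSEQ_iff)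
    have "(\<lambda>n. v n t - y n) \<longlonglongrightarrow> 0"
      by (rule Lim_null_comparison[OF _ LIMSEQ_realpow_zero[of "1/2"]]) (use y(2) in \<open>auto simp: dist_norm\<close>)
    from tendsto_diff[OF l this] have "y \<longlonglongrightarrow> lim (\<lambda>n. v n t)" by simp
    then show ?thesis by (rule closed_sequentially[OF cl, rotated]) (rule y(1))
  qed
  show ?thesis
    by (rule bexI[of _ "\<lambda>t. lim (\<lambda>n. v n t)"]) (use lim_in vm in \<open>auto intro: borel_measurable_lim_metric\<close>)
qed

text \<open>
  A Castaing representation up to a null set. For each ball of a countable family, select a point
  of \<open>U t\<close> in this ball whenever there is one.
\<close>

theorem dense_selectors:
  fixes U :: "real \<Rightarrow> 'u::euclidean_space set"
  assumes graph: "{(t, u). 0 \<le> t \<and> u \<in> U t} \<in> sets borel" and cl: "\<And>t. 0 \<le> t \<Longrightarrow> closed (U t)"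
    and u0: "u0 \<in> selectors U"
  shows "\<exists>w :: nat \<Rightarrow> real \<Rightarrow> 'u. (\<forall>n. w n \<in> selectors U) \<and>
     (AE t in lborel. 0 \<le> t \<longrightarrow> U t \<subseteq> closure (range (\<lambda>n. w n t)))"
proof -
  obtain d :: "nat \<Rightarrow> 'u" where dense: "\<And>x e. e > 0 \<Longrightarrow> \<exists>j. dist x (d j) < e"
    using dense_sequence_exists by metis
  define C where "C n = cball (d (fst (prod_decode n))) (1 / real (Suc (snd (prod_decode n))))" for n
  have one: "\<exists>u\<in>selectors U. AE t in lborel. 0 \<le> t \<and> U t \<inter> C n \<noteq> {} \<longrightarrow> u t \<in> C n" for n
  proof -
    define V where "V t = (if 0 \<le> t then U t \<inter> C n else {})" for t
    have "{(t, u). u \<in> V t} = {(t, u). 0 \<le> t \<and> u \<in> U t} \<inter> (UNIV \<times> C n)"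
      by (auto simp: V_def split: if_splits)
    also have "\<dots> \<in> sets borel"
      by (intro sets.Int graph borel_closed closed_Times) (auto simp: C_def)
    finally have Vg: "{(t, u). u \<in> V t} \<in> sets borel" .
    have Vcl: "closed (V t)" for t using cl by (auto simp: V_def C_def)
    obtain v where v: "v \<in> borel_measurable lebesgue" "\<And>t. V t \<noteq> {} \<Longrightarrow> v t \<in> V t"
      using measurable_selection[OF Vg Vcl] by blast
    have Pm: "{t. V t \<noteq> {}} \<in> sets lebesgue"
    proof -
      have "fst ` {(t, u). u \<in> V t} \<in> sets lebesgue" by (rule borel_projection_lebesgue[OF Vg])
      also have "fst ` {(t, u). u \<in> V t} = {t. V t \<noteq> {}}" by force
      finally show ?thesis .
    qed
    define u00 where "u00 t = (if 0 \<le> t then u0 t else 0)" for t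
    have u00: "u00 \<in> borel_measurable lebesgue"
    proof -
      have "u0 \<in> borel_measurable (restrict_space borel {0..})" using u0 by (simp add: selectors_def)
      then have "(\<lambda>t. if t \<in> {0..} then u0 t else 0) \<in> borel_measurable borel"
        by (subst (asm) measurable_restrict_space_iff[where c=0]) auto
      then show ?thesis unfolding u00_def by (intro measurable_completion) simp
    qed
    define w where "w t = (if V t \<noteq> {} then v t else u00 t)" for t
    have "w \<in> borel_measurable lebesgue"
      unfolding w_def using v(1) u00 Pm by (intro measurable_If) auto
    moreover have "w t \<in> U t" if "0 \<le> t" for t
      using that v(2)[of t] u0 by (auto simp: w_def u00_def V_def selectors_def)
    ultimately obtain u where u: "u \<in> selectors U" "AE t in lborel. 0 \<le> t \<longrightarrow> u t = w t"
      using selectors_modify[OF u0] by blast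
    have wC: "w t \<in> C n" if "0 \<le> t" "U t \<inter> C n \<noteq> {}" for t
      using v(2)[of t] that by (auto simp: w_def V_def)
    have "AE t in lborel. 0 \<le> t \<and> U t \<inter> C n \<noteq> {} \<longrightarrow> u t \<in> C n"
      using u(2) by eventually_elim (use wC in auto)
    then show ?thesis using u by blast
  qed
  then have "\<forall>n. \<exists>u. u \<in> selectors U \<and> (AE t in lborel. 0 \<le> t \<and> U t \<inter> C n \<noteq> {} \<longrightarrow> u t \<in> C n)" by blast
  from choice[OF this] obtain w where "\<forall>n. w n \<in> selectors U \<and>
    (AE t in lborel. 0 \<le> t \<and> U t \<inter> C n \<noteq> {} \<longrightarrow> w n t \<in> C n)" ..
  then have w: "\<And>n. w n \<in> selectors U"
    "\<And>n. AE t in lborel. 0 \<le> t \<and> U t \<inter> C n \<noteq> {} \<longrightarrow> w n t \<in> C n" by blast+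
  have "AE t in lborel. \<forall>n. 0 \<le> t \<and> U t \<inter> C n \<noteq> {} \<longrightarrow> w n t \<in> C n"
    using w(2) by (simp add: AE_all_countable)
  then have "AE t in lborel. 0 \<le> t \<longrightarrow> U t \<subseteq> closure (range (\<lambda>n. w n t))"
  proof eventually_elim
    case (elim t)
    show ?case
    proof (intro impI subsetI)
      fix y assume t: "0 \<le> t" and y: "y \<in> U t"
      show "y \<in> closure (range (\<lambda>n. w n t))"
        unfolding closure_approachable
      proof (intro allI impI)
        fix e :: real assume e: "e > 0"
        obtain k where k: "1 / real (Suc k) < e / 2" using nat_approx_posE[of "e/2"] e by auto
        obtain j where j: "dist y (d j) < 1 / real (Suc k)" using dense[of "1 / real (Suc k)" y] by auto
        define n where "n = prod_encode (j, k)"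
        have Cn: "C n = cball (d j) (1 / real (Suc k))" by (simp add: C_def n_def)
        have "y \<in> C n" using j by (simp add: Cn dist_commute)
        then have "w n t \<in> C n" using elim t y by blast
        then have "dist (w n t) y \<le> 1 / real (Suc k) + 1 / real (Suc k)"
          using j dist_triangle[of "w n t" y "d j"] by (simp add: Cn dist_commute)
        with k have "dist (w n t) y < e" by linarith
        then show "\<exists>z\<in>range (\<lambda>n. w n t). dist z y < e" by blast
      qed
    qed
  qed
  with w(1) show ?thesis by blast
qed

section \<open>Matrices, derivatives and solutions on the half-line\<close>

lemma norm_matrix_vector_mult_le:
  fixes B :: "real^'n^'m"
  shows "norm (B *v x) \<le> norm B * norm x"
proof -
  have "norm (B *v x) = L2_set (\<lambda>i. norm ((B *v x) $ i)) UNIV" by (simp add: norm_vec_def)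
  also have "\<dots> \<le> L2_set (\<lambda>i. norm (B $ i) * norm x) UNIV"
    by (intro L2_set_mono) (auto simp: matrix_vector_mul_component Cauchy_Schwarz_ineq2)
  also have "\<dots> = norm B * norm x" by (simp add: norm_vec_def flip: L2_set_left_distrib)
  finally show ?thesis .
qed

lemma norm_vector_matrix_mult_le:
  fixes B :: "real^'n^'m"
  shows "norm (v v* B) \<le> norm v * norm B"
proof -
  have "norm (v v* B) * norm (v v* B) = v \<bullet> (B *v (v v* B))"
    by (metis dot_lmul_matrix power2_eq_square power2_norm_eq_inner)
  also have "\<dots> \<le> norm v * (norm B * norm (v v* B))"
    by (rule order_trans[OF norm_cauchy_schwarz mult_left_mono[OF norm_matrix_vector_mult_le]]) auto
  finally have "norm (v v* B) * norm (v v* B) \<le> (norm v * norm B) * norm (v v* B)" by (simp add: mult.assoc)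
  then show ?thesis by (cases "norm (v v* B) = 0") (auto simp: mult_le_cancel_right)
qed

lemma AE_time_iff:
  "(AE t in lebesgue_on {0..}. P t) \<longleftrightarrow> (\<exists>N. negligible N \<and> (\<forall>t::real. 0 \<le> t \<longrightarrow> t \<notin> N \<longrightarrow> P t))"
proof -
  have "(AE t in lebesgue_on {0..}. P t) \<longleftrightarrow> (AE t in lebesgue. t \<in> {0::real..} \<longrightarrow> P t)"
    by (rule AE_restrict_space_iff) auto
  also have "\<dots> \<longleftrightarrow> (\<exists>N. negligible N \<and> (\<forall>t::real. 0 \<le> t \<longrightarrow> t \<notin> N \<longrightarrow> P t))"
    unfolding eventually_ae_filter negligible_iff_null_sets by (simp add: subset_eq) blast
  finally show ?thesis .
qed

lemma solves_ode_has_integral: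
  fixes x :: "real \<Rightarrow> 'x::euclidean_space"
  assumes x: "solves_ode F \<xi> x" and st: "0 \<le> s" "s \<le> t"
  shows "((\<lambda>\<tau>. F \<tau> (x \<tau>)) has_integral x t - x s) {s..t}"
proof -
  obtain N where N: "negligible N" "\<And>\<tau>. 0 \<le> \<tau> \<Longrightarrow> \<tau> \<notin> N \<Longrightarrow> (x has_vector_derivative F \<tau> (x \<tau>)) (at \<tau> within {0..})"
    using x unfolding solves_ode_def AE_time_iff by blast
  have ac: "absolutely_continuous_on_interval s t x"
    using x st unfolding solves_ode_def locally_absolutely_continuous_def
    by (meson ac_subinterval order_refl order_trans)
  show ?thesis
  proof (rule ac_has_integral_derivative[OF st(2) ac N(1)])
    fix \<tau> assume "\<tau> \<in> {s..t} - N"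
    then show "(x has_vector_derivative F \<tau> (x \<tau>)) (at \<tau> within {s..t})"
      using st by (intro has_vector_derivative_within_subset[OF N(2)]) auto
  qed
qed

lemma solves_ode_0: "solves_ode F \<xi> x \<Longrightarrow> x 0 = \<xi>"
  by (simp add: solves_ode_def)

text \<open>
  Taylor's formula with Lipschitz derivative. Quadratic bounds with explicit constants can be
  integrated in time, which is how the expansions of the flow and of the payoff arise below.
\<close>

lemma second_order_remainder:
  fixes h :: "'a::real_normed_vector \<Rightarrow> 'b::real_normed_vector"
  assumes S: "convex S" "x \<in> S" "y \<in> S"
    and D: "\<And>z. z \<in> S \<Longrightarrow> (h has_derivative D z) (at z)"
    and lip: "\<And>z v. z \<in> S \<Longrightarrow> norm (D z v - D x v) \<le> c * norm (z - x) * norm v"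
    and c: "c \<ge> 0"
  shows "norm (h y - h x - D x (y - x)) \<le> c * (norm (y - x))\<^sup>2"
proof -
  have seg: "closed_segment x y \<subseteq> S" using S by (simp add: closed_segment_subset)
  have "norm (h y - h x - D x (y - x)) \<le> norm (y - x) * (c * norm (y - x))"
  proof (rule differentiable_bound_linearization[where S="closed_segment x y" and f'=D])
    show "x + t *\<^sub>R (y - x) \<in> closed_segment x y" if "t \<in> {0..1}" for t
      using that by (auto simp: closed_segment_def algebra_simps intro!: exI[of _ t])
    show "(h has_derivative D z) (at z within closed_segment x y)" if "z \<in> closed_segment x y" for z
      using D seg that by (blast intro: has_derivative_at_withinI)
    show "onorm (D z - D x) \<le> c * norm (y - x)" if "z \<in> closed_segment x y" for z
    proof (rule onorm_bound)
      show "0 \<le> c * norm (y - x)" using c by simp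
      fix v
      have "norm ((D z - D x) v) \<le> c * norm (z - x) * norm v" using lip seg that by auto
      also have "\<dots> \<le> c * norm (y - x) * norm v"
        using segment_bound1[OF that] c by (intro mult_right_mono mult_left_mono) auto
      finally show "norm ((D z - D x) v) \<le> c * norm (y - x) * norm v" .
    qed
  qed auto
  then show ?thesis by (simp add: power2_eq_square algebra_simps)
qed

lemma locally_summable_add:
  assumes "locally_summable a" "locally_summable b"
  shows "locally_summable (\<lambda>t. a t + b t)"
  using assms unfolding locally_summable_def by (auto intro: set_integral_add(1))

lemma locally_summable_ivl:
  assumes "locally_summable M" "0 \<le> a"
  shows "M absolutely_integrable_on {a..b}" "M integrable_on {a..b}"
proof -
  show *: "M absolutely_integrable_on {a..b}"
  proof (cases "a \<le> b")
    case True
    then have "M absolutely_integrable_on {0..b}" using assms unfolding locally_summable_def by auto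
    then show ?thesis by (rule absolutely_integrable_on_subinterval) (use assms in auto)
  qed simp
  then show "M integrable_on {a..b}" by (simp add: absolutely_integrable_on_def)
qed

lemma locally_summable_nonneg: "locally_summable M \<Longrightarrow> 0 \<le> t \<Longrightarrow> 0 \<le> M t"
  by (simp add: locally_summable_def)

lemma absolutely_integrable_cmult:
  fixes h :: "real \<Rightarrow> real"
  assumes "h absolutely_integrable_on S"
  shows "(\<lambda>t. c * h t) absolutely_integrable_on S"
  using absolutely_integrable_scaleR_left[OF assms, of c] by simp

lemma bounded_bilinear_matrix_mult: "bounded_bilinear ((**) :: real^'n^'m \<Rightarrow> real^'k^'n \<Rightarrow> real^'k^'m)"
proof -
  have "bilinear ((**) :: real^'n^'m \<Rightarrow> real^'k^'n \<Rightarrow> real^'k^'m)"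
    unfolding bilinear_def
    by (auto intro!: linearI simp: vec_eq_iff matrix_matrix_mult_def sum.distrib sum_distrib_left algebra_simps)
  then show ?thesis by (simp add: bilinear_conv_bounded_bilinear)
qed

lemma bounded_bilinear_vector_matrix_mult: "bounded_bilinear ((v*) :: real^'m \<Rightarrow> real^'n^'m \<Rightarrow> real^'n)"
proof -
  have "bilinear ((v*) :: real^'m \<Rightarrow> real^'n^'m \<Rightarrow> real^'n)"
    unfolding bilinear_def
    by (auto intro!: linearI simp: vec_eq_iff vector_matrix_mult_def sum.distrib sum_distrib_left algebra_simps)
  then show ?thesis by (simp add: bilinear_conv_bounded_bilinear)
qed

lemma norm_matrix_mult_le:
  fixes P :: "real^'n^'m" and Q :: "real^'k^'n"
  shows "norm (P ** Q) \<le> norm P * norm Q"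
proof -
  have row: "(P ** Q) $ i = P $ i v* Q" for i
    by (simp add: vec_eq_iff matrix_matrix_mult_def vector_matrix_mult_def mult.commute)
  have "norm (P ** Q) = L2_set (\<lambda>i. norm (P $ i v* Q)) UNIV" by (simp add: norm_vec_def[of "P ** Q"] row)
  also have "\<dots> \<le> L2_set (\<lambda>i. norm (P $ i) * norm Q) UNIV"
    by (intro L2_set_mono norm_vector_matrix_mult_le) auto
  also have "\<dots> = norm P * norm Q" by (simp add: norm_vec_def[of P] L2_set_left_distrib)
  finally show ?thesis .
qed

text \<open>
  Passes from a bound on the operator norm to the Euclidean norm of the matrix.
\<close>

lemma norm_matrix_le_bound:
  fixes B :: "real^'m^'m"
  assumes "\<And>e. norm (B *v e) \<le> c * norm e"
  shows "norm B \<le> (real CARD('m))\<^sup>2 * c"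
proof -
  have entry: "\<bar>B $ i $ j\<bar> \<le> c" for i j
  proof -
    have "B $ i $ j = (B *v axis j 1) $ i" by (simp add: matrix_vector_mult_basis column_def)
    also have "\<bar>\<dots>\<bar> \<le> norm (B *v axis j 1)" by (rule component_le_norm_cart)
    also have "\<dots> \<le> c" using assms[of "axis j 1"] by simp
    finally show ?thesis .
  qed
  have "norm B \<le> (\<Sum>i\<in>UNIV. norm (B $ i))"
    unfolding norm_vec_def[of B] by (rule L2_set_le_sum) auto
  also have "\<dots> \<le> (\<Sum>i\<in>UNIV. \<Sum>j\<in>UNIV. \<bar>B $ i $ j\<bar>)" by (intro sum_mono norm_le_l1_cart)
  also have "\<dots> \<le> (\<Sum>i\<in>(UNIV::'m set). \<Sum>j\<in>(UNIV::'m set). c)" by (intro sum_mono entry)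
  also have "\<dots> = (real CARD('m))\<^sup>2 * c" by (simp add: power2_eq_square)
  finally show ?thesis .
qed

lemma has_vector_derivative_quotient_iff:
  fixes x :: "real \<Rightarrow> 'a::real_normed_vector"
  shows "(x has_vector_derivative D) (at t within S) \<longleftrightarrow>
     ((\<lambda>s. (1 / (s - t)) *\<^sub>R (x s - x t)) \<longlongrightarrow> D) (at t within S)"
proof -
  have eq: "norm ((1 / norm (s - t)) *\<^sub>R (x s - (x t + (s - t) *\<^sub>R D))) = norm ((1 / (s - t)) *\<^sub>R (x s - x t) - D)"
    if "s \<noteq> t" for s
  proof -
    have "(1 / (s - t)) *\<^sub>R (x s - x t) - D = (1 / (s - t)) *\<^sub>R (x s - (x t + (s - t) *\<^sub>R D))"
      using that by (simp add: diff_diff_eq[symmetric] scaleR_diff_right)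
    then show ?thesis by simp
  qed
  have ev: "\<forall>\<^sub>F s in at t within S. s \<noteq> t" by (simp add: eventually_at_filter)
  have "(x has_vector_derivative D) (at t within S) \<longleftrightarrow>
     ((\<lambda>s. norm ((1 / norm (s - t)) *\<^sub>R (x s - (x t + (s - t) *\<^sub>R D)))) \<longlongrightarrow> 0) (at t within S)"
    unfolding has_vector_derivative_def has_derivative_within tendsto_norm_zero_iff
    by (simp add: bounded_linear_scaleR_left)
  also have "\<dots> \<longleftrightarrow> ((\<lambda>s. norm ((1 / (s - t)) *\<^sub>R (x s - x t) - D)) \<longlongrightarrow> 0) (at t within S)"
    by (rule tendsto_cong, rule eventually_mono[OF ev], rule eq)
  also have "\<dots> \<longleftrightarrow> ((\<lambda>s. (1 / (s - t)) *\<^sub>R (x s - x t)) \<longlongrightarrow> D) (at t within S)"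
    by (simp only: tendsto_norm_zero_iff LIM_zero_iff)
  finally show ?thesis .
qed

lemma at_within_time:
  fixes t :: real
  assumes "0 \<le> t" "t < T"
  shows "at t within {0..T} = at t within {0..}"
  by (rule at_within_nhd[of t "{..<T}"]) (use assms in auto)

lemma lac_tendsto:
  fixes x :: "real \<Rightarrow> 'a::real_normed_vector"
  assumes x: "locally_absolutely_continuous x" and t: "0 \<le> t"
  shows "(x \<longlongrightarrow> x t) (at t within {0..})"
proof -
  have "absolutely_continuous_on_interval 0 (t + 1) x"
    using x t by (simp add: locally_absolutely_continuous_def)
  then have "continuous_on {0..t + 1} x" by (rule ac_continuous)
  then have "(x \<longlongrightarrow> x t) (at t within {0..t + 1})" using t by (auto simp: continuous_on)
  then show ?thesis using at_within_time[of t "t + 1"] t by simp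
qed

text \<open>
  Lebesgue's theorem on the half-line with one exceptional set, so that the derivative is the one
  within \<open>{0..}\<close> which occurs in the definition of a solution.
\<close>

lemma indefinite_integral_derivative_time:
  fixes h :: "real \<Rightarrow> 'b::euclidean_space"
  assumes h: "\<And>T. 0 \<le> T \<Longrightarrow> h integrable_on {0..T}"
  shows "\<exists>N. negligible N \<and> (\<forall>t. 0 \<le> t \<longrightarrow> t \<notin> N \<longrightarrow>
     ((\<lambda>s. integral {0..s} h) has_vector_derivative h t) (at t within {0..}))"
proof -
  have "\<forall>n. \<exists>N. negligible N \<and> (\<forall>t\<in>{0..real n} - N.
     ((\<lambda>s. integral {0..s} h) has_vector_derivative h t) (at t within {0..real n}))"
    using h by (intro allI indefinite_integral_has_vector_derivative_ae) auto
  from choice[OF this] obtain N where N: "\<And>n. negligible (N n)"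
    "\<And>n t. t \<in> {0..real n} - N n \<Longrightarrow> ((\<lambda>s. integral {0..s} h) has_vector_derivative h t) (at t within {0..real n})"
    by blast
  show ?thesis
  proof (intro exI[of _ "\<Union>n. N n"] conjI allI impI)
    show "negligible (\<Union>n. N n)" using N(1) by (intro negligible_countable_Union) auto
    fix t :: real assume t: "0 \<le> t" "t \<notin> (\<Union>n. N n)"
    obtain n :: nat where n: "t < real n" using reals_Archimedean2 by blast
    then have "((\<lambda>s. integral {0..s} h) has_vector_derivative h t) (at t within {0..real n})"
      using t by (intro N(2)) auto
    then show "((\<lambda>s. integral {0..s} h) has_vector_derivative h t) (at t within {0..})"
      using at_within_time[OF t(1) n] by simp
  qed
qed

lemma lac_indefinite_integral:
  fixes h :: "real \<Rightarrow> 'b::euclidean_space"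
  assumes "\<And>T. 0 \<le> T \<Longrightarrow> h absolutely_integrable_on {0..T}"
  shows "locally_absolutely_continuous (\<lambda>t. integral {0..t} h)"
  using assms ac_indefinite_integral unfolding locally_absolutely_continuous_def by blast

lemma lac_prod:
  assumes "locally_absolutely_continuous x" "locally_absolutely_continuous y" "bounded_bilinear p"
  shows "locally_absolutely_continuous (\<lambda>t. p (x t) (y t))"
  using assms ac_prod unfolding locally_absolutely_continuous_def by blast

lemma lac_lipschitz:
  assumes "locally_absolutely_continuous x" "C \<ge> 0"
    and "\<And>s t. 0 \<le> s \<Longrightarrow> s \<le> t \<Longrightarrow> norm (z t - z s) \<le> C * norm (x t - x s)"
  shows "locally_absolutely_continuous z"
  unfolding locally_absolutely_continuous_def
proof (intro allI impI)
  fix T :: real assume "0 \<le> T"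
  then have x: "absolutely_continuous_on_interval 0 T x" using assms(1) by (simp add: locally_absolutely_continuous_def)
  show "absolutely_continuous_on_interval 0 T z"
    by (rule ac_dominated[OF x ac_const[of _ _ "0::real"] assms(2)]) (use assms(3) in simp)
qed

lemma filterlim_shift_right:
  assumes "0 \<le> \<tau>" "\<And>n. h n > 0" "h \<longlonglongrightarrow> 0"
  shows "filterlim (\<lambda>n. \<tau> + h n) (at \<tau> within {0::real..}) sequentially"
  unfolding filterlim_at
proof
  show "\<forall>\<^sub>F n in sequentially. \<tau> + h n \<in> {0..} \<and> \<tau> + h n \<noteq> \<tau>"
    using assms(1,2) by (intro always_eventually allI) (simp add: less_imp_le add_nonneg_nonneg less_imp_neq[symmetric])
  show "(\<lambda>n. \<tau> + h n) \<longlonglongrightarrow> \<tau>" using tendsto_add[OF tendsto_const[of \<tau>] assms(3)] by simp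
qed

lemma derivative_along_sequence:
  fixes \<Phi> :: "real \<Rightarrow> 'y::real_normed_vector"
  assumes "(\<Phi> has_vector_derivative D) (at \<tau> within {0..})" "0 \<le> \<tau>" "\<And>n. h n > 0" "h \<longlonglongrightarrow> 0"
  shows "(\<lambda>n. (1 / h n) *\<^sub>R (\<Phi> (\<tau> + h n) - \<Phi> \<tau>)) \<longlonglongrightarrow> D"
  using filterlim_compose[OF assms(1)[unfolded has_vector_derivative_quotient_iff] filterlim_shift_right[OF assms(2-4)]]
  by simp

lemma GDERIV_unique:
  assumes "GDERIV h x :> D" "GDERIV h x :> D'"
  shows "D = D'"
proof -
  have "(\<lambda>v. v \<bullet> D) = (\<lambda>v. v \<bullet> D')"
    using assms unfolding gderiv_def by (rule has_derivative_unique)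
  then show ?thesis by (metis vector_eq_ldot)
qed

lemma lac_cong:
  assumes "\<And>t. 0 \<le> t \<Longrightarrow> x t = y t" "locally_absolutely_continuous x"
  shows "locally_absolutely_continuous y"
  unfolding locally_absolutely_continuous_def
proof (intro allI impI)
  fix T :: real assume "0 \<le> T"
  then have "absolutely_continuous_on_interval 0 T x" using assms(2) by (simp add: locally_absolutely_continuous_def)
  then show "absolutely_continuous_on_interval 0 T y" by (rule ac_cong[rotated]) (use assms(1) in auto)
qed

section \<open>A priori estimates for trajectories\<close>

locale control_system =
  fixes U :: "real \<Rightarrow> 'u::euclidean_space set"
    and f :: "real \<Rightarrow> real ^ 'm \<Rightarrow> 'u \<Rightarrow> real ^ 'm"
    and g :: "real \<Rightarrow> real ^ 'm \<Rightarrow> 'u \<Rightarrow> real"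
    and fx :: "real \<Rightarrow> real ^ 'm \<Rightarrow> 'u \<Rightarrow> real ^ 'm ^ 'm"
    and gx :: "real \<Rightarrow> real ^ 'm \<Rightarrow> 'u \<Rightarrow> real ^ 'm"
  assumes cond_u: "condition_u U"
    and cond_fg: "condition_fg U f g"
    and cond_partial: "condition_partial U f g fx gx"
begin

abbreviation trajectory :: "(real \<Rightarrow> 'u) \<Rightarrow> real ^ 'm \<Rightarrow> (real \<Rightarrow> real ^ 'm) \<Rightarrow> bool" where
  "trajectory u \<equiv> solves_ode (\<lambda>t y. f t y (u t))"

lemma f_globally_lipschitz:
  "\<exists>L. locally_summable L \<and> (\<forall>t\<ge>0. \<forall>u\<in>U t. \<forall>x y. norm (f t x u - f t y u) \<le> L t * norm (x - y))"
proof -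
  obtain L where L: "locally_summable L"
    "\<And>K. compact K \<Longrightarrow> K \<subseteq> {0..} \<times> UNIV \<Longrightarrow> lipschitz_bound U f K L"
    using cond_fg unfolding condition_fg_def continuability_def by blast
  have "norm (f t x u - f t y u) \<le> L t * norm (x - y)" if "t \<ge> 0" "u \<in> U t" for t u x y
    using L(2)[of "{(t, x), (t, y)}"] that unfolding lipschitz_bound_def by auto
  with L(1) show ?thesis by blast
qed

text \<open>
  A Lipschitz modulus of \<open>f\<close> that serves all states at once, as granted by the continuability
  condition.
\<close>

definition Lip :: "real \<Rightarrow> real" where
  "Lip = (SOME L. locally_summable L \<and> (\<forall>t\<ge>0. \<forall>u\<in>U t. \<forall>x y. norm (f t x u - f t y u) \<le> L t * norm (x - y)))"

lemma Lip_summable: "locally_summable Lip"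
  and Lip_bound: "0 \<le> t \<Longrightarrow> u \<in> U t \<Longrightarrow> norm (f t x u - f t y u) \<le> Lip t * norm (x - y)"
  using someI_ex[OF f_globally_lipschitz, folded Lip_def] by auto

definition majorizes :: "real \<Rightarrow> real \<Rightarrow> (real \<Rightarrow> real) \<Rightarrow> (real \<Rightarrow> real ^ 'm \<Rightarrow> 'u \<Rightarrow> 'y::real_normed_vector) \<Rightarrow> bool" where
  "majorizes T R M a \<longleftrightarrow> (\<forall>t\<in>{0..T}. \<forall>u\<in>U t. \<forall>x::real^'m\<in>cball 0 R. norm (a t x u) \<le> M t \<and>
     (\<forall>y\<in>cball 0 R. norm (a t x u - a t y u) \<le> M t * norm (x - y)))"

lemma majorant_one:
  fixes a :: "real \<Rightarrow> real ^ 'm \<Rightarrow> 'u \<Rightarrow> 'y::euclidean_space"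
  assumes "locally_lipschitz U a" "integrally_bounded U a"
  shows "\<exists>M. locally_summable M \<and> majorizes T R M a"
proof -
  define K :: "(real \<times> (real ^ 'm)) set" where "K = {0..T} \<times> cball 0 R"
  have K: "compact K" "K \<subseteq> {0..} \<times> UNIV" by (auto simp: K_def intro!: compact_Times)
  obtain L where L: "locally_summable L" "lipschitz_bound U a K L"
    using assms(1) K unfolding locally_lipschitz_def by blast
  obtain M where M: "locally_summable M" "\<forall>(t, x)\<in>K. \<forall>u\<in>U t. norm (a t x u) \<le> M t"
    using assms(2) K unfolding integrally_bounded_def by blast
  have "majorizes T R (\<lambda>t. L t + M t) a"
    unfolding majorizes_def
  proof (intro ballI conjI)
    fix t u and x :: "real^'m" assume t: "t \<in> {0..T}" and u: "u \<in> U t" and x: "x \<in> cball 0 R"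
    have L0: "L t \<ge> 0" and M0: "M t \<ge> 0" using L(1) M(1) t by (auto intro: locally_summable_nonneg)
    have "norm (a t x u) \<le> M t" using M(2) t u x unfolding K_def by blast
    then show "norm (a t x u) \<le> L t + M t" using L0 by simp
    fix y :: "real^'m" assume y: "y \<in> cball 0 R"
    have "norm (a t x u - a t y u) \<le> L t * norm (x - y)"
      using L(2) t u x y unfolding K_def lipschitz_bound_def by blast
    also have "\<dots> \<le> (L t + M t) * norm (x - y)" using M0 by (intro mult_right_mono) auto
    finally show "norm (a t x u - a t y u) \<le> (L t + M t) * norm (x - y)" .
  qed
  with locally_summable_add[OF L(1) M(1)] show ?thesis by blast
qed

lemma majorizes_mono:
  fixes a :: "real \<Rightarrow> real ^ 'm \<Rightarrow> 'u \<Rightarrow> 'y::real_normed_vector"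
  assumes "majorizes T R M a" "\<And>t. 0 \<le> t \<Longrightarrow> M t \<le> M' t"
  shows "majorizes T R M' a"
  using assms unfolding majorizes_def
  by (meson atLeastAtMost_iff mult_right_mono norm_ge_zero order_trans)

lemma common_majorant:
  "\<exists>M. locally_summable M \<and> majorizes T R M f \<and> majorizes T R M g \<and> majorizes T R M fx \<and> majorizes T R M gx"
proof -
  obtain M1 where M1: "locally_summable M1" "majorizes T R M1 f"
    using majorant_one[of f T R] cond_fg unfolding condition_fg_def by blast
  obtain M2 where M2: "locally_summable M2" "majorizes T R M2 g"
    using majorant_one[of g T R] cond_fg unfolding condition_fg_def by blast
  obtain M3 where M3: "locally_summable M3" "majorizes T R M3 fx"
    using majorant_one[of fx T R] cond_partial unfolding condition_partial_def by blast
  obtain M4 where M4: "locally_summable M4" "majorizes T R M4 gx"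
    using majorant_one[of gx T R] cond_partial unfolding condition_partial_def by blast
  define M where "M t = M1 t + M2 t + (M3 t + M4 t)" for t
  have "locally_summable M"
    unfolding M_def by (intro locally_summable_add M1 M2 M3 M4)
  moreover have "majorizes T R M f" "majorizes T R M g" "majorizes T R M fx" "majorizes T R M gx"
    using M1 M2 M3 M4 by (auto simp: M_def locally_summable_nonneg add_nonneg_nonneg elim!: majorizes_mono)
  ultimately show ?thesis by blast
qed

text \<open>
  One summable function dominates the values and the Lipschitz moduli in the state of all four maps
  \<open>f\<close>, \<open>g\<close>, \<open>fx\<close>, \<open>gx\<close> over times up to \<open>T\<close> and states of norm at most \<open>R\<close>.
\<close>

definition maj :: "real \<Rightarrow> real \<Rightarrow> real \<Rightarrow> real" where
  "maj T R = (SOME M. locally_summable M \<and> majorizes T R M f \<and> majorizes T R M g \<and> majorizes T R M fx \<and> majorizes T R M gx)"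

lemma maj_summable: "locally_summable (maj T R)"
  and maj: "majorizes T R (maj T R) f" "majorizes T R (maj T R) g" "majorizes T R (maj T R) fx" "majorizes T R (maj T R) gx"
  using someI_ex[OF common_majorant[of T R], folded maj_def] by auto

lemma maj_bound:
  fixes a :: "real \<Rightarrow> real ^ 'm \<Rightarrow> 'u \<Rightarrow> 'y::real_normed_vector" and x :: "real ^ 'm"
  assumes "majorizes T R M a" "0 \<le> t" "t \<le> T" "u \<in> U t" "norm x \<le> R"
  shows "norm (a t x u) \<le> M t"
  using assms unfolding majorizes_def by auto

lemma maj_lipschitz:
  fixes a :: "real \<Rightarrow> real ^ 'm \<Rightarrow> 'u \<Rightarrow> 'y::real_normed_vector" and x y :: "real ^ 'm"
  assumes "majorizes T R M a" "0 \<le> t" "t \<le> T" "u \<in> U t" "norm x \<le> R" "norm y \<le> R"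
  shows "norm (a t x u - a t y u) \<le> M t * norm (x - y)"
  using assms unfolding majorizes_def by auto

lemma maj_nonneg: "0 \<le> t \<Longrightarrow> 0 \<le> maj T R t"
  using maj_summable locally_summable_nonneg by blast

definition growth :: "real \<Rightarrow> real" where
  "growth T = exp (integral {0..T} Lip)"

lemma growth_ge_1: "1 \<le> growth T"
proof -
  have "0 \<le> integral {0..T} Lip"
    by (rule integral_nonneg[OF locally_summable_ivl(2)[OF Lip_summable order_refl]])
       (simp add: locally_summable_nonneg[OF Lip_summable])
  then show ?thesis by (simp add: growth_def)
qed

text \<open>
  Radius of a ball that contains, up to time \<open>T\<close>, all trajectories with initial value of norm at
  most \<open>\<rho>\<close>, whatever the control.
\<close>

definition radius :: "real \<Rightarrow> real \<Rightarrow> real" where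
  "radius T \<rho> = (\<rho> + integral {0..T} (maj T 0)) * growth T"

lemma trajectory_radius:
  assumes u: "u \<in> selectors U" and x: "trajectory u \<xi> x" and \<xi>: "norm \<xi> \<le> \<rho>" and t: "0 \<le> t" "t \<le> T"
  shows "norm (x t) \<le> radius T \<rho>"
proof -
  have "norm (x t) \<le> (norm (x 0) + integral {0..T} (maj T 0)) * exp (integral {0..T} Lip)"
  proof (rule linear_growth_bound[where Z="\<lambda>t. f t (x t) (u t)"])
    fix t assume t: "t \<in> {0..T}"
    then have ut: "u t \<in> U t" using u by (auto simp: selectors_def)
    have "norm (f t (x t) (u t)) \<le> norm (f t (x t) (u t) - f t 0 (u t)) + norm (f t 0 (u t))"
      by (metis diff_add_cancel norm_triangle_ineq)
    also have "\<dots> \<le> Lip t * norm (x t - 0) + maj T 0 t"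
      using t ut by (intro add_mono Lip_bound maj_bound[OF maj(1)]) auto
    finally show "norm (f t (x t) (u t)) \<le> Lip t * norm (x t) + maj T 0 t" by simp
  qed (use t x in \<open>auto intro: solves_ode_has_integral[OF x] locally_summable_ivl Lip_summable maj_summable
      locally_summable_nonneg maj_nonneg\<close>)
  also have "\<dots> \<le> (\<rho> + integral {0..T} (maj T 0)) * exp (integral {0..T} Lip)"
    using \<xi> solves_ode_0[OF x] by (intro mult_right_mono) auto
  finally show ?thesis by (simp add: radius_def growth_def)
qed

text \<open>
  Controls may differ at the end points of the interval; this fits the half-open needles below.
\<close>

lemma trajectory_stability:
  assumes u: "u \<in> selectors U" "trajectory u \<xi> x" and v: "v \<in> selectors U" "trajectory v \<eta> y"
    and uv: "\<And>\<tau>. a < \<tau> \<Longrightarrow> \<tau> < b \<Longrightarrow> u \<tau> = v \<tau>" and ab: "0 \<le> a" "b \<le> T"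
    and st: "s \<in> {a..b}" "t \<in> {a..b}"
  shows "norm (x t - y t) \<le> growth T * norm (x s - y s)"
proof -
  define Z where "Z \<tau> = (if u \<tau> = v \<tau> then f \<tau> (x \<tau>) (u \<tau>) - f \<tau> (y \<tau>) (v \<tau>) else 0)" for \<tau>
  have "norm (x t - y t) \<le> (norm (x s - y s) + integral {a..b} (\<lambda>_. 0)) * exp (integral {a..b} Lip)"
  proof (rule linear_growth_bound[where Z=Z])
    fix s t assume st: "a \<le> s" "s \<le> t" "t \<le> b"
    have "((\<lambda>\<tau>. f \<tau> (x \<tau>) (u \<tau>) - f \<tau> (y \<tau>) (v \<tau>)) has_integral (x t - x s) - (y t - y s)) {s..t}"
      using st ab by (intro has_integral_diff solves_ode_has_integral[OF u(2)] solves_ode_has_integral[OF v(2)]) auto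
    moreover have "Z \<tau> = f \<tau> (x \<tau>) (u \<tau>) - f \<tau> (y \<tau>) (v \<tau>)" if "\<tau> \<in> {s..t} - {a, b}" for \<tau>
      using that st uv[of \<tau>] by (auto simp: Z_def)
    ultimately have "(Z has_integral (x t - x s) - (y t - y s)) {s..t}"
      by (intro has_integral_spike_finite[of "{a, b}" _ Z]) auto
    then show "(Z has_integral (x t - y t) - (x s - y s)) {s..t}" by (simp add: algebra_simps)
  next
    fix \<tau> assume \<tau>: "\<tau> \<in> {a..b}"
    then have "u \<tau> \<in> U \<tau>" using u ab by (auto simp: selectors_def)
    then show "norm (Z \<tau>) \<le> Lip \<tau> * norm (x \<tau> - y \<tau>) + 0"
      using Lip_bound[of \<tau> "u \<tau>" "x \<tau>" "y \<tau>"] \<tau> ab locally_summable_nonneg[OF Lip_summable, of \<tau>]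
      by (auto simp: Z_def)
  qed (use ab st in \<open>auto intro: locally_summable_ivl Lip_summable locally_summable_nonneg\<close>)
  also have "\<dots> \<le> norm (x s - y s) * growth T"
  proof -
    have "integral {a..b} Lip \<le> integral {0..T} Lip"
      using ab by (intro integral_subset_le locally_summable_ivl Lip_summable)
         (auto intro: locally_summable_nonneg Lip_summable)
    then show ?thesis by (auto simp: growth_def intro: mult_left_mono)
  qed
  finally show ?thesis by (simp add: mult.commute)
qed

lemma trajectory_increment:
  assumes u: "u \<in> selectors U" and x: "trajectory u \<xi> x" and \<xi>: "norm \<xi> \<le> \<rho>" and st: "0 \<le> s" "s \<le> t" "t \<le> T"
  shows "norm (x t - x s) \<le> integral {s..t} (maj T (radius T \<rho>))"
proof -
  have I: "((\<lambda>\<tau>. f \<tau> (x \<tau>) (u \<tau>)) has_integral x t - x s) {s..t}"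
    using st by (intro solves_ode_has_integral[OF x])
  have "norm (integral {s..t} (\<lambda>\<tau>. f \<tau> (x \<tau>) (u \<tau>))) \<le> integral {s..t} (maj T (radius T \<rho>))"
  proof (rule integral_norm_bound_integral)
    fix \<tau> assume \<tau>: "\<tau> \<in> {s..t}"
    then have "u \<tau> \<in> U \<tau>" using u st by (auto simp: selectors_def)
    then show "norm (f \<tau> (x \<tau>) (u \<tau>)) \<le> maj T (radius T \<rho>) \<tau>"
      using \<tau> st trajectory_radius[OF u x \<xi>] by (intro maj_bound[OF maj(1)]) auto
  qed (use I st in \<open>auto intro: has_integral_integrable locally_summable_ivl maj_summable\<close>)
  then show ?thesis using I by (simp add: integral_unique)
qed

lemma trajectory_dynamics_integrable:
  assumes u: "u \<in> selectors U" and x: "trajectory u \<xi> x" and T: "0 \<le> T"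
  shows "(\<lambda>t. f t (x t) (u t)) absolutely_integrable_on {0..T}"
proof (rule absolutely_integrable_integrable_bound)
  fix t assume t: "t \<in> {0..T}"
  then have "u t \<in> U t" using u by (auto simp: selectors_def)
  then show "norm (f t (x t) (u t)) \<le> maj T (radius T (norm \<xi>)) t"
    using t trajectory_radius[OF u x order_refl] by (intro maj_bound[OF maj(1)]) auto
next
  show "(\<lambda>t. f t (x t) (u t)) integrable_on {0..T}"
    using solves_ode_has_integral[OF x order_refl T] by (rule has_integral_integrable)
qed (intro locally_summable_ivl maj_summable order_refl)

lemma f_remainder:
  assumes "0 \<le> t" "t \<le> T" "u \<in> U t" "norm x \<le> R" "norm y \<le> R"
  shows "norm (f t y u - f t x u - fx t x u *v (y - x)) \<le> maj T R t * (norm (y - x))\<^sup>2"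
proof (rule second_order_remainder[of "cball 0 R"])
  show "((\<lambda>y. f t y u) has_derivative (\<lambda>h. fx t z u *v h)) (at z)" for z
    using cond_partial assms unfolding condition_partial_def by blast
  fix z v :: "real^'m" assume z: "z \<in> cball 0 R"
  have "norm (fx t z u *v v - fx t x u *v v) \<le> norm (fx t z u - fx t x u) * norm v"
    unfolding matrix_vector_mult_diff_rdistrib[symmetric] by (rule norm_matrix_vector_mult_le)
  also have "\<dots> \<le> maj T R t * norm (z - x) * norm v"
    using z assms by (intro mult_right_mono maj_lipschitz[OF maj(3)]) auto
  finally show "norm (fx t z u *v v - fx t x u *v v) \<le> maj T R t * norm (z - x) * norm v" .
qed (use assms maj_nonneg in auto)

lemma g_remainder:
  assumes "0 \<le> t" "t \<le> T" "u \<in> U t" "norm x \<le> R" "norm y \<le> R"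
  shows "\<bar>g t y u - g t x u - gx t x u \<bullet> (y - x)\<bar> \<le> maj T R t * (norm (y - x))\<^sup>2"
proof -
  have "norm (g t y u - g t x u - gx t x u \<bullet> (y - x)) \<le> maj T R t * (norm (y - x))\<^sup>2"
  proof (rule second_order_remainder[of "cball 0 R"])
    show "((\<lambda>y. g t y u) has_derivative (\<lambda>h. gx t z u \<bullet> h)) (at z)" for z
      using cond_partial assms unfolding condition_partial_def gderiv_def by (simp add: inner_commute)
    fix z v :: "real^'m" assume z: "z \<in> cball 0 R"
    have "norm (gx t z u \<bullet> v - gx t x u \<bullet> v) \<le> norm (gx t z u - gx t x u) * norm v"
      unfolding inner_diff_left[symmetric] real_norm_def by (rule Cauchy_Schwarz_ineq2)
    also have "\<dots> \<le> maj T R t * norm (z - x) * norm v"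
      using z assms by (intro mult_right_mono maj_lipschitz[OF maj(4)]) auto
    finally show "norm (gx t z u \<bullet> v - gx t x u \<bullet> v) \<le> maj T R t * norm (z - x) * norm v" .
  qed (use assms maj_nonneg in auto)
  then show ?thesis by simp
qed

lemma hamiltonian_gradient:
  assumes "0 \<le> t" "u \<in> U t"
  shows "GDERIV (\<lambda>y. hamiltonian f g y t u l \<psi>) x :> \<psi> v* fx t x u + l *\<^sub>R gx t x u"
proof -
  have f: "((\<lambda>y. f t y u) has_derivative (\<lambda>h. fx t x u *v h)) (at x)"
    and g: "((\<lambda>y. g t y u) has_derivative (\<lambda>h. h \<bullet> gx t x u)) (at x)"
    using cond_partial assms unfolding condition_partial_def gderiv_def by blast+
  have "((\<lambda>y. \<psi> \<bullet> f t y u + l * g t y u) has_derivative (\<lambda>h. \<psi> \<bullet> (fx t x u *v h) + l * (h \<bullet> gx t x u))) (at x)"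
    by (intro derivative_intros f g)
  then show ?thesis
    unfolding gderiv_def hamiltonian_def
    by (simp add: inner_add_right dot_lmul_matrix inner_commute flip: dot_lmul_matrix)
qed

end

section \<open>The flow of the reference control\<close>

text \<open>
  The flow \<open>X\<close> of the fixed control \<open>u0\<close> and the fundamental matrices \<open>A \<xi>\<close> of its
  linearizations.
\<close>

locale reference_process = control_system U f g fx gx
  for U :: "real \<Rightarrow> 'u::euclidean_space set"
    and f :: "real \<Rightarrow> real ^ 'm \<Rightarrow> 'u \<Rightarrow> real ^ 'm"
    and g :: "real \<Rightarrow> real ^ 'm \<Rightarrow> 'u \<Rightarrow> real"
    and fx :: "real \<Rightarrow> real ^ 'm \<Rightarrow> 'u \<Rightarrow> real ^ 'm ^ 'm"
    and gx :: "real \<Rightarrow> real ^ 'm \<Rightarrow> 'u \<Rightarrow> real ^ 'm" +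
  fixes u0 :: "real \<Rightarrow> 'u"
    and X :: "real ^ 'm \<Rightarrow> real \<Rightarrow> real ^ 'm"
    and A :: "real ^ 'm \<Rightarrow> real \<Rightarrow> real ^ 'm ^ 'm"
  assumes u0: "u0 \<in> selectors U"
    and X: "\<And>\<xi>. trajectory u0 \<xi> (X \<xi>)"
    and A: "\<And>\<xi>. solves_ode (\<lambda>t B. fx t (X \<xi> t) (u0 t) ** B) (mat 1) (A \<xi>)"
    and grad_integrable: "\<And>\<xi> T. T \<ge> 0 \<Longrightarrow>
      (\<lambda>t. gx t (X \<xi> t) (u0 t) v* A \<xi> t) absolutely_integrable_on {0..T}"
begin

text \<open>
  Formal derivative, with respect to the initial value \<open>\<xi>\<close>, of the running payoff at time \<open>t\<close>.
\<close>

definition grad :: "real ^ 'm \<Rightarrow> real \<Rightarrow> real ^ 'm" where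
  "grad \<xi> t = gx t (X \<xi> t) (u0 t) v* A \<xi> t"

definition I :: "real ^ 'm \<Rightarrow> real \<Rightarrow> real ^ 'm" where
  "I \<xi> T = integral {0..T} (grad \<xi>)"

lemma u0_in: "0 \<le> t \<Longrightarrow> u0 t \<in> U t"
  using u0 by (simp add: selectors_def)

lemma X_0: "X \<xi> 0 = \<xi>"
  using X solves_ode_0 by blast

lemma A_0: "A \<xi> 0 = mat 1"
  using A solves_ode_0 by blast

lemma grad_inner: "grad \<xi> t \<bullet> e = gx t (X \<xi> t) (u0 t) \<bullet> (A \<xi> t *v e)"
  by (simp add: grad_def dot_lmul_matrix)

lemma flow_lipschitz:
  assumes "0 \<le> t" "t \<le> T"
  shows "norm (X \<eta> t - X \<zeta> t) \<le> growth T * norm (\<eta> - \<zeta>)"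
  using trajectory_stability[OF u0 X u0 X, of 0 T T 0 t \<eta> \<zeta>] assms by (simp add: X_0)

lemma flow_expanding:
  assumes "0 \<le> t" "t \<le> T"
  shows "norm (\<eta> - \<zeta>) \<le> growth T * norm (X \<eta> t - X \<zeta> t)"
  using trajectory_stability[OF u0 X u0 X, of 0 T T t 0 \<eta> \<zeta>] assms by (simp add: X_0)

lemma flow_radius:
  assumes "norm \<xi> \<le> \<rho>" "0 \<le> t" "t \<le> T"
  shows "norm (X \<xi> t) \<le> radius T \<rho>"
  using trajectory_radius[OF u0 X] assms by blast

text \<open>
  A bi-Lipschitz self-map of Euclidean space has an open image, by invariance of domain, and a
  closed one, by completeness. This replaces solving the equation backward from a state at time
  \<open>T\<close>.
\<close>

lemma flow_surj:
  assumes T: "0 \<le> T"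
  shows "\<exists>\<xi>. X \<xi> T = y"
proof -
  define \<Psi> where "\<Psi> \<xi> = X \<xi> T" for \<xi>
  have lip: "norm (\<Psi> \<eta> - \<Psi> \<zeta>) \<le> growth T * norm (\<eta> - \<zeta>)" for \<eta> \<zeta>
    unfolding \<Psi>_def using T by (intro flow_lipschitz) auto
  have exp: "norm (\<eta> - \<zeta>) \<le> growth T * norm (\<Psi> \<eta> - \<Psi> \<zeta>)" for \<eta> \<zeta>
    unfolding \<Psi>_def using T by (intro flow_expanding) auto
  have E: "growth T > 0" using growth_ge_1[of T] by simp
  have cont: "continuous_on UNIV \<Psi>"
    unfolding continuous_on_iff
  proof (intro ballI allI impI)
    fix \<zeta> and e :: real assume e: "e > 0"
    show "\<exists>d>0. \<forall>\<eta>\<in>UNIV. dist \<eta> \<zeta> < d \<longrightarrow> dist (\<Psi> \<eta>) (\<Psi> \<zeta>) < e"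
    proof (intro exI[of _ "e / growth T"] conjI ballI impI)
      fix \<eta> assume "dist \<eta> \<zeta> < e / growth T"
      then have "growth T * norm (\<eta> - \<zeta>) < e" using E by (simp add: dist_norm field_simps)
      then show "dist (\<Psi> \<eta>) (\<Psi> \<zeta>) < e" using lip[of \<eta> \<zeta>] by (simp add: dist_norm)
    qed (use e E in auto)
  qed
  have inj: "inj \<Psi>"
    using exp by (intro injI) (metis diff_self norm_le_zero_iff mult_zero_right norm_zero right_minus_eq)
  have "open (range \<Psi>)" by (rule invariance_of_domain[OF cont open_UNIV inj])
  moreover have "closed (range \<Psi>)"
    unfolding closed_sequential_limits
  proof (intro allI impI)
    fix y l assume "(\<forall>n. y n \<in> range \<Psi>) \<and> y \<longlonglongrightarrow> l"
    then have "\<forall>n. \<exists>\<xi>. y n = \<Psi> \<xi>" and yl: "y \<longlonglongrightarrow> l" by auto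
    from choice[OF this(1)] obtain \<xi> where \<xi>: "\<And>n. y n = \<Psi> (\<xi> n)" by blast
    have "Cauchy \<xi>"
      unfolding Cauchy_def
    proof (intro allI impI)
      fix e :: real assume e: "e > 0"
      have "Cauchy y" using yl by (rule LIMSEQ_imp_Cauchy)
      then obtain M where M: "\<And>m n. m \<ge> M \<Longrightarrow> n \<ge> M \<Longrightarrow> dist (y m) (y n) < e / growth T"
        unfolding Cauchy_def using e E by (meson divide_pos_pos)
      have "dist (\<xi> m) (\<xi> n) < e" if "m \<ge> M" "n \<ge> M" for m n
      proof -
        have "dist (\<xi> m) (\<xi> n) \<le> growth T * dist (y m) (y n)" using exp by (simp add: dist_norm \<xi>)
        also have "\<dots> < e" using M[OF that] E by (simp add: field_simps)
        finally show ?thesis .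
      qed
      then show "\<exists>M. \<forall>m\<ge>M. \<forall>n\<ge>M. dist (\<xi> m) (\<xi> n) < e" by blast
    qed
    then obtain l' where l': "\<xi> \<longlonglongrightarrow> l'" by (meson Cauchy_convergent convergent_def)
    have "(\<lambda>n. \<Psi> (\<xi> n)) \<longlonglongrightarrow> \<Psi> l'"
      using continuous_on_tendsto_compose[OF cont l'] by simp
    moreover have "y = (\<lambda>n. \<Psi> (\<xi> n))" using \<xi> by (rule ext)
    ultimately have "y \<longlonglongrightarrow> \<Psi> l'" by simp
    then have "l = \<Psi> l'" by (rule LIMSEQ_unique[OF yl])
    then show "l \<in> range \<Psi>" by blast
  qed
  ultimately have "range \<Psi> = {} \<or> range \<Psi> = UNIV" by (simp only: flip: clopen)
  then have "y \<in> range \<Psi>" by auto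
  then show ?thesis by (auto simp: \<Psi>_def)
qed

lemma variational_has_integral:
  assumes "0 \<le> s" "s \<le> t"
  shows "((\<lambda>\<tau>. fx \<tau> (X \<xi> \<tau>) (u0 \<tau>) *v (A \<xi> \<tau> *v e)) has_integral A \<xi> t *v e - A \<xi> s *v e) {s..t}"
proof -
  have "bounded_linear (\<lambda>B::real^'m^'m. B *v e)"
    by (intro linear_conv_bounded_linear[THEN iffD1] linearI)
       (simp_all add: matrix_vector_mult_add_rdistrib scaleR_matrix_vector_assoc)
  from has_integral_linear[OF solves_ode_has_integral[OF A assms] this]
  show ?thesis by (simp add: o_def matrix_vector_mul_assoc matrix_vector_mult_diff_rdistrib)
qed

definition vgrowth :: "real \<Rightarrow> real \<Rightarrow> real" where
  "vgrowth T \<rho> = exp (integral {0..T} (maj T (radius T \<rho>)))"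

lemma vgrowth_pos: "0 < vgrowth T \<rho>" by (simp add: vgrowth_def)

lemma variational_growth:
  assumes \<xi>: "norm \<xi> \<le> \<rho>" and st: "s \<in> {0..T}" "t \<in> {0..T}"
  shows "norm (A \<xi> t *v e) \<le> vgrowth T \<rho> * norm (A \<xi> s *v e)"
proof -
  have "norm (A \<xi> t *v e) \<le> (norm (A \<xi> s *v e) + integral {0..T} (\<lambda>_. 0)) * exp (integral {0..T} (maj T (radius T \<rho>)))"
  proof (rule linear_growth_bound[where Z="\<lambda>\<tau>. fx \<tau> (X \<xi> \<tau>) (u0 \<tau>) *v (A \<xi> \<tau> *v e)"])
    fix \<tau> assume \<tau>: "\<tau> \<in> {0..T}"
    have "norm (fx \<tau> (X \<xi> \<tau>) (u0 \<tau>) *v (A \<xi> \<tau> *v e)) \<le> norm (fx \<tau> (X \<xi> \<tau>) (u0 \<tau>)) * norm (A \<xi> \<tau> *v e)"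
      by (rule norm_matrix_vector_mult_le)
    also have "\<dots> \<le> maj T (radius T \<rho>) \<tau> * norm (A \<xi> \<tau> *v e)"
      using \<tau> \<xi> by (intro mult_right_mono maj_bound[OF maj(3)] u0_in flow_radius) auto
    finally show "norm (fx \<tau> (X \<xi> \<tau>) (u0 \<tau>) *v (A \<xi> \<tau> *v e)) \<le> maj T (radius T \<rho>) \<tau> * norm (A \<xi> \<tau> *v e) + 0" by simp
  qed (use st in \<open>auto intro: variational_has_integral locally_summable_ivl maj_summable maj_nonneg\<close>)
  then show ?thesis by (simp add: vgrowth_def mult.commute)
qed

lemma variational_lower:
  assumes "norm \<xi> \<le> \<rho>" "0 \<le> t" "t \<le> T"
  shows "norm e \<le> vgrowth T \<rho> * norm (A \<xi> t *v e)"
  using variational_growth[of \<xi> \<rho> t T 0 e] assms by (simp add: A_0)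

text \<open>
  A kernel vector of \<open>A \<xi> t\<close> would give a solution of the linearized equation that vanishes at
  \<open>t\<close>, hence at \<open>0\<close>.
\<close>

lemma A_invertible:
  assumes "0 \<le> t"
  shows "invertible (A \<xi> t)"
proof -
  have "e = e'" if "A \<xi> t *v e = A \<xi> t *v e'" for e e'
    using variational_lower[of \<xi> "norm \<xi>" t t "e - e'"] assms that
    by (simp add: matrix_vector_mult_diff_distrib)
  then have "inj ((*v) (A \<xi> t))" by (intro injI)
  then show ?thesis by (simp add: invertible_left_inverse matrix_left_invertible_injective)
qed

definition flow_const :: "real \<Rightarrow> real \<Rightarrow> real" where
  "flow_const T \<rho> = integral {0..T} (maj T (radius T \<rho>)) * (growth T)\<^sup>2 * vgrowth T \<rho>"

text \<open>
  The remainder \<open>w\<close> solves the linearized equation with an inhomogeneity of second order.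
\<close>

lemma flow_remainder:
  assumes \<zeta>: "norm \<zeta> \<le> \<rho>" and \<eta>: "norm \<eta> \<le> \<rho>" and t: "0 \<le> t" "t \<le> T"
  shows "norm (X \<eta> t - X \<zeta> t - A \<zeta> t *v (\<eta> - \<zeta>)) \<le> flow_const T \<rho> * (norm (\<eta> - \<zeta>))\<^sup>2"
proof -
  define e where "e = \<eta> - \<zeta>"
  define M where "M = maj T (radius T \<rho>)"
  define w where "w \<tau> = X \<eta> \<tau> - X \<zeta> \<tau> - A \<zeta> \<tau> *v e" for \<tau>
  define W where "W \<tau> = f \<tau> (X \<eta> \<tau>) (u0 \<tau>) - f \<tau> (X \<zeta> \<tau>) (u0 \<tau>) - fx \<tau> (X \<zeta> \<tau>) (u0 \<tau>) *v (A \<zeta> \<tau> *v e)" for \<tau>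
  define c where "c = (growth T * norm e)\<^sup>2"
  have "norm (w t) \<le> (norm (w 0) + integral {0..T} (\<lambda>\<tau>. c * M \<tau>)) * exp (integral {0..T} M)"
  proof (rule linear_growth_bound[where Z=W])
    fix s t assume st: "0 \<le> s" "s \<le> t" "t \<le> T"
    have "(W has_integral (X \<eta> t - X \<eta> s) - (X \<zeta> t - X \<zeta> s) - (A \<zeta> t *v e - A \<zeta> s *v e)) {s..t}"
      unfolding W_def using st
      by (intro has_integral_diff solves_ode_has_integral[OF X] variational_has_integral)
    then show "(W has_integral w t - w s) {s..t}" by (simp add: w_def algebra_simps)
  next
    fix \<tau> assume \<tau>: "\<tau> \<in> {0..T}"
    have bd: "norm (X \<eta> \<tau>) \<le> radius T \<rho>" "norm (X \<zeta> \<tau>) \<le> radius T \<rho>" "u0 \<tau> \<in> U \<tau>"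
      using \<tau> \<zeta> \<eta> by (auto intro: flow_radius u0_in)
    have "W \<tau> = (f \<tau> (X \<eta> \<tau>) (u0 \<tau>) - f \<tau> (X \<zeta> \<tau>) (u0 \<tau>) - fx \<tau> (X \<zeta> \<tau>) (u0 \<tau>) *v (X \<eta> \<tau> - X \<zeta> \<tau>))
         + fx \<tau> (X \<zeta> \<tau>) (u0 \<tau>) *v w \<tau>"
      by (simp add: W_def w_def algebra_simps)
    also have "norm \<dots> \<le> M \<tau> * (norm (X \<eta> \<tau> - X \<zeta> \<tau>))\<^sup>2 + M \<tau> * norm (w \<tau>)"
    proof (rule order_trans[OF norm_triangle_ineq add_mono])
      show "norm (f \<tau> (X \<eta> \<tau>) (u0 \<tau>) - f \<tau> (X \<zeta> \<tau>) (u0 \<tau>) - fx \<tau> (X \<zeta> \<tau>) (u0 \<tau>) *v (X \<eta> \<tau> - X \<zeta> \<tau>))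
          \<le> M \<tau> * (norm (X \<eta> \<tau> - X \<zeta> \<tau>))\<^sup>2"
        unfolding M_def using bd \<tau> by (intro f_remainder) auto
      have "norm (fx \<tau> (X \<zeta> \<tau>) (u0 \<tau>) *v w \<tau>) \<le> norm (fx \<tau> (X \<zeta> \<tau>) (u0 \<tau>)) * norm (w \<tau>)"
        by (rule norm_matrix_vector_mult_le)
      also have "\<dots> \<le> M \<tau> * norm (w \<tau>)"
        unfolding M_def using bd \<tau> by (intro mult_right_mono maj_bound[OF maj(3)]) auto
      finally show "norm (fx \<tau> (X \<zeta> \<tau>) (u0 \<tau>) *v w \<tau>) \<le> M \<tau> * norm (w \<tau>)" .
    qed
    also have "M \<tau> * (norm (X \<eta> \<tau> - X \<zeta> \<tau>))\<^sup>2 \<le> M \<tau> * c"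
      unfolding c_def e_def M_def using \<tau> by (intro mult_left_mono power_mono flow_lipschitz maj_nonneg) auto
    finally show "norm (W \<tau>) \<le> M \<tau> * norm (w \<tau>) + c * M \<tau>" by (simp add: algebra_simps)
  next
    show "(\<lambda>\<tau>. c * M \<tau>) absolutely_integrable_on {0..T}"
      unfolding M_def by (intro absolutely_integrable_cmult locally_summable_ivl maj_summable order_refl)
  qed (use t in \<open>auto simp: M_def c_def intro: locally_summable_ivl maj_summable maj_nonneg intro!: mult_nonneg_nonneg\<close>)
  also have "w 0 = 0" by (simp add: w_def X_0 A_0 e_def)
  finally show ?thesis
    by (simp add: w_def e_def M_def c_def flow_const_def vgrowth_def power_mult_distrib mult_ac)
qed

definition payoff_const :: "real \<Rightarrow> real \<Rightarrow> real" where
  "payoff_const T \<rho> = (growth T)\<^sup>2 + flow_const T \<rho>"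

lemma flow_const_nonneg: "0 \<le> flow_const T \<rho>"
  unfolding flow_const_def using vgrowth_pos[of T \<rho>]
  by (intro mult_nonneg_nonneg integral_nonneg) (auto intro: locally_summable_ivl maj_summable maj_nonneg)

lemma payoff_const_nonneg: "0 \<le> payoff_const T \<rho>"
  unfolding payoff_const_def using flow_const_nonneg by simp

lemma payoff_remainder:
  assumes \<zeta>: "norm \<zeta> \<le> \<rho>" and \<eta>: "norm \<eta> \<le> \<rho>" and t: "0 \<le> t" "t \<le> T"
  shows "\<bar>g t (X \<eta> t) (u0 t) - g t (X \<zeta> t) (u0 t) - grad \<zeta> t \<bullet> (\<eta> - \<zeta>)\<bar>
    \<le> payoff_const T \<rho> * (norm (\<eta> - \<zeta>))\<^sup>2 * maj T (radius T \<rho>) t"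
proof -
  define M where "M = maj T (radius T \<rho>) t"
  define w where "w = X \<eta> t - X \<zeta> t - A \<zeta> t *v (\<eta> - \<zeta>)"
  have bd: "norm (X \<eta> t) \<le> radius T \<rho>" "norm (X \<zeta> t) \<le> radius T \<rho>" "u0 t \<in> U t"
    using assms by (auto intro: flow_radius u0_in)
  have M0: "M \<ge> 0" unfolding M_def using t maj_nonneg by blast
  have "g t (X \<eta> t) (u0 t) - g t (X \<zeta> t) (u0 t) - grad \<zeta> t \<bullet> (\<eta> - \<zeta>) =
     (g t (X \<eta> t) (u0 t) - g t (X \<zeta> t) (u0 t) - gx t (X \<zeta> t) (u0 t) \<bullet> (X \<eta> t - X \<zeta> t)) + gx t (X \<zeta> t) (u0 t) \<bullet> w"
    by (simp add: grad_inner w_def inner_diff_right[of _ "X \<eta> t - X \<zeta> t"])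
  also have "\<bar>\<dots>\<bar> \<le> M * (norm (X \<eta> t - X \<zeta> t))\<^sup>2 + M * norm w"
  proof (rule order_trans[OF abs_triangle_ineq add_mono])
    show "\<bar>g t (X \<eta> t) (u0 t) - g t (X \<zeta> t) (u0 t) - gx t (X \<zeta> t) (u0 t) \<bullet> (X \<eta> t - X \<zeta> t)\<bar> \<le> M * (norm (X \<eta> t - X \<zeta> t))\<^sup>2"
      unfolding M_def using bd t by (intro g_remainder) auto
    have "\<bar>gx t (X \<zeta> t) (u0 t) \<bullet> w\<bar> \<le> norm (gx t (X \<zeta> t) (u0 t)) * norm w" by (rule Cauchy_Schwarz_ineq2)
    also have "\<dots> \<le> M * norm w"
      unfolding M_def using bd t by (intro mult_right_mono maj_bound[OF maj(4)]) auto
    finally show "\<bar>gx t (X \<zeta> t) (u0 t) \<bullet> w\<bar> \<le> M * norm w" .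
  qed
  also have "\<dots> \<le> M * (growth T * norm (\<eta> - \<zeta>))\<^sup>2 + M * (flow_const T \<rho> * (norm (\<eta> - \<zeta>))\<^sup>2)"
    using M0 t flow_remainder[OF \<zeta> \<eta> t]
    by (intro add_mono mult_left_mono power_mono flow_lipschitz) (auto simp: w_def)
  also have "\<dots> = payoff_const T \<rho> * (norm (\<eta> - \<zeta>))\<^sup>2 * M"
    by (simp add: payoff_const_def algebra_simps power_mult_distrib)
  finally show ?thesis by (simp add: M_def)
qed

definition payoff_shift :: "real ^ 'm \<Rightarrow> real \<Rightarrow> real" where
  "payoff_shift \<xi> t = g t (X \<xi> t) (u0 t) - g t (X 0 t) (u0 t)"

lemma grad_abs: "0 \<le> T \<Longrightarrow> grad \<xi> absolutely_integrable_on {0..T}"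
  using grad_integrable[of T \<xi>] unfolding grad_def by simp

lemma grad_int: "0 \<le> T \<Longrightarrow> grad \<xi> integrable_on {0..T}"
  using grad_abs by (auto simp: absolutely_integrable_on_def)

lemma grad_inner_abs: "0 \<le> T \<Longrightarrow> (\<lambda>t. grad \<xi> t \<bullet> e) absolutely_integrable_on {0..T}"
  using absolutely_integrable_linear[OF grad_abs bounded_linear_inner_left[of e]] by (simp add: o_def)

lemma grad_inner_integral: "0 \<le> T \<Longrightarrow> integral {0..T} (\<lambda>t. grad \<xi> t \<bullet> e) = I \<xi> T \<bullet> e"
  using integral_linear[OF grad_int bounded_linear_inner_left[of e]] by (simp add: o_def I_def)

text \<open>
  Subdividing the segment from \<open>0\<close> to \<open>\<xi>\<close> and linearizing the running payoff at each node
  expresses the payoff difference as a limit of Riemann sums of \<open>I\<^bsub>s\<xi>\<^esub>(T) \<bullet> \<xi>\<close>. The same limit yields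
  integrability of \<open>payoff_shift \<xi>\<close>: the assumptions give integrability of the gradients only, not
  of the running payoff along \<open>X \<xi>\<close>.
\<close>

lemma payoff_difference_riemann:
  assumes T: "0 \<le> T"
  shows "payoff_shift \<xi> absolutely_integrable_on {0..T}"
    and "(\<lambda>n. (\<Sum>i<Suc n. I ((real i / real (Suc n)) *\<^sub>R \<xi>) T \<bullet> \<xi>) / real (Suc n)) \<longlonglongrightarrow> integral {0..T} (payoff_shift \<xi>)"
proof -
  define \<rho> where "\<rho> = norm \<xi>"
  define M where "M = maj T (radius T \<rho>)"
  define c where "c = payoff_const T \<rho> * \<rho>\<^sup>2"
  have c0: "c \<ge> 0" unfolding c_def using payoff_const_nonneg by simp
  have M0: "M t \<ge> 0" if "t \<in> {0..T}" for t unfolding M_def using that maj_nonneg by auto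
  define p where "p n i = (real i / real (Suc n)) *\<^sub>R \<xi>" for n i
  define F where "F n t = (\<Sum>i<Suc n. grad (p n i) t \<bullet> \<xi>) / real (Suc n)" for n t
  have p_norm: "norm (p n i) \<le> \<rho>" if "i \<le> Suc n" for n i
  proof -
    have "norm (p n i) = real i / real (Suc n) * norm \<xi>" by (simp add: p_def)
    also have "\<dots> \<le> 1 * norm \<xi>" using that by (intro mult_right_mono) auto
    finally show ?thesis by (simp add: \<rho>_def)
  qed
  have p_step: "p n (Suc i) - p n i = (1 / real (Suc n)) *\<^sub>R \<xi>" for n i
    unfolding p_def scaleR_diff_left[symmetric] by (simp add: add_divide_distrib)
  have err: "\<bar>payoff_shift \<xi> t - F n t\<bar> \<le> c * M t / real (Suc n)" if t: "t \<in> {0..T}" for t n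
  proof -
    let ?g = "\<lambda>i. g t (X (p n i) t) (u0 t)"
    have "(\<Sum>i<Suc n. ?g (Suc i) - ?g i) = ?g (Suc n) - ?g 0" by (rule sum_lessThan_telescope)
    also have "\<dots> = payoff_shift \<xi> t" by (simp add: payoff_shift_def p_def)
    finally have "payoff_shift \<xi> t = (\<Sum>i<Suc n. ?g (Suc i) - ?g i)" by (rule sym)
    moreover have "F n t = (\<Sum>i<Suc n. grad (p n i) t \<bullet> (p n (Suc i) - p n i))"
      unfolding F_def p_step sum_divide_distrib by simp
    ultimately have "payoff_shift \<xi> t - F n t = (\<Sum>i<Suc n. ?g (Suc i) - ?g i - grad (p n i) t \<bullet> (p n (Suc i) - p n i))"
      by (simp only: sum_subtractf)
    then have "\<bar>payoff_shift \<xi> t - F n t\<bar> \<le> (\<Sum>i<Suc n. \<bar>?g (Suc i) - ?g i - grad (p n i) t \<bullet> (p n (Suc i) - p n i)\<bar>)"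
      by (simp only: sum_abs)
    also have "\<dots> \<le> (\<Sum>i<Suc n. c * M t / (real (Suc n))\<^sup>2)"
    proof (rule sum_mono)
      fix i assume i: "i \<in> {..<Suc n}"
      have "\<bar>?g (Suc i) - ?g i - grad (p n i) t \<bullet> (p n (Suc i) - p n i)\<bar>
         \<le> payoff_const T \<rho> * (norm (p n (Suc i) - p n i))\<^sup>2 * maj T (radius T \<rho>) t"
        using i t by (intro payoff_remainder p_norm) auto
      also have "\<dots> = c * M t / (real (Suc n))\<^sup>2"
        unfolding p_step by (simp add: c_def M_def \<rho>_def power_divide)
      finally show "\<bar>?g (Suc i) - ?g i - grad (p n i) t \<bullet> (p n (Suc i) - p n i)\<bar> \<le> c * M t / (real (Suc n))\<^sup>2" .
    qed
    also have "\<dots> = c * M t / real (Suc n)" by (simp add: power2_eq_square)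
    finally show ?thesis .
  qed
  have q_le: "\<bar>payoff_shift \<xi> t\<bar> \<le> growth T * \<rho> * M t" if t: "t \<in> {0..T}" for t
  proof -
    have "\<bar>payoff_shift \<xi> t\<bar> \<le> M t * norm (X \<xi> t - X 0 t)"
      unfolding payoff_shift_def M_def real_norm_def[symmetric] using t
      by (intro maj_lipschitz[OF maj(2)] u0_in flow_radius) (auto simp: \<rho>_def)
    also have "\<dots> \<le> M t * (growth T * norm (\<xi> - 0))"
      using t M0 by (intro mult_left_mono flow_lipschitz) auto
    finally show ?thesis by (simp add: \<rho>_def mult_ac)
  qed
  have F_abs: "F n absolutely_integrable_on {0..T}" for n
  proof -
    have "(\<lambda>t. (1 / real (Suc n)) * (\<Sum>i<Suc n. grad (p n i) t \<bullet> \<xi>)) absolutely_integrable_on {0..T}"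
      by (intro absolutely_integrable_cmult absolutely_integrable_sum grad_inner_abs T) auto
    moreover have "F n = (\<lambda>t. (1 / real (Suc n)) * (\<Sum>i<Suc n. grad (p n i) t \<bullet> \<xi>))"
      by (simp add: F_def fun_eq_iff)
    ultimately show ?thesis by simp
  qed
  have conv: "(\<lambda>n. F n t) \<longlonglongrightarrow> payoff_shift \<xi> t" if t: "t \<in> {0..T}" for t
  proof -
    have "(\<lambda>n. payoff_shift \<xi> t - F n t) \<longlonglongrightarrow> 0"
    proof (rule Lim_null_comparison)
      show "\<forall>\<^sub>F n in sequentially. norm (payoff_shift \<xi> t - F n t) \<le> c * M t * (1 / real (Suc n))"
        using err[OF t] by (intro always_eventually allI) simp
      show "(\<lambda>n. c * M t * (1 / real (Suc n))) \<longlonglongrightarrow> 0"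
        by (intro tendsto_mult_right_zero LIMSEQ_Suc lim_1_over_n)
    qed
    from tendsto_diff[OF tendsto_const[of "payoff_shift \<xi> t"] this] show ?thesis by simp
  qed
  have dom: "norm (F n t) \<le> (growth T * \<rho> + c) * M t" if t: "t \<in> {0..T}" for n t
  proof -
    have "c * M t / real (Suc n) \<le> c * M t" using mult_nonneg_nonneg[OF c0 M0[OF t]] by (auto simp: divide_le_eq mult_le_cancel_left1)
    then show ?thesis using err[OF t, of n] q_le[OF t] by (simp add: algebra_simps)
  qed
  have Mi: "(\<lambda>t. (growth T * \<rho> + c) * M t) integrable_on {0..T}"
    unfolding M_def by (intro integrable_on_mult_right locally_summable_ivl maj_summable order_refl)
  have "integral {0..T} (F n) = (\<Sum>i<Suc n. I (p n i) T \<bullet> \<xi>) / real (Suc n)" for n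
  proof -
    have "integral {0..T} (\<lambda>t. (\<Sum>i<Suc n. grad (p n i) t \<bullet> \<xi>)) = (\<Sum>i<Suc n. I (p n i) T \<bullet> \<xi>)"
      using grad_inner_abs[OF T] by (subst integral_sum) (auto simp: grad_inner_integral[OF T] absolutely_integrable_on_def)
    then show ?thesis unfolding F_def by simp
  qed
  moreover have Fi: "F n integrable_on {0..T}" for n using F_abs by (auto simp: absolutely_integrable_on_def)
  note dc = dominated_convergence[OF Fi Mi dom conv]
  ultimately show "(\<lambda>n. (\<Sum>i<Suc n. I ((real i / real (Suc n)) *\<^sub>R \<xi>) T \<bullet> \<xi>) / real (Suc n)) \<longlonglongrightarrow> integral {0..T} (payoff_shift \<xi>)"
    using dc(2) by (simp add: p_def)
  show "payoff_shift \<xi> absolutely_integrable_on {0..T}"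
  proof (rule absolutely_integrable_integrable_bound[OF _ dc(1)])
    show "(\<lambda>t. growth T * \<rho> * M t) integrable_on {0..T}"
      unfolding M_def by (intro integrable_on_mult_right locally_summable_ivl maj_summable order_refl)
  qed (use q_le in auto)
qed

text \<open>
  A uniform estimate of the gradients on the segment becomes an estimate of the payoff difference.
  It contains no constant depending on \<open>T\<close>, in contrast to \<open>payoff_difference_first_order\<close>.
\<close>

lemma payoff_difference_limit:
  assumes T: "0 \<le> T" and near: "\<And>s. 0 \<le> s \<Longrightarrow> s \<le> 1 \<Longrightarrow> norm (I (s *\<^sub>R \<xi>) T - L) \<le> \<epsilon>"
  shows "\<bar>integral {0..T} (payoff_shift \<xi>) - L \<bullet> \<xi>\<bar> \<le> \<epsilon> * norm \<xi>"
proof (rule LIMSEQ_le_const2)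
  show "(\<lambda>n. \<bar>(\<Sum>i<Suc n. I ((real i / real (Suc n)) *\<^sub>R \<xi>) T \<bullet> \<xi>) / real (Suc n) - L \<bullet> \<xi>\<bar>) \<longlonglongrightarrow> \<bar>integral {0..T} (payoff_shift \<xi>) - L \<bullet> \<xi>\<bar>"
    by (intro tendsto_intros payoff_difference_riemann T)
  have "\<bar>(\<Sum>i<Suc n. I ((real i / real (Suc n)) *\<^sub>R \<xi>) T \<bullet> \<xi>) / real (Suc n) - L \<bullet> \<xi>\<bar> \<le> \<epsilon> * norm \<xi>" for n
  proof -
    have "(\<Sum>i<Suc n. I ((real i / real (Suc n)) *\<^sub>R \<xi>) T \<bullet> \<xi>) / real (Suc n) - L \<bullet> \<xi>
      = (\<Sum>i<Suc n. (I ((real i / real (Suc n)) *\<^sub>R \<xi>) T - L) \<bullet> \<xi>) / real (Suc n)"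
      unfolding inner_diff_left sum_subtractf diff_divide_distrib by simp
    also have "\<bar>\<dots>\<bar> \<le> (\<Sum>i<Suc n. \<epsilon> * norm \<xi>) / real (Suc n)"
    proof -
      have "\<bar>(I ((real i / real (Suc n)) *\<^sub>R \<xi>) T - L) \<bullet> \<xi>\<bar> \<le> \<epsilon> * norm \<xi>" if "i < Suc n" for i
        by (rule order_trans[OF Cauchy_Schwarz_ineq2 mult_right_mono[OF near]]) (use that in auto)
      then have "\<bar>\<Sum>i<Suc n. (I ((real i / real (Suc n)) *\<^sub>R \<xi>) T - L) \<bullet> \<xi>\<bar> \<le> (\<Sum>i<Suc n. \<epsilon> * norm \<xi>)"
        by (intro order_trans[OF sum_abs sum_mono]) auto
      then show ?thesis by (simp only: abs_divide abs_of_nat) (intro divide_right_mono, auto)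
    qed
    also have "\<dots> = \<epsilon> * norm \<xi>" by simp
    finally show ?thesis .
  qed
  then show "\<exists>N. \<forall>n\<ge>N. \<bar>(\<Sum>i<Suc n. I ((real i / real (Suc n)) *\<^sub>R \<xi>) T \<bullet> \<xi>) / real (Suc n) - L \<bullet> \<xi>\<bar> \<le> \<epsilon> * norm \<xi>"
    by blast
qed

text \<open>
  The expansion on bounded time intervals, which accounts for the part of the payoff difference
  before the end of the needle.
\<close>

lemma payoff_difference_first_order:
  assumes \<xi>: "norm \<xi> \<le> \<rho>" and t: "0 \<le> t" "t \<le> T"
  shows "\<bar>integral {0..t} (payoff_shift \<xi>) - I 0 t \<bullet> \<xi>\<bar>
     \<le> payoff_const T \<rho> * integral {0..T} (maj T (radius T \<rho>)) * (norm \<xi>)\<^sup>2"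
proof -
  have \<rho>: "\<rho> \<ge> 0" using \<xi> norm_ge_zero order_trans by blast
  have qi: "payoff_shift \<xi> integrable_on {0..t}" using payoff_difference_riemann(1)[OF t(1)] by (auto simp: absolutely_integrable_on_def)
  have gi: "(\<lambda>\<tau>. grad 0 \<tau> \<bullet> \<xi>) integrable_on {0..t}" using grad_inner_abs[OF t(1)] by (auto simp: absolutely_integrable_on_def)
  define c where "c = payoff_const T \<rho> * (norm \<xi>)\<^sup>2"
  have c0: "c \<ge> 0" unfolding c_def using payoff_const_nonneg by simp
  have "\<bar>integral {0..t} (payoff_shift \<xi>) - I 0 t \<bullet> \<xi>\<bar> = norm (integral {0..t} (\<lambda>\<tau>. payoff_shift \<xi> \<tau> - grad 0 \<tau> \<bullet> \<xi>))"
    using Henstock_Kurzweil_Integration.integral_diff[OF qi gi] by (simp add: grad_inner_integral[OF t(1)])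
  also have "\<dots> \<le> integral {0..t} (\<lambda>\<tau>. c * maj T (radius T \<rho>) \<tau>)"
  proof (rule integral_norm_bound_integral)
    fix \<tau> assume \<tau>: "\<tau> \<in> {0..t}"
    have "\<bar>payoff_shift \<xi> \<tau> - grad 0 \<tau> \<bullet> (\<xi> - 0)\<bar> \<le> payoff_const T \<rho> * (norm (\<xi> - 0))\<^sup>2 * maj T (radius T \<rho>) \<tau>"
      unfolding payoff_shift_def using \<tau> t \<xi> \<rho> by (intro payoff_remainder) auto
    then show "norm (payoff_shift \<xi> \<tau> - grad 0 \<tau> \<bullet> \<xi>) \<le> c * maj T (radius T \<rho>) \<tau>" by (simp add: c_def)
  next
    show "(\<lambda>\<tau>. payoff_shift \<xi> \<tau> - grad 0 \<tau> \<bullet> \<xi>) integrable_on {0..t}" using qi gi by (rule integrable_diff)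
    show "(\<lambda>\<tau>. c * maj T (radius T \<rho>) \<tau>) integrable_on {0..t}"
      by (intro integrable_on_mult_right locally_summable_ivl maj_summable order_refl)
  qed
  also have "\<dots> = c * integral {0..t} (maj T (radius T \<rho>))" by simp
  also have "\<dots> \<le> c * integral {0..T} (maj T (radius T \<rho>))"
    using t c0 by (intro mult_left_mono integral_subset_le) (auto intro: locally_summable_ivl maj_summable maj_nonneg)
  finally show ?thesis by (simp add: c_def mult_ac)
qed

end

section \<open>The costate\<close>

context reference_process
begin

definition A_inv :: "real \<Rightarrow> real ^ 'm ^ 'm" where
  "A_inv t = matrix_inv (A 0 t)"

lemma A_inv_left: "0 \<le> t \<Longrightarrow> A_inv t ** A 0 t = mat 1"
  and A_inv_right: "0 \<le> t \<Longrightarrow> A 0 t ** A_inv t = mat 1"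
proof -
  assume "0 \<le> t"
  then have "\<exists>A'. A 0 t ** A' = mat 1 \<and> A' ** A 0 t = mat 1"
    using A_invertible unfolding invertible_def by blast
  from someI_ex[OF this] show "A_inv t ** A 0 t = mat 1" "A 0 t ** A_inv t = mat 1"
    unfolding A_inv_def matrix_inv_def by auto
qed

lemma A_inv_0: "A_inv 0 = mat 1"
  using A_inv_left[of 0] by (simp add: A_0)

lemma A_lac: "locally_absolutely_continuous (A \<xi>)"
  using A unfolding solves_ode_def by blast

text \<open>
  The resolvent identity; it transfers absolute continuity and the derivative from \<open>A 0\<close> to its
  inverse.
\<close>

lemma A_inv_difference: "0 \<le> s \<Longrightarrow> 0 \<le> t \<Longrightarrow> A_inv t - A_inv s = - (A_inv t ** (A 0 t - A 0 s) ** A_inv s)"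
proof -
  assume st: "0 \<le> s" "0 \<le> t"
  have "A_inv t ** (A 0 t - A 0 s) ** A_inv s = (A_inv t ** A 0 t) ** A_inv s - A_inv t ** (A 0 s ** A_inv s)"
    by (simp add: bounded_bilinear.diff_right[OF bounded_bilinear_matrix_mult]
          bounded_bilinear.diff_left[OF bounded_bilinear_matrix_mult] matrix_mul_assoc)
  also have "\<dots> = A_inv s - A_inv t" using st by (simp add: A_inv_left A_inv_right)
  finally show ?thesis by simp
qed

lemma A_inv_bound:
  assumes "0 \<le> t" "t \<le> T"
  shows "norm (A_inv t) \<le> (real CARD('m))\<^sup>2 * vgrowth T 0"
proof (rule norm_matrix_le_bound)
  fix e
  have "norm (A_inv t *v e) \<le> vgrowth T 0 * norm (A 0 t *v (A_inv t *v e))"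
    using assms by (intro variational_lower) auto
  then show "norm (A_inv t *v e) \<le> vgrowth T 0 * norm e"
    using assms by (simp add: matrix_vector_mul_assoc A_inv_right)
qed

lemma A_inv_lac: "locally_absolutely_continuous A_inv"
  unfolding locally_absolutely_continuous_def
proof (intro allI impI)
  fix T :: real assume T: "0 \<le> T"
  define c where "c = (real CARD('m))\<^sup>2 * vgrowth T 0"
  have c0: "c \<ge> 0" using vgrowth_pos[of T 0] by (simp add: c_def)
  have ac: "absolutely_continuous_on_interval 0 T (A 0)"
    using A_lac T by (simp add: locally_absolutely_continuous_def)
  show "absolutely_continuous_on_interval 0 T A_inv"
  proof (rule ac_dominated[OF ac ac_const[of _ _ "0::real"], where C="c * c"])
    fix s t assume st: "0 \<le> s" "s \<le> t" "t \<le> T"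
    have "norm (A_inv t - A_inv s) = norm (A_inv t ** (A 0 t - A 0 s) ** A_inv s)" using A_inv_difference[of s t] st by simp
    also have "\<dots> \<le> norm (A_inv t ** (A 0 t - A 0 s)) * norm (A_inv s)" by (rule norm_matrix_mult_le)
    also have "\<dots> \<le> (norm (A_inv t) * norm (A 0 t - A 0 s)) * norm (A_inv s)"
      by (intro mult_right_mono norm_matrix_mult_le) auto
    also have "\<dots> \<le> (c * norm (A 0 t - A 0 s)) * c"
      using c0 st A_inv_bound by (intro mult_right_mono mult_mono) (auto simp: c_def)
    finally show "norm (A_inv t - A_inv s) \<le> c * c * (norm (A 0 t - A 0 s) + norm (0 - (0::real)))"
      by (simp add: mult_ac)
  qed (use c0 in auto)
qed

lemma A_inv_derivative:
  assumes t: "0 \<le> t" and A': "(A 0 has_vector_derivative A') (at t within {0..})"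
  shows "(A_inv has_vector_derivative - (A_inv t ** A' ** A_inv t)) (at t within {0..})"
  unfolding has_vector_derivative_quotient_iff
proof (rule Lim_transform_eventually)
  note bb = bounded_bilinear_matrix_mult[where 'm='m and 'n='m and 'k='m]
  show "((\<lambda>s. - (A_inv s ** ((1 / (s - t)) *\<^sub>R (A 0 s - A 0 t)) ** A_inv t)) \<longlongrightarrow> - (A_inv t ** A' ** A_inv t)) (at t within {0..})"
    using A' unfolding has_vector_derivative_quotient_iff
    by (intro tendsto_minus bounded_bilinear.tendsto[OF bb] tendsto_const lac_tendsto A_inv_lac t)
  show "\<forall>\<^sub>F s in at t within {0..}. - (A_inv s ** ((1 / (s - t)) *\<^sub>R (A 0 s - A 0 t)) ** A_inv t) = (1 / (s - t)) *\<^sub>R (A_inv s - A_inv t)"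
    unfolding eventually_at_filter
    by (intro always_eventually allI impI)
       (use A_inv_difference t in \<open>simp add: bounded_bilinear.scaleR_left[OF bb] bounded_bilinear.scaleR_right[OF bb]\<close>)
qed

lemma I_lac: "locally_absolutely_continuous (I \<xi>)"
  unfolding I_def by (intro lac_indefinite_integral grad_abs)

text \<open>
  The adjoint vector for the multiplier \<open>1\<close>, prescribed by \<open>costate_A\<close>.
\<close>

definition costate :: "real ^ 'm \<Rightarrow> real \<Rightarrow> real ^ 'm" where
  "costate L t = (L - I 0 t) v* A_inv t"

lemma costate_A: "0 \<le> t \<Longrightarrow> costate L t v* A 0 t = L - I 0 t"
  by (simp add: costate_def vector_matrix_mul_assoc A_inv_left)

lemma costate_inner: "0 \<le> t \<Longrightarrow> costate L t \<bullet> (A 0 t *v e) = (L - I 0 t) \<bullet> e"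
  by (simp add: costate_A flip: dot_lmul_matrix)

lemma costate_0: "costate L 0 = L"
  by (simp add: costate_def A_inv_0 I_def)

lemma costate_lac: "locally_absolutely_continuous (costate L)"
proof -
  have "locally_absolutely_continuous (\<lambda>t. L - I 0 t)"
    by (rule lac_lipschitz[OF I_lac[of 0], of 1]) (simp_all add: norm_minus_commute)
  from lac_prod[OF this A_inv_lac bounded_bilinear_vector_matrix_mult]
  have "locally_absolutely_continuous (\<lambda>t. (L - I 0 t) v* A_inv t)" .
  then show ?thesis by (simp add: costate_def[abs_def])
qed

text \<open>
  The adjoint equation: in the derivative of the product, the factor \<open>A 0 t\<close> of \<open>grad 0 t\<close> cancels
  against the inverse matrix.
\<close>

lemma costate_derivative_ae:
  "\<exists>N. negligible N \<and> (\<forall>t. 0 \<le> t \<longrightarrow> t \<notin> N \<longrightarrow>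
     (costate L has_vector_derivative - (costate L t v* fx t (X 0 t) (u0 t) + gx t (X 0 t) (u0 t))) (at t within {0..}))"
proof -
  obtain N1 where N1: "negligible N1" "\<And>t. 0 \<le> t \<Longrightarrow> t \<notin> N1 \<Longrightarrow>
      (A 0 has_vector_derivative fx t (X 0 t) (u0 t) ** A 0 t) (at t within {0..})"
    using A[of 0] unfolding solves_ode_def AE_time_iff by blast
  obtain N2 where N2: "negligible N2" "\<And>t. 0 \<le> t \<Longrightarrow> t \<notin> N2 \<Longrightarrow> (I 0 has_vector_derivative grad 0 t) (at t within {0..})"
    using indefinite_integral_derivative_time[OF grad_int[of _ 0], folded I_def] by metis
  show ?thesis
  proof (intro exI[of _ "N1 \<union> N2"] conjI allI impI)
    show "negligible (N1 \<union> N2)" by (rule negligible_Un[OF N1(1) N2(1)])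
    fix t assume t: "0 \<le> t" "t \<notin> N1 \<union> N2"
    define P where "P = fx t (X 0 t) (u0 t)"
    have p: "((\<lambda>s. L - I 0 s) has_vector_derivative - grad 0 t) (at t within {0..})"
      using N2(2)[of t] t by (auto intro!: derivative_eq_intros)
    have b: "(A_inv has_vector_derivative - (A_inv t ** P)) (at t within {0..})"
      using A_inv_derivative[OF t(1) N1(2)[of t]] t by (simp add: P_def A_inv_right flip: matrix_mul_assoc)
    have "(costate L has_vector_derivative (L - I 0 t) v* (- (A_inv t ** P)) + (- grad 0 t) v* A_inv t) (at t within {0..})"
      unfolding costate_def[abs_def]
      by (rule bounded_bilinear.has_vector_derivative[OF bounded_bilinear_vector_matrix_mult p b])
    also have "(L - I 0 t) v* (- (A_inv t ** P)) + (- grad 0 t) v* A_inv t = - (costate L t v* P + gx t (X 0 t) (u0 t))"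
      using t(1) by (simp add: costate_def grad_def vector_matrix_mul_assoc A_inv_right
          bounded_bilinear.minus_left[OF bounded_bilinear_vector_matrix_mult]
          bounded_bilinear.minus_right[OF bounded_bilinear_vector_matrix_mult])
    finally show "(costate L has_vector_derivative - (costate L t v* fx t (X 0 t) (u0 t) + gx t (X 0 t) (u0 t))) (at t within {0..})"
      by (simp add: P_def)
  qed
qed

text \<open>
  Along a solution of the adjoint equation with multiplier \<open>l\<close>, the product with \<open>A 0\<close> has
  derivative \<open>- l grad 0\<close>, since the terms with \<open>fx\<close> cancel.
\<close>

lemma costate_unique:
  assumes ac: "locally_absolutely_continuous \<psi>"
    and der: "AE t in lebesgue_on {0..}. (\<psi> has_vector_derivative
        - (\<psi> t v* fx t (X 0 t) (u0 t) + l *\<^sub>R gx t (X 0 t) (u0 t))) (at t within {0..})"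
    and t: "0 \<le> t"
  shows "\<psi> t v* A 0 t = \<psi> 0 - l *\<^sub>R I 0 t"
proof -
  obtain N1 where N1: "negligible N1" "\<And>t. 0 \<le> t \<Longrightarrow> t \<notin> N1 \<Longrightarrow>
      (A 0 has_vector_derivative fx t (X 0 t) (u0 t) ** A 0 t) (at t within {0..})"
    using A[of 0] unfolding solves_ode_def AE_time_iff by blast
  obtain N2 where N2: "negligible N2" "\<And>t. 0 \<le> t \<Longrightarrow> t \<notin> N2 \<Longrightarrow> (\<psi> has_vector_derivative
        - (\<psi> t v* fx t (X 0 t) (u0 t) + l *\<^sub>R gx t (X 0 t) (u0 t))) (at t within {0..})"
    using der unfolding AE_time_iff by blast
  define z where "z t = \<psi> t v* A 0 t" for t
  have acz: "absolutely_continuous_on_interval 0 t z"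
    using lac_prod[OF ac A_lac bounded_bilinear_vector_matrix_mult] t
    unfolding z_def locally_absolutely_continuous_def by blast
  have "((\<lambda>s. - l *\<^sub>R grad 0 s) has_integral z t - z 0) {0..t}"
  proof (rule ac_has_integral_derivative[OF t acz negligible_Un[OF N1(1) N2(1)]])
    fix s assume s: "s \<in> {0..t} - (N1 \<union> N2)"
    have "(z has_vector_derivative \<psi> s v* (fx s (X 0 s) (u0 s) ** A 0 s)
        + (- (\<psi> s v* fx s (X 0 s) (u0 s) + l *\<^sub>R gx s (X 0 s) (u0 s))) v* A 0 s) (at s within {0..})"
      unfolding z_def
      by (rule bounded_bilinear.has_vector_derivative[OF bounded_bilinear_vector_matrix_mult])
         (use s N1(2)[of s] N2(2)[of s] in auto)
    also have "\<psi> s v* (fx s (X 0 s) (u0 s) ** A 0 s)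
        + (- (\<psi> s v* fx s (X 0 s) (u0 s) + l *\<^sub>R gx s (X 0 s) (u0 s))) v* A 0 s = - l *\<^sub>R grad 0 s"
      by (simp add: grad_def vector_matrix_mul_assoc
          bounded_bilinear.minus_left[OF bounded_bilinear_vector_matrix_mult]
          bounded_bilinear.diff_left[OF bounded_bilinear_vector_matrix_mult]
          bounded_bilinear.scaleR_left[OF bounded_bilinear_vector_matrix_mult])
    finally show "(z has_vector_derivative - l *\<^sub>R grad 0 s) (at s within {0..t})"
      by (rule has_vector_derivative_within_subset) auto
  qed
  moreover have "((\<lambda>s. - l *\<^sub>R grad 0 s) has_integral - l *\<^sub>R I 0 t) {0..t}"
    unfolding I_def by (intro has_integral_cmul integrable_integral grad_int t)
  ultimately have "z t - z 0 = - l *\<^sub>R I 0 t" by (rule has_integral_unique)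
  then show ?thesis by (simp add: z_def A_0 algebra_simps)
qed

end

section \<open>Needle variations\<close>

definition spike :: "(real \<Rightarrow> 'u) \<Rightarrow> (real \<Rightarrow> 'u) \<Rightarrow> real \<Rightarrow> real \<Rightarrow> real \<Rightarrow> 'u" where
  "spike u v a b t = (if a \<le> t \<and> t < b then v t else u t)"

lemma spike_selector:
  assumes u: "u \<in> selectors U" and v: "v \<in> selectors U"
  shows "spike u v a b \<in> selectors U"
proof -
  have "spike u v a b = (\<lambda>t. if t \<in> {a..<b} then v t else u t)" by (auto simp: spike_def)
  moreover have "(\<lambda>t. if t \<in> {a..<b} then v t else u t) \<in> borel_measurable (restrict_space borel {0..})"
  proof (rule measurable_If_set)
    show "{a..<b} \<inter> space (restrict_space borel {0..}) \<in> sets (restrict_space borel {0::real..})"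
      by (subst sets_restrict_space_iff) (auto simp: space_restrict_space)
  qed (use u v in \<open>auto simp: selectors_def\<close>)
  ultimately show ?thesis using u v by (auto simp: selectors_def)
qed

locale optimal_process = reference_process U f g fx gx u0 X A
  for U :: "real \<Rightarrow> 'u::euclidean_space set"
    and f :: "real \<Rightarrow> real ^ 'm \<Rightarrow> 'u \<Rightarrow> real ^ 'm"
    and g :: "real \<Rightarrow> real ^ 'm \<Rightarrow> 'u \<Rightarrow> real"
    and fx :: "real \<Rightarrow> real ^ 'm \<Rightarrow> 'u \<Rightarrow> real ^ 'm ^ 'm"
    and gx :: "real \<Rightarrow> real ^ 'm \<Rightarrow> 'u \<Rightarrow> real ^ 'm"
    and u0 :: "real \<Rightarrow> 'u"
    and X :: "real ^ 'm \<Rightarrow> real \<Rightarrow> real ^ 'm"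
    and A :: "real ^ 'm \<Rightarrow> real \<Rightarrow> real ^ 'm ^ 'm" +
  fixes \<phi> :: "(real \<Rightarrow> 'u) \<Rightarrow> real \<Rightarrow> real ^ 'm"
    and L :: "real ^ 'm"
  assumes \<phi>: "\<And>u. u \<in> selectors U \<Longrightarrow> trajectory u 0 (\<phi> u)"
    and payoff_integrable: "\<And>u T. u \<in> selectors U \<Longrightarrow> T \<ge> 0 \<Longrightarrow>
           (\<lambda>t. g t (\<phi> u t) (u t)) absolutely_integrable_on {0..T}"
    and optimal: "uniformly_overtaking_optimal U g \<phi> u0"
    and I_limit: "((\<lambda>(t, \<xi>). I \<xi> t) \<longlongrightarrow> L) (at_top \<times>\<^sub>F at 0)"
    and I_0_limit: "(I 0 \<longlongrightarrow> L) at_top"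
begin

lemma \<phi>_reference: "0 \<le> t \<Longrightarrow> \<phi> u0 t = X 0 t"
  using trajectory_stability[OF u0 \<phi>[OF u0] u0 X[of 0], of 0 t t 0 t]
  by (simp add: X_0 solves_ode_0[OF \<phi>[OF u0]])

text \<open>
  The common properties of \<open>f\<close> and \<open>g\<close> that are needed to linearize them along needles. Stating
  them for a map \<open>a\<close> with values in any Euclidean space allows one treatment of both.
\<close>

definition admissible :: "(real \<Rightarrow> real ^ 'm \<Rightarrow> 'u \<Rightarrow> 'y::euclidean_space) \<Rightarrow> bool" where
  "admissible a \<longleftrightarrow> (\<forall>T R. majorizes T R (maj T R) a) \<and>
     (\<forall>v\<in>selectors U. \<forall>T\<ge>0. (\<lambda>t. a t (\<phi> v t) (v t)) absolutely_integrable_on {0..T})"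

lemma admissible_f: "admissible f"
  unfolding admissible_def using maj(1) trajectory_dynamics_integrable \<phi> by blast

lemma admissible_g: "admissible g"
  unfolding admissible_def using maj(2) payoff_integrable by blast

text \<open>
  Measurability of \<open>t \<mapsto> a(t, X\<^sub>0(t), u(t))\<close> does not follow from the Caratheodory conditions. On
  the cell \<open>[j/(n+1), (j+1)/(n+1))\<close> the map is approximated by \<open>a\<close> along the trajectory that
  switches from \<open>u0\<close> to \<open>u\<close> at the left end of the cell; that function is integrable, and the
  trajectory has had no time to move away from \<open>X\<^sub>0\<close>.
\<close>

lemma along_reference:
  fixes a :: "real \<Rightarrow> real ^ 'm \<Rightarrow> 'u \<Rightarrow> 'y::euclidean_space"
  assumes a: "admissible a" and u: "u \<in> selectors U" and T: "0 \<le> T"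
  shows "(\<lambda>t. a t (X 0 t) (u t)) absolutely_integrable_on {0..T}"
proof -
  define M where "M = maj T (radius T 0)"
  have majo: "majorizes T (radius T 0) M a" unfolding M_def using a by (simp add: admissible_def)
  have aint: "(\<lambda>t. a t (\<phi> v t) (v t)) absolutely_integrable_on {0..T}" if "v \<in> selectors U" for v
    using a that T by (simp add: admissible_def)
  define \<Phi> where "\<Phi> t = integral {0..t} M" for t
  have Mi: "M integrable_on {s..t}" if "0 \<le> s" for s t
    unfolding M_def using that by (intro locally_summable_ivl maj_summable)
  have \<Phi>c: "continuous_on {0..T} \<Phi>"
    unfolding \<Phi>_def by (intro indefinite_integral_continuous_1 Mi) simp
  have \<Phi>d: "integral {s..t} M = \<Phi> t - \<Phi> s" if "0 \<le> s" "s \<le> t" for s t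
    using Henstock_Kurzweil_Integration.integral_combine[of 0 s t M] Mi[of 0 t] that by (simp add: \<Phi>_def)
  define c where "c n j = real j / real (Suc n)" for n j :: nat
  \<comment> \<open>The switch lasts beyond \<open>T\<close>, so that \<open>T\<close> itself is covered by the half-open interval.\<close>
  define W where "W n j = spike u0 u (c n j) (T + 1)" for n j
  have Wsel: "W n j \<in> selectors U" for n j unfolding W_def by (intro spike_selector u0 u)
  define S where "S n j = {c n j..<c n (Suc j)}" for n j
  \<comment> \<open>Enough cells to contain the right end point \<open>T\<close>.\<close>
  define N where "N n = Suc (nat \<lfloor>real (Suc n) * T\<rfloor>)" for n
  define F where "F n t = (\<Sum>j<N n. if t \<in> S n j then a t (\<phi> (W n j) t) (W n j t) else 0)" for n t
  have Fabs: "F n absolutely_integrable_on {0..T}" for n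
    unfolding F_def
  proof (intro absolutely_integrable_sum)
    fix j
    have "{0..T} \<inter> S n j \<in> sets lebesgue" by (simp add: S_def)
    then have "(\<lambda>t. a t (\<phi> (W n j) t) (W n j t)) absolutely_integrable_on ({0..T} \<inter> S n j)"
      by (rule set_integrable_subset[OF aint[OF Wsel]]) simp
    then have "(\<lambda>t. if t \<in> {0..T} \<inter> S n j then a t (\<phi> (W n j) t) (W n j t) else 0) absolutely_integrable_on UNIV"
      by (simp only: absolutely_integrable_restrict_UNIV)
    then have "(\<lambda>t. if t \<in> {0..T} then (if t \<in> S n j then a t (\<phi> (W n j) t) (W n j t) else 0) else 0) absolutely_integrable_on UNIV"
      by (rule back_subst[of "\<lambda>h. h absolutely_integrable_on UNIV"]) auto
    then show "(\<lambda>t. if t \<in> S n j then a t (\<phi> (W n j) t) (W n j t) else 0) absolutely_integrable_on {0..T}"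
      by (simp only: absolutely_integrable_restrict_UNIV)
  qed simp
  have cell: "\<exists>j. c n j \<le> t \<and> t - c n j \<le> 1 / real (Suc n) \<and> F n t = a t (\<phi> (W n j) t) (u t)"
    if t: "t \<in> {0..T}" for n t
  proof -
    define j where "j = nat \<lfloor>real (Suc n) * t\<rfloor>"
    have j: "real j \<le> real (Suc n) * t" "real (Suc n) * t < real j + 1"
      using t by (simp_all add: j_def)
    have jS: "t \<in> S n i \<longleftrightarrow> i = j" for i
    proof -
      have "t \<in> S n i \<longleftrightarrow> real i \<le> real (Suc n) * t \<and> real (Suc n) * t < real i + 1"
        by (simp add: S_def c_def field_simps)
      also have "\<dots> \<longleftrightarrow> i = j" using j by linarith
      finally show ?thesis .
    qed
    have "real (Suc n) * t \<le> real (Suc n) * T" using t by (intro mult_left_mono) auto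
    then have jN: "j < N n" unfolding N_def j_def by (intro le_imp_less_Suc nat_mono floor_mono)
    have "F n t = a t (\<phi> (W n j) t) (W n j t)"
      unfolding F_def jS using jN by (simp add: sum.delta)
    moreover have "c n j \<le> t"
      using j(1) by (simp add: c_def pos_divide_le_eq mult.commute)
    moreover have "t \<le> (real j + 1) / real (Suc n)"
      using j(2) by (simp only: pos_le_divide_eq of_nat_0_less_iff zero_less_Suc mult.commute less_imp_le)
    then have "t - c n j \<le> 1 / real (Suc n)"
      by (simp add: c_def add_divide_distrib)
    moreover have "W n j t = u t" using t \<open>c n j \<le> t\<close> by (simp add: W_def spike_def)
    ultimately show ?thesis by auto
  qed
  have err: "norm (\<phi> (W n j) t - X 0 t) \<le> 2 * (\<Phi> t - \<Phi> (c n j))" if t: "c n j \<le> t" "t \<le> T" for n j t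
  proof -
    have c0: "0 \<le> c n j" by (simp add: c_def)
    have "W n j s = u0 s" if "s < c n j" for s using that by (simp add: W_def spike_def)
    moreover have "\<phi> (W n j) 0 = 0" by (rule solves_ode_0[OF \<phi>[OF Wsel]])
    ultimately have eq: "\<phi> (W n j) (c n j) = X 0 (c n j)"
      using trajectory_stability[OF Wsel \<phi>[OF Wsel] u0 X[of 0], of 0 "c n j" n j T 0 "c n j"] c0 t
      by (simp add: X_0)
    have 1: "norm (\<phi> (W n j) t - \<phi> (W n j) (c n j)) \<le> \<Phi> t - \<Phi> (c n j)"
      using trajectory_increment[OF Wsel \<phi>[OF Wsel], of 0 "c n j" t T] c0 t \<Phi>d by (simp add: M_def)
    have 2: "norm (X 0 t - X 0 (c n j)) \<le> \<Phi> t - \<Phi> (c n j)"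
      using trajectory_increment[OF u0 X, of 0 0 "c n j" t T] c0 t \<Phi>d by (simp add: M_def)
    have "\<phi> (W n j) t - X 0 t = (\<phi> (W n j) t - \<phi> (W n j) (c n j)) - (X 0 t - X 0 (c n j))" by (simp add: eq)
    then show ?thesis using norm_triangle_ineq4[of "\<phi> (W n j) t - \<phi> (W n j) (c n j)" "X 0 t - X 0 (c n j)"] 1 2 by simp
  qed
  show ?thesis
  proof (rule dominated_convergence_absolutely_integrable[OF Fabs Mi])
    fix t assume t: "t \<in> {0..T}"
    then have ut: "u t \<in> U t" using u by (auto simp: selectors_def)
    have X0r: "norm (X 0 t) \<le> radius T 0" using t by (intro flow_radius) auto
    show "norm (a t (X 0 t) (u t)) \<le> M t" using t ut X0r by (intro maj_bound[OF majo]) auto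
    from cell[OF t] have "\<forall>n. \<exists>j. c n j \<le> t \<and> t - c n j \<le> 1 / real (Suc n) \<and> F n t = a t (\<phi> (W n j) t) (u t)" by blast
    from choice[OF this] obtain j where j: "\<And>n. c n (j n) \<le> t" "\<And>n. t - c n (j n) \<le> 1 / real (Suc n)"
      "\<And>n. F n t = a t (\<phi> (W n (j n)) t) (u t)" by blast
    have "(\<lambda>n. t - c n (j n)) \<longlonglongrightarrow> 0"
      by (rule Lim_null_comparison[OF _ LIMSEQ_Suc[OF lim_1_over_n]]) (use j(1,2) in \<open>auto intro!: always_eventually\<close>)
    from tendsto_diff[OF tendsto_const[of t] this] have "(\<lambda>n. c n (j n)) \<longlonglongrightarrow> t" by simp
    then have \<Phi>l: "(\<lambda>n. \<Phi> (c n (j n))) \<longlonglongrightarrow> \<Phi> t"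
      by (rule continuous_on_tendsto_compose[OF \<Phi>c _ t]) (use j(1) t in \<open>auto simp: c_def intro!: always_eventually intro: order_trans\<close>)
    have "(\<lambda>n. F n t - a t (X 0 t) (u t)) \<longlonglongrightarrow> 0"
    proof (rule Lim_null_comparison)
      show "(\<lambda>n. M t * (2 * (\<Phi> t - \<Phi> (c n (j n))))) \<longlonglongrightarrow> 0"
        using tendsto_diff[OF tendsto_const[of "\<Phi> t"] \<Phi>l] by (intro tendsto_mult_right_zero) simp
      show "\<forall>\<^sub>F n in sequentially. norm (F n t - a t (X 0 t) (u t)) \<le> M t * (2 * (\<Phi> t - \<Phi> (c n (j n))))"
      proof (intro always_eventually allI)
        fix n
        have "norm (\<phi> (W n (j n)) t) \<le> radius T 0"
          using t by (intro trajectory_radius[OF Wsel \<phi>[OF Wsel]]) auto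
        then have "norm (F n t - a t (X 0 t) (u t)) \<le> M t * norm (\<phi> (W n (j n)) t - X 0 t)"
          unfolding j(3) using t ut X0r by (intro maj_lipschitz[OF majo]) auto
        also have "\<dots> \<le> M t * (2 * (\<Phi> t - \<Phi> (c n (j n))))"
          using t err j(1) by (intro mult_left_mono) (auto simp: M_def maj_nonneg)
        finally show "norm (F n t - a t (X 0 t) (u t)) \<le> M t * (2 * (\<Phi> t - \<Phi> (c n (j n))))" .
      qed
    qed
    then show "(\<lambda>n. F n t) \<longlonglongrightarrow> a t (X 0 t) (u t)" by (simp only: LIM_zero_iff)
  qed simp
qed

definition gap :: "(real \<Rightarrow> real ^ 'm \<Rightarrow> 'u \<Rightarrow> 'y::euclidean_space) \<Rightarrow> (real \<Rightarrow> 'u) \<Rightarrow> real \<Rightarrow> 'y" where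
  "gap a u t = a t (X 0 t) (u t) - a t (X 0 t) (u0 t)"

lemma gap_abs:
  assumes "admissible a" "u \<in> selectors U" "0 \<le> T"
  shows "gap a u absolutely_integrable_on {0..T}"
  unfolding gap_def[abs_def] using assms by (intro set_integral_diff along_reference u0)

lemma needle_before:
  assumes u: "u \<in> selectors U" and \<tau>: "0 \<le> t" "t \<le> \<tau>"
  shows "\<phi> (spike u0 u \<tau> b) t = X 0 t"
proof -
  let ?v = "spike u0 u \<tau> b"
  have v: "?v \<in> selectors U" by (intro spike_selector u0 u)
  show ?thesis
    using trajectory_stability[OF v \<phi>[OF v] u0 X[of 0], of 0 \<tau> \<tau> 0 t] \<tau>
    by (simp add: X_0 solves_ode_0[OF \<phi>[OF v]] spike_def)
qed

lemma needle_after: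
  assumes u: "u \<in> selectors U" and \<tau>: "0 \<le> b" "b \<le> t" and \<xi>: "X \<xi> b = \<phi> (spike u0 u \<tau> b) b"
  shows "\<phi> (spike u0 u \<tau> b) t = X \<xi> t"
proof -
  let ?v = "spike u0 u \<tau> b"
  have v: "?v \<in> selectors U" by (intro spike_selector u0 u)
  show ?thesis
    using trajectory_stability[OF v \<phi>[OF v] u0 X[of \<xi>], of b t t b t] \<tau> \<xi>
    by (simp add: spike_def)
qed

text \<open>
  Over the needle, the perturbed trajectory stays within \<open>2 \<rho>\<close> of the reference, so replacing it by
  the reference costs at most \<open>2 \<rho>\<close> times the integral \<open>\<rho>\<close> of the Lipschitz modulus.
\<close>

lemma needle_increment:
  fixes a :: "real \<Rightarrow> real ^ 'm \<Rightarrow> 'u \<Rightarrow> 'y::euclidean_space"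
  assumes a: "admissible a" and u: "u \<in> selectors U" and \<tau>: "0 \<le> \<tau>" "0 \<le> h" "\<tau> + h \<le> T"
  defines "v \<equiv> spike u0 u \<tau> (\<tau> + h)"
  defines "\<rho> \<equiv> integral {\<tau>..\<tau> + h} (maj T (radius T 1))"
  shows "norm (integral {\<tau>..\<tau> + h} (\<lambda>t. a t (\<phi> v t) (v t) - a t (X 0 t) (u0 t)) - integral {\<tau>..\<tau> + h} (gap a u))
      \<le> 2 * \<rho> * \<rho>"
proof -
  define M where "M = maj T (radius T 1)"
  have majo: "majorizes T (radius T 1) M a" unfolding M_def using a by (simp add: admissible_def)
  have v: "v \<in> selectors U" unfolding v_def by (intro spike_selector u0 u)
  have Mi: "M integrable_on {s..t}" if "0 \<le> s" for s t
    unfolding M_def using that by (intro locally_summable_ivl maj_summable)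
  have M0: "0 \<le> M t" if "0 \<le> t" for t unfolding M_def using that by (rule maj_nonneg)
  have T: "0 \<le> T" and Th: "0 \<le> \<tau> + h" using \<tau> by auto
  have I1: "(\<lambda>t. a t (\<phi> v t) (v t)) integrable_on {\<tau>..\<tau> + h}"
    by (rule integrable_on_subinterval[of _ "{0..\<tau> + h}"])
       (use a v Th \<tau> in \<open>auto simp: admissible_def absolutely_integrable_on_def\<close>)
  have I2: "(\<lambda>t. a t (X 0 t) (w t)) integrable_on {\<tau>..\<tau> + h}" if "w \<in> selectors U" for w
    by (rule integrable_on_subinterval[of _ "{0..\<tau> + h}"])
       (use along_reference[OF a that Th] \<tau> in \<open>auto simp: absolutely_integrable_on_def\<close>)
  have I3: "gap a u integrable_on {\<tau>..\<tau> + h}"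
    unfolding gap_def[abs_def] by (intro integrable_diff I2 u u0)
  define D where "D t = (if t = \<tau> + h then 0 else a t (\<phi> v t) (v t) - a t (X 0 t) (u t))" for t
  have "integral {\<tau>..\<tau> + h} (\<lambda>t. a t (\<phi> v t) (v t) - a t (X 0 t) (u0 t)) - integral {\<tau>..\<tau> + h} (gap a u)
      = integral {\<tau>..\<tau> + h} (\<lambda>t. a t (\<phi> v t) (v t) - a t (X 0 t) (u0 t) - gap a u t)"
    by (rule Henstock_Kurzweil_Integration.integral_diff[symmetric, OF integrable_diff[OF I1 I2[OF u0]] I3])
  also have "\<dots> = integral {\<tau>..\<tau> + h} D"
    by (rule integral_spike[of "{\<tau> + h}"]) (auto simp: D_def gap_def)
  finally have eq: "integral {\<tau>..\<tau> + h} (\<lambda>t. a t (\<phi> v t) (v t) - a t (X 0 t) (u0 t)) - integral {\<tau>..\<tau> + h} (gap a u)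
      = integral {\<tau>..\<tau> + h} D" .
  have sub: "integral {s..t} M \<le> \<rho>" if "\<tau> \<le> s" "t \<le> \<tau> + h" for s t
    unfolding \<rho>_def M_def[symmetric] using that \<tau> by (intro integral_subset_le Mi) (auto intro: M0)
  have close: "norm (\<phi> v t - X 0 t) \<le> 2 * \<rho>" if t: "t \<in> {\<tau>..\<tau> + h}" for t
  proof -
    have eq: "\<phi> v \<tau> = X 0 \<tau>" unfolding v_def using \<tau> by (intro needle_before u) auto
    have "norm (\<phi> v t - \<phi> v \<tau>) \<le> \<rho>"
      using trajectory_increment[OF v \<phi>[OF v], of 1 \<tau> t T] t \<tau> sub[of \<tau> t] by (auto simp: M_def)
    moreover have "norm (X 0 t - X 0 \<tau>) \<le> \<rho>"
      using trajectory_increment[OF u0 X, of 0 1 \<tau> t T] t \<tau> sub[of \<tau> t] by (auto simp: M_def)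
    ultimately show ?thesis
      using norm_triangle_ineq4[of "\<phi> v t - \<phi> v \<tau>" "X 0 t - X 0 \<tau>"] by (simp add: eq)
  qed
  have Di: "D integrable_on {\<tau>..\<tau> + h}"
    by (rule integrable_spike[OF integrable_diff[OF I1 I2[OF u]], of "{\<tau> + h}"]) (auto simp: D_def)
  have "norm (integral {\<tau>..\<tau> + h} D) \<le> integral {\<tau>..\<tau> + h} (\<lambda>t. 2 * \<rho> * M t)"
  proof (rule integral_norm_bound_integral[OF Di])
    show "(\<lambda>t. 2 * \<rho> * M t) integrable_on {\<tau>..\<tau> + h}" using \<tau> by (intro integrable_on_mult_right Mi)
    fix t assume t: "t \<in> {\<tau>..\<tau> + h}"
    then have t0: "0 \<le> t" "t \<le> T" using \<tau> by auto
    have r0: "0 \<le> 2 * \<rho>" using close[OF t] norm_ge_zero order_trans by blast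
    show "norm (D t) \<le> 2 * \<rho> * M t"
    proof (cases "t = \<tau> + h")
      case True
      then show ?thesis using mult_nonneg_nonneg[OF r0 M0[OF t0(1)]] by (simp add: D_def)
    next
      case False
      then have vt: "v t = u t" using t by (simp add: v_def spike_def)
      have "u t \<in> U t" using u t0 by (simp add: selectors_def)
      moreover have "norm (\<phi> v t) \<le> radius T 1" "norm (X 0 t) \<le> radius T 1"
        using t0 by (auto intro!: flow_radius trajectory_radius[OF v \<phi>[OF v]])
      ultimately have "norm (a t (\<phi> v t) (u t) - a t (X 0 t) (u t)) \<le> M t * norm (\<phi> v t - X 0 t)"
        using t0 by (intro maj_lipschitz[OF majo])
      also have "\<dots> \<le> M t * (2 * \<rho>)" using close[OF t] M0[OF t0(1)] by (intro mult_left_mono)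
      finally show ?thesis using False vt by (simp add: D_def mult.commute)
    qed
  qed
  also have "\<dots> = 2 * \<rho> * \<rho>" by (simp add: \<rho>_def M_def)
  finally show ?thesis unfolding eq .
qed

text \<open>
  The joint limit excludes \<open>\<xi> = 0\<close>; there the improper integral takes over.
\<close>

lemma I_near_limit:
  assumes "\<epsilon> > 0"
  shows "\<exists>\<delta>>0. \<exists>T1\<ge>0. \<forall>T\<ge>T1. \<forall>\<xi>. norm \<xi> < \<delta> \<longrightarrow> norm (I \<xi> T - L) \<le> \<epsilon>"
proof -
  have "\<forall>\<^sub>F p in at_top \<times>\<^sub>F at 0. dist (case p of (t, \<xi>) \<Rightarrow> I \<xi> t) L < \<epsilon>"
    using tendstoD[OF I_limit assms] .
  then obtain P Q where PQ: "eventually P at_top" "eventually Q (at 0)"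
    "\<And>t \<xi>. P t \<Longrightarrow> Q \<xi> \<Longrightarrow> dist (I \<xi> t) L < \<epsilon>"
    unfolding eventually_prod_filter by auto
  obtain t1 where t1: "\<And>t. t \<ge> t1 \<Longrightarrow> P t" using PQ(1) by (auto simp: eventually_at_top_linorder)
  obtain \<delta> where \<delta>: "\<delta> > 0" "\<And>\<xi>. \<xi> \<noteq> 0 \<Longrightarrow> norm \<xi> < \<delta> \<Longrightarrow> Q \<xi>"
    using PQ(2) by (auto simp: eventually_at dist_norm)
  obtain t2 where t2: "\<And>t. t \<ge> t2 \<Longrightarrow> dist (I 0 t) L < \<epsilon>"
    using tendstoD[OF I_0_limit assms] by (auto simp: eventually_at_top_linorder)
  show ?thesis
  proof (rule exI[of _ \<delta>], intro conjI exI[of _ "max 0 (max t1 t2)"] allI impI)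
    fix T :: real and \<xi> :: "real ^ 'm" assume "T \<ge> max 0 (max t1 t2)" "norm \<xi> < \<delta>"
    then show "norm (I \<xi> T - L) \<le> \<epsilon>"
      using PQ(3)[OF t1 \<delta>(2)] t2[of T] by (cases "\<xi> = 0") (auto simp: dist_norm less_imp_le)
  qed (use \<delta> in auto)
qed

lemma payoff_near_limit:
  assumes "\<epsilon> > 0"
  shows "\<exists>\<delta>>0. \<exists>T1\<ge>0. \<forall>T\<ge>T1. \<forall>\<xi>. norm \<xi> < \<delta> \<longrightarrow> \<bar>integral {0..T} (payoff_shift \<xi>) - L \<bullet> \<xi>\<bar> \<le> \<epsilon> * norm \<xi>"
proof -
  obtain \<delta> T1 where *: "\<delta> > 0" "T1 \<ge> 0" "\<And>T \<xi>. T \<ge> T1 \<Longrightarrow> norm \<xi> < \<delta> \<Longrightarrow> norm (I \<xi> T - L) \<le> \<epsilon>"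
    using I_near_limit[OF assms] by blast
  have "\<bar>integral {0..T} (payoff_shift \<xi>) - L \<bullet> \<xi>\<bar> \<le> \<epsilon> * norm \<xi>" if "T \<ge> T1" "norm \<xi> < \<delta>" for T \<xi>
  proof (rule payoff_difference_limit)
    fix s :: real assume "0 \<le> s" "s \<le> 1"
    then have "norm (s *\<^sub>R \<xi>) \<le> norm \<xi>" by (simp add: mult_left_le_one_le)
    then show "norm (I (s *\<^sub>R \<xi>) T - L) \<le> \<epsilon>" using that by (intro *(3)) auto
  qed (use that *(2) in auto)
  with *(1,2) show ?thesis by blast
qed

text \<open>
  The payoff changes during the needle, and afterwards by the passage from \<open>X\<^sub>0\<close> to \<open>X\<^sub>\<xi>\<close>.
\<close>

lemma needle_payoff:
  assumes u: "u \<in> selectors U" and \<tau>: "0 \<le> \<tau>" "0 \<le> h" "\<tau> + h \<le> T"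
  defines "v \<equiv> spike u0 u \<tau> (\<tau> + h)"
  assumes \<xi>: "X \<xi> (\<tau> + h) = \<phi> v (\<tau> + h)"
  shows "payoff g T (\<phi> v) v - payoff g T (\<phi> u0) u0 =
     integral {\<tau>..\<tau> + h} (\<lambda>t. g t (\<phi> v t) (v t) - g t (X 0 t) (u0 t))
     + integral {0..T} (payoff_shift \<xi>) - integral {0..\<tau> + h} (payoff_shift \<xi>)"
proof -
  define D where "D t = g t (\<phi> v t) (v t) - g t (X 0 t) (u0 t)" for t
  have T: "0 \<le> T" using \<tau> by simp
  have v: "v \<in> selectors U" unfolding v_def by (intro spike_selector u0 u)
  have i1: "(\<lambda>t. g t (\<phi> v t) (v t)) integrable_on {0..T}"
    using payoff_integrable[OF v T] by (simp add: absolutely_integrable_on_def)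
  have i2: "(\<lambda>t. g t (X 0 t) (u0 t)) integrable_on {0..T}"
    using along_reference[OF admissible_g u0 T] by (simp add: absolutely_integrable_on_def)
  have Di: "D integrable_on {0..T}" unfolding D_def[abs_def] by (intro integrable_diff i1 i2)
  have qi: "payoff_shift \<xi> integrable_on {0..T}" using payoff_difference_riemann(1)[OF T] by (simp add: absolutely_integrable_on_def)
  have "payoff g T (\<phi> u0) u0 = integral {0..T} (\<lambda>t. g t (X 0 t) (u0 t))"
    unfolding payoff_def by (rule integral_cong) (simp add: \<phi>_reference)
  then have "payoff g T (\<phi> v) v - payoff g T (\<phi> u0) u0 = integral {0..T} D"
    unfolding D_def[abs_def] payoff_def by (simp add: Henstock_Kurzweil_Integration.integral_diff[OF i1 i2])
  also have "\<dots> = integral {0..\<tau> + h} D + integral {\<tau> + h..T} D"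
    by (rule Henstock_Kurzweil_Integration.integral_combine[symmetric]) (use \<tau> Di in auto)
  also have "integral {0..\<tau> + h} D = integral {0..\<tau>} D + integral {\<tau>..\<tau> + h} D"
    by (rule Henstock_Kurzweil_Integration.integral_combine[symmetric])
       (use \<tau> in \<open>auto intro: integrable_on_subinterval[OF Di]\<close>)
  also have "integral {0..\<tau>} D = integral {0..\<tau>} (\<lambda>_. 0)"
    by (rule integral_spike[of "{\<tau>}"])
       (use u in \<open>auto simp: D_def v_def needle_before spike_def\<close>)
  also have "integral {\<tau> + h..T} D = integral {\<tau> + h..T} (payoff_shift \<xi>)"
    using \<tau> \<xi> by (intro integral_cong)
       (auto simp: D_def payoff_shift_def v_def needle_after[OF u _ _ \<xi>[unfolded v_def]] spike_def)
  also have "\<dots> = integral {0..T} (payoff_shift \<xi>) - integral {0..\<tau> + h} (payoff_shift \<xi>)"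
    using Henstock_Kurzweil_Integration.integral_combine[of 0 "\<tau> + h" T "payoff_shift \<xi>"] \<tau> qi by simp
  finally show ?thesis by (simp add: D_def[abs_def])
qed

definition needle_const :: "real \<Rightarrow> real" where
  "needle_const T = payoff_const T 1 * integral {0..T} (maj T (radius T 1))"

lemma needle_const_nonneg: "0 \<le> needle_const T"
  unfolding needle_const_def
  by (intro mult_nonneg_nonneg payoff_const_nonneg integral_nonneg locally_summable_ivl maj_summable maj_nonneg) auto

text \<open>
  The inequality for a needle of length \<open>h\<close>. For fixed \<open>h\<close>, optimality is applied with arbitrarily
  small tolerance and horizon tending to infinity, so its tolerance disappears and only the
  error \<open>\<epsilon> \<bar>\<xi>\<bar>\<close> of the joint limit and second-order terms are left.
\<close>

lemma needle_step:
  assumes u: "u \<in> selectors U" and \<tau>: "0 \<le> \<tau>" "0 \<le> h" "\<tau> + h \<le> T"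
    and \<epsilon>: "\<epsilon> > 0"
    and near: "\<And>T' \<xi>. T' \<ge> T1 \<Longrightarrow> norm \<xi> < \<delta> \<Longrightarrow> \<bar>integral {0..T'} (payoff_shift \<xi>) - L \<bullet> \<xi>\<bar> \<le> \<epsilon> * norm \<xi>"
  defines "v \<equiv> spike u0 u \<tau> (\<tau> + h)"
  defines "d \<equiv> \<phi> v (\<tau> + h) - X 0 (\<tau> + h)"
  defines "e \<equiv> integral {\<tau>..\<tau> + h} (\<lambda>t. g t (\<phi> v t) (v t) - g t (X 0 t) (u0 t))"
  assumes small: "growth T * norm d < min \<delta> 1"
  shows "e + costate L (\<tau> + h) \<bullet> d \<le> \<epsilon> * (growth T * norm d)
     + (needle_const T + norm (costate L (\<tau> + h)) * flow_const T 1) * (growth T * norm d)\<^sup>2"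
proof -
  define b where "b = \<tau> + h"
  have b: "0 \<le> b" "b \<le> T" using \<tau> by (auto simp: b_def)
  obtain \<xi> where \<xi>: "X \<xi> b = \<phi> v b" using flow_surj[OF b(1)] by blast
  have \<xi>d: "norm \<xi> \<le> growth T * norm d"
    using flow_expanding[OF b, of \<xi> 0] \<xi> by (simp add: d_def b_def)
  with small have \<xi>1: "norm \<xi> \<le> 1" and \<xi>\<delta>: "norm \<xi> < \<delta>" by auto
  have v: "v \<in> selectors U" unfolding v_def by (intro spike_selector u0 u)
  have key: "e + L \<bullet> \<xi> - \<epsilon> * norm \<xi> - integral {0..b} (payoff_shift \<xi>) \<le> 0"
  proof (rule field_le_epsilon)
    fix \<epsilon>' :: real assume "\<epsilon>' > 0"
    then obtain T2 where T2: "\<And>u t. u \<in> selectors U \<Longrightarrow> t \<ge> T2 \<Longrightarrow> payoff g t (\<phi> u0) u0 \<ge> payoff g t (\<phi> u) u - \<epsilon>'"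
      using optimal unfolding uniformly_overtaking_optimal_def by blast
    \<comment> \<open>Late enough for the joint limit, for the optimality with tolerance \<open>\<epsilon>'\<close>, and for the needle to be over.\<close>
    define T' where "T' = max T1 (max T2 T)"
    have "payoff g T' (\<phi> v) v - payoff g T' (\<phi> u0) u0 = e + integral {0..T'} (payoff_shift \<xi>) - integral {0..b} (payoff_shift \<xi>)"
      unfolding e_def v_def b_def
      by (rule needle_payoff[OF u]) (use \<tau> \<xi> in \<open>auto simp: T'_def v_def b_def\<close>)
    moreover have "payoff g T' (\<phi> v) v - payoff g T' (\<phi> u0) u0 \<le> \<epsilon>'"
    proof -
      have "T2 \<le> T'" by (simp add: T'_def)
      from T2[OF v this] show ?thesis by linarith
    qed
    moreover have "L \<bullet> \<xi> - \<epsilon> * norm \<xi> \<le> integral {0..T'} (payoff_shift \<xi>)"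
      using near[of T' \<xi>] \<xi>\<delta> by (auto simp: T'_def abs_le_iff)
    ultimately show "e + L \<bullet> \<xi> - \<epsilon> * norm \<xi> - integral {0..b} (payoff_shift \<xi>) \<le> 0 + \<epsilon>'" by linarith
  qed
  have q1: "integral {0..b} (payoff_shift \<xi>) \<le> I 0 b \<bullet> \<xi> + needle_const T * (norm \<xi>)\<^sup>2"
    using payoff_difference_first_order[OF \<xi>1 b] by (simp add: needle_const_def abs_le_iff)
  have flow: "norm (d - A 0 b *v \<xi>) \<le> flow_const T 1 * (norm \<xi>)\<^sup>2"
    using flow_remainder[of 0 1 \<xi> b T] \<xi>1 b \<xi> by (simp add: d_def b_def)
  have "costate L b \<bullet> d = (L - I 0 b) \<bullet> \<xi> + costate L b \<bullet> (d - A 0 b *v \<xi>)"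
    using costate_inner[OF b(1), of L \<xi>] by (simp add: inner_diff_right)
  also have "\<dots> \<le> (L - I 0 b) \<bullet> \<xi> + norm (costate L b) * (flow_const T 1 * (norm \<xi>)\<^sup>2)"
    using order_trans[OF norm_cauchy_schwarz mult_left_mono[OF flow]] by simp
  finally have "e + costate L b \<bullet> d \<le> \<epsilon> * norm \<xi> + (needle_const T + norm (costate L b) * flow_const T 1) * (norm \<xi>)\<^sup>2"
    using key q1 by (simp add: inner_diff_left algebra_simps)
  also have "\<dots> \<le> \<epsilon> * (growth T * norm d) + (needle_const T + norm (costate L b) * flow_const T 1) * (growth T * norm d)\<^sup>2"
    using \<epsilon> \<xi>d needle_const_nonneg[of T] flow_const_nonneg[of T 1]
    by (intro add_mono mult_left_mono power_mono) auto
  finally show ?thesis by (simp add: b_def)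
qed

text \<open>
  Divide \<open>needle_step\<close> by \<open>h\<close> and let \<open>h\<close> tend to zero, then \<open>\<epsilon>\<close>. The assumptions say that
  \<open>\<tau>\<close> is a Lebesgue point of the dominating function and of the two differences.
\<close>

lemma needle_inequality:
  assumes u: "u \<in> selectors U" and \<tau>: "0 \<le> \<tau>" "\<tau> < T"
    and dM: "((\<lambda>s. integral {0..s} (maj T (radius T 1))) has_vector_derivative m) (at \<tau> within {0..})"
    and df: "((\<lambda>s. integral {0..s} (gap f u)) has_vector_derivative gap f u \<tau>) (at \<tau> within {0..})"
    and dg: "((\<lambda>s. integral {0..s} (gap g u)) has_vector_derivative gap g u \<tau>) (at \<tau> within {0..})"
  shows "gap g u \<tau> + costate L \<tau> \<bullet> gap f u \<tau> \<le> 0"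
proof -
  define h where "h n = (T - \<tau>) / real (Suc n)" for n
  have h: "h n > 0" "\<tau> + h n \<le> T" for n
  proof -
    show "h n > 0" using \<tau> by (simp add: h_def)
    have "h n \<le> T - \<tau>" using \<tau> unfolding h_def by (subst divide_le_eq) (auto simp: mult_le_cancel_left1)
    then show "\<tau> + h n \<le> T" by simp
  qed
  have h_lim: "h \<longlonglongrightarrow> 0"
    unfolding h_def[abs_def] by (rule LIMSEQ_Suc[OF lim_const_over_n])
  define v where "v n = spike u0 u \<tau> (\<tau> + h n)" for n
  define d where "d n = \<phi> (v n) (\<tau> + h n) - X 0 (\<tau> + h n)" for n
  define e where "e n = integral {\<tau>..\<tau> + h n} (\<lambda>t. g t (\<phi> (v n) t) (v n t) - g t (X 0 t) (u0 t))" for n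
  define \<rho> where "\<rho> n = integral {\<tau>..\<tau> + h n} (maj T (radius T 1))" for n
  have quot: "(\<lambda>n. (1 / h n) *\<^sub>R integral {\<tau>..\<tau> + h n} k) \<longlonglongrightarrow> D"
    if "\<And>T. 0 \<le> T \<Longrightarrow> k integrable_on {0..T}"
      "((\<lambda>s. integral {0..s} k) has_vector_derivative D) (at \<tau> within {0..})"
    for k :: "real \<Rightarrow> 'y::euclidean_space" and D
  proof -
    have "integral {\<tau>..\<tau> + h n} k = integral {0..\<tau> + h n} k - integral {0..\<tau>} k" for n
      using Henstock_Kurzweil_Integration.integral_combine[of 0 \<tau> "\<tau> + h n" k] that(1)[of "\<tau> + h n"] \<tau> h(1)[of n]
      by (simp add: algebra_simps)
    then show ?thesis using derivative_along_sequence[OF that(2) \<tau>(1) h(1) h_lim] by simp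
  qed
  have \<rho>_q: "(\<lambda>n. (1 / h n) *\<^sub>R \<rho> n) \<longlonglongrightarrow> m"
    unfolding \<rho>_def by (intro quot dM locally_summable_ivl maj_summable order_refl)
  have \<rho>_lim: "\<rho> \<longlonglongrightarrow> 0"
    using tendsto_scaleR[OF h_lim \<rho>_q] h(1) by (simp add: less_imp_neq[symmetric])
  have err_lim: "(\<lambda>n. (1 / h n) * (2 * \<rho> n * \<rho> n)) \<longlonglongrightarrow> 0"
    using tendsto_mult[OF tendsto_mult[OF tendsto_const[of 2] \<rho>_lim] \<rho>_q] by (simp add: mult_ac)
  have incr: "(\<lambda>n. (1 / h n) *\<^sub>R integral {\<tau>..\<tau> + h n} (\<lambda>t. a t (\<phi> (v n) t) (v n t) - a t (X 0 t) (u0 t))) \<longlonglongrightarrow> gap a u \<tau>"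
    if a: "admissible a" and da: "((\<lambda>s. integral {0..s} (gap a u)) has_vector_derivative gap a u \<tau>) (at \<tau> within {0..})"
    for a :: "real \<Rightarrow> real ^ 'm \<Rightarrow> 'u \<Rightarrow> 'y::euclidean_space"
  proof -
    define J where "J n = integral {\<tau>..\<tau> + h n} (\<lambda>t. a t (\<phi> (v n) t) (v n t) - a t (X 0 t) (u0 t))" for n
    have 1: "(\<lambda>n. (1 / h n) *\<^sub>R integral {\<tau>..\<tau> + h n} (gap a u)) \<longlonglongrightarrow> gap a u \<tau>"
      by (intro quot da) (use gap_abs[OF a u] in \<open>auto simp: absolutely_integrable_on_def\<close>)
    have 2: "(\<lambda>n. (1 / h n) *\<^sub>R (J n - integral {\<tau>..\<tau> + h n} (gap a u))) \<longlonglongrightarrow> 0"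
    proof (rule Lim_null_comparison[OF always_eventually err_lim], rule allI)
      fix n
      have "norm (J n - integral {\<tau>..\<tau> + h n} (gap a u)) \<le> 2 * \<rho> n * \<rho> n"
        unfolding J_def v_def \<rho>_def using \<tau> h[of n] by (intro needle_increment a u) auto
      then show "norm ((1 / h n) *\<^sub>R (J n - integral {\<tau>..\<tau> + h n} (gap a u))) \<le> (1 / h n) * (2 * \<rho> n * \<rho> n)"
        using h(1)[of n] by (simp add: divide_right_mono)
    qed
    have "(\<lambda>n. (1 / h n) *\<^sub>R J n) \<longlonglongrightarrow> gap a u \<tau>"
      using tendsto_add[OF 1 2] by (simp add: scaleR_diff_right)
    then show ?thesis by (simp add: J_def)
  qed
  \<comment> \<open>Up to time \<open>\<tau>\<close> both trajectories coincide, so \<open>d n\<close> is an increment over the needle.\<close>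
  have d_eq: "d n = integral {\<tau>..\<tau> + h n} (\<lambda>t. f t (\<phi> (v n) t) (v n t) - f t (X 0 t) (u0 t))" for n
  proof -
    have vs: "v n \<in> selectors U" unfolding v_def by (intro spike_selector u0 u)
    have "((\<lambda>t. f t (\<phi> (v n) t) (v n t) - f t (X 0 t) (u0 t)) has_integral
       (\<phi> (v n) (\<tau> + h n) - \<phi> (v n) \<tau>) - (X 0 (\<tau> + h n) - X 0 \<tau>)) {\<tau>..\<tau> + h n}"
      using \<tau> h[of n] by (intro has_integral_diff solves_ode_has_integral[OF \<phi>[OF vs]] solves_ode_has_integral[OF X]) auto
    moreover have "\<phi> (v n) \<tau> = X 0 \<tau>" unfolding v_def using \<tau> by (intro needle_before u) auto
    ultimately show ?thesis by (simp add: d_def integral_unique)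
  qed
  define d' where "d' n = (1 / h n) *\<^sub>R d n" for n
  define e' where "e' n = (1 / h n) * e n" for n
  have d'_lim: "d' \<longlonglongrightarrow> gap f u \<tau>"
    unfolding d'_def[abs_def] d_eq by (rule incr[OF admissible_f df])
  have e'_lim: "e' \<longlonglongrightarrow> gap g u \<tau>"
    using incr[OF admissible_g dg] by (simp add: e'_def[abs_def] e_def)
  have d_lim: "d \<longlonglongrightarrow> 0"
    using tendsto_scaleR[OF h_lim d'_lim] h(1) by (simp add: d'_def less_imp_neq[symmetric])
  have c_lim: "(\<lambda>n. costate L (\<tau> + h n)) \<longlonglongrightarrow> costate L \<tau>"
    by (rule filterlim_compose[OF lac_tendsto[OF costate_lac \<tau>(1)] filterlim_shift_right[OF \<tau>(1) h(1) h_lim]])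
  define E where "E = growth T"
  have main: "gap g u \<tau> + costate L \<tau> \<bullet> gap f u \<tau> \<le> \<epsilon> * (E * norm (gap f u \<tau>))" if \<epsilon>: "\<epsilon> > 0" for \<epsilon>
  proof -
    obtain \<delta> T1 where \<delta>: "\<delta> > 0" "\<And>T' \<xi>. T' \<ge> T1 \<Longrightarrow> norm \<xi> < \<delta> \<Longrightarrow> \<bar>integral {0..T'} (payoff_shift \<xi>) - L \<bullet> \<xi>\<bar> \<le> \<epsilon> * norm \<xi>"
      using payoff_near_limit[OF \<epsilon>] by blast
    define C where "C n = needle_const T + norm (costate L (\<tau> + h n)) * flow_const T 1" for n
    have "(\<lambda>n. E * norm (d n)) \<longlonglongrightarrow> E * norm (0::real^'m)" by (intro tendsto_intros d_lim)
    then have small: "\<forall>\<^sub>F n in sequentially. E * norm (d n) < min \<delta> 1"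
      using \<delta>(1) by (intro order_tendstoD(2)[where y="E * norm (0::real^'m)"]) auto
    have ineq: "\<forall>\<^sub>F n in sequentially. e' n + costate L (\<tau> + h n) \<bullet> d' n
        \<le> \<epsilon> * (E * norm (d' n)) + C n * (E * norm (d' n)) * (E * norm (d n))"
      using small
    proof eventually_elim
      case (elim n)
      have "e n + costate L (\<tau> + h n) \<bullet> d n \<le> \<epsilon> * (E * norm (d n)) + C n * (E * norm (d n))\<^sup>2"
        using needle_step[OF u \<tau>(1) less_imp_le[OF h(1)[of n]] h(2)[of n] \<epsilon> \<delta>(2)] elim
        by (simp add: C_def E_def d_def e_def v_def)
      then have "(1 / h n) * (e n + costate L (\<tau> + h n) \<bullet> d n) \<le> (1 / h n) * (\<epsilon> * (E * norm (d n)) + C n * (E * norm (d n))\<^sup>2)"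
        using h(1)[of n] by (intro mult_left_mono) auto
      moreover have "norm (d' n) = (1 / h n) * norm (d n)" using h(1)[of n] by (simp add: d'_def)
      moreover have "costate L (\<tau> + h n) \<bullet> d' n = (1 / h n) * (costate L (\<tau> + h n) \<bullet> d n)" by (simp add: d'_def)
      ultimately show ?case by (simp only: e'_def) (simp add: power2_eq_square algebra_simps)
    qed
    have lhs: "(\<lambda>n. e' n + costate L (\<tau> + h n) \<bullet> d' n) \<longlonglongrightarrow> gap g u \<tau> + costate L \<tau> \<bullet> gap f u \<tau>"
      by (intro tendsto_intros e'_lim c_lim d'_lim)
    have "(\<lambda>n. \<epsilon> * (E * norm (d' n)) + C n * (E * norm (d' n)) * (E * norm (d n))) \<longlonglongrightarrow>
       \<epsilon> * (E * norm (gap f u \<tau>)) + (needle_const T + norm (costate L \<tau>) * flow_const T 1) * (E * norm (gap f u \<tau>)) * (E * norm (0::real^'m))"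
      unfolding C_def by (intro tendsto_intros d'_lim c_lim d_lim)
    then have rhs: "(\<lambda>n. \<epsilon> * (E * norm (d' n)) + C n * (E * norm (d' n)) * (E * norm (d n))) \<longlonglongrightarrow> \<epsilon> * (E * norm (gap f u \<tau>))"
      by simp
    show ?thesis by (rule tendsto_le[OF _ rhs lhs ineq]) simp
  qed
  define c where "c = E * norm (gap f u \<tau>)"
  have c0: "c \<ge> 0" unfolding c_def E_def using growth_ge_1[of T] by simp
  show ?thesis
  proof (rule field_le_epsilon)
    fix \<epsilon> :: real assume \<epsilon>: "\<epsilon> > 0"
    have "gap g u \<tau> + costate L \<tau> \<bullet> gap f u \<tau> \<le> \<epsilon> / (c + 1) * c"
      using main[of "\<epsilon> / (c + 1)"] \<epsilon> c0 by (simp add: c_def)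
    also have "\<dots> \<le> \<epsilon>" using \<epsilon> c0 by (simp add: divide_le_eq mult_left_mono)
    finally show "gap g u \<tau> + costate L \<tau> \<bullet> gap f u \<tau> \<le> 0 + \<epsilon>" by simp
  qed
qed

lemma selector_maximum_ae:
  assumes u: "u \<in> selectors U"
  shows "\<exists>N. negligible N \<and> (\<forall>t. 0 \<le> t \<longrightarrow> t \<notin> N \<longrightarrow> gap g u t + costate L t \<bullet> gap f u t \<le> 0)"
proof -
  have gi: "gap g u integrable_on {0..T}" "gap f u integrable_on {0..T}" if "0 \<le> T" for T
    using gap_abs[OF admissible_g u that] gap_abs[OF admissible_f u that] by (auto simp: absolutely_integrable_on_def)
  obtain N1 where N1: "negligible N1" "\<And>t. 0 \<le> t \<Longrightarrow> t \<notin> N1 \<Longrightarrow>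
     ((\<lambda>s. integral {0..s} (gap f u)) has_vector_derivative gap f u t) (at t within {0..})"
    using indefinite_integral_derivative_time[OF gi(2)] by metis
  obtain N2 where N2: "negligible N2" "\<And>t. 0 \<le> t \<Longrightarrow> t \<notin> N2 \<Longrightarrow>
     ((\<lambda>s. integral {0..s} (gap g u)) has_vector_derivative gap g u t) (at t within {0..})"
    using indefinite_integral_derivative_time[OF gi(1)] by metis
  have "\<forall>n::nat. \<exists>N. negligible N \<and> (\<forall>t. 0 \<le> t \<longrightarrow> t \<notin> N \<longrightarrow>
     ((\<lambda>s. integral {0..s} (maj (real n) (radius (real n) 1))) has_vector_derivative maj (real n) (radius (real n) 1) t) (at t within {0..}))"
    by (intro allI indefinite_integral_derivative_time locally_summable_ivl maj_summable order_refl)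
  from choice[OF this] obtain N3 where "\<forall>n. negligible (N3 n) \<and> (\<forall>t. 0 \<le> t \<longrightarrow> t \<notin> N3 n \<longrightarrow>
     ((\<lambda>s. integral {0..s} (maj (real n) (radius (real n) 1))) has_vector_derivative maj (real n) (radius (real n) 1) t) (at t within {0..}))" ..
  then have N3: "\<And>n. negligible (N3 n)" "\<And>n t. 0 \<le> t \<Longrightarrow> t \<notin> N3 n \<Longrightarrow>
     ((\<lambda>s. integral {0..s} (maj (real n) (radius (real n) 1))) has_vector_derivative maj (real n) (radius (real n) 1) t) (at t within {0..})"
    by auto
  show ?thesis
  proof (intro exI[of _ "N1 \<union> N2 \<union> (\<Union>n. N3 n)"] conjI allI impI)
    show "negligible (N1 \<union> N2 \<union> (\<Union>n. N3 n))"
      using N3(1) by (intro negligible_Un N1(1) N2(1) negligible_countable_Union) auto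
    fix t assume t: "0 \<le> t" "t \<notin> N1 \<union> N2 \<union> (\<Union>n. N3 n)"
    obtain n :: nat where n: "t < real n" using reals_Archimedean2 by blast
    show "gap g u t + costate L t \<bullet> gap f u t \<le> 0"
      by (rule needle_inequality[OF u t(1) n N3(2) N1(2) N2(2)]) (use t in auto)
  qed
qed

text \<open>
  The null set of \<open>selector_maximum_ae\<close> depends on the selector. A countable family of selectors
  with dense values, and continuity in the control, give one null set for all control values.
\<close>

lemma maximum_condition_ae:
  "\<exists>N. negligible N \<and> (\<forall>t. 0 \<le> t \<longrightarrow> t \<notin> N \<longrightarrow> (\<forall>p\<in>U t.
     costate L t \<bullet> f t (X 0 t) p + g t (X 0 t) p \<le> costate L t \<bullet> f t (X 0 t) (u0 t) + g t (X 0 t) (u0 t)))"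
proof -
  have graph: "{(t, u). 0 \<le> t \<and> u \<in> U t} \<in> sets borel" and cl: "\<And>t. 0 \<le> t \<Longrightarrow> closed (U t)"
    using cond_u unfolding condition_u_def by (auto intro: compact_imp_closed)
  obtain w where w: "\<And>n. w n \<in> selectors U" "AE t in lborel. 0 \<le> t \<longrightarrow> U t \<subseteq> closure (range (\<lambda>n::nat. w n t))"
    using dense_selectors[OF graph cl u0] by blast
  obtain N0 where N0: "N0 \<in> null_sets lborel" "\<And>t. t \<notin> N0 \<Longrightarrow> 0 \<le> t \<Longrightarrow> U t \<subseteq> closure (range (\<lambda>n::nat. w n t))"
  proof -
    from w(2) obtain N where "N \<in> null_sets lborel" "{t \<in> space lborel. \<not> (0 \<le> t \<longrightarrow> U t \<subseteq> closure (range (\<lambda>n::nat. w n t)))} \<subseteq> N"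
      unfolding eventually_ae_filter by blast
    then show thesis by (intro that[of N]) auto
  qed
  have "\<forall>n. \<exists>N. negligible N \<and> (\<forall>t. 0 \<le> t \<longrightarrow> t \<notin> N \<longrightarrow> gap g (w n) t + costate L t \<bullet> gap f (w n) t \<le> 0)"
    by (intro allI selector_maximum_ae w(1))
  from choice[OF this] obtain N where "\<forall>n. negligible (N n) \<and> (\<forall>t. 0 \<le> t \<longrightarrow> t \<notin> N n \<longrightarrow> gap g (w n) t + costate L t \<bullet> gap f (w n) t \<le> 0)" ..
  then have N: "\<And>n. negligible (N n)" "\<And>n t. 0 \<le> t \<Longrightarrow> t \<notin> N n \<Longrightarrow> gap g (w n) t + costate L t \<bullet> gap f (w n) t \<le> 0"
    by auto
  show ?thesis
  proof (intro exI[of _ "N0 \<union> (\<Union>n. N n)"] conjI allI impI ballI)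
    have "negligible N0" unfolding negligible_iff_null_sets using N0(1) by (rule null_sets_completionI)
    then show "negligible (N0 \<union> (\<Union>n. N n))"
      using N(1) by (intro negligible_Un negligible_countable_Union) auto
    fix t p assume t: "0 \<le> t" "t \<notin> N0 \<union> (\<Union>n. N n)" and p: "p \<in> U t"
    define H where "H p = costate L t \<bullet> f t (X 0 t) p + g t (X 0 t) p" for p
    have cf: "continuous_on (UNIV \<times> U t) (\<lambda>(y, u). f t y u)" and cg: "continuous_on (UNIV \<times> U t) (\<lambda>(y, u). g t y u)"
      using cond_fg t(1) unfolding condition_fg_def caratheodory_def by auto
    have "continuous_on (U t) (\<lambda>p. (\<lambda>(y, u). f t y u) (X 0 t, p))"
      by (rule continuous_on_compose2[OF cf]) (auto intro!: continuous_intros)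
    moreover have "continuous_on (U t) (\<lambda>p. (\<lambda>(y, u). g t y u) (X 0 t, p))"
      by (rule continuous_on_compose2[OF cg]) (auto intro!: continuous_intros)
    ultimately have cH: "continuous_on (U t) H"
      unfolding H_def by (auto intro!: continuous_intros)
    have Hw: "H (w n t) \<le> H (u0 t)" for n
      using N(2)[of t n] t by (simp add: H_def gap_def inner_diff_right)
    have "p \<in> closure (range (\<lambda>n. w n t))" using N0(2)[of t] t p by auto
    then obtain s where s: "\<And>k. s k \<in> range (\<lambda>n. w n t)" "s \<longlonglongrightarrow> p" by (auto simp: closure_sequential)
    have sU: "s k \<in> U t" for k using s(1)[of k] w(1) t(1) by (auto simp: selectors_def)
    have "(\<lambda>k. H (s k)) \<longlonglongrightarrow> H p"
      by (rule continuous_on_tendsto_compose[OF cH s(2) p]) (use sU in \<open>auto intro!: always_eventually\<close>)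
    moreover have "H (s k) \<le> H (u0 t)" for k using s(1)[of k] Hw by auto
    ultimately have "H p \<le> H (u0 t)" by (intro LIMSEQ_le_const2) auto
    then show "costate L t \<bullet> f t (X 0 t) p + g t (X 0 t) p \<le> costate L t \<bullet> f t (X 0 t) (u0 t) + g t (X 0 t) (u0 t)"
      by (simp add: H_def)
  qed
qed

section \<open>The maximum principle\<close>

lemma tail_improper_integral:
  assumes T: "0 \<le> T"
  shows "has_improper_integral (grad 0) (L - I 0 T) T"
  unfolding has_improper_integral_def
proof (intro conjI allI impI)
  show "grad 0 absolutely_integrable_on {T..T'}" if "T \<le> T'" for T'
    by (rule absolutely_integrable_on_subinterval[OF grad_abs[of T']]) (use that T in auto)
  have "((\<lambda>T'. I 0 T' - I 0 T) \<longlongrightarrow> L - I 0 T) at_top"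
    by (intro tendsto_intros I_0_limit)
  moreover have "\<forall>\<^sub>F T' in at_top. I 0 T' - I 0 T = integral {T..T'} (grad 0)"
    using eventually_ge_at_top[of T]
  proof eventually_elim
    case (elim T')
    then show ?case
      using Henstock_Kurzweil_Integration.integral_combine[OF T elim grad_int[of T' 0]] T by (simp add: I_def algebra_simps)
  qed
  ultimately show "((\<lambda>T'. integral {T..T'} (grad 0)) \<longlongrightarrow> L - I 0 T) at_top"
    by (rule Lim_transform_eventually)
qed

lemma costate_vanishes: "((\<lambda>t. costate L t v* A 0 t) \<longlongrightarrow> 0) at_top"
proof (rule Lim_transform_eventually)
  show "((\<lambda>t. L - I 0 t) \<longlongrightarrow> 0) at_top"
    using tendsto_diff[OF tendsto_const[of L] I_0_limit] by simp
  show "\<forall>\<^sub>F t in at_top. L - I 0 t = costate L t v* A 0 t"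
    using eventually_ge_at_top[of 0] by eventually_elim (simp add: costate_A)
qed

lemma normalized_costate_solution:
  assumes l: "l = 1 / (1 + norm L)" and x0: "\<And>t. 0 \<le> t \<Longrightarrow> x0 t = X 0 t"
  shows "(x0, u0, l, \<lambda>t. l *\<^sub>R costate L t) \<in> maximum_principle_solutions U f g"
proof -
  have pos: "1 + norm L > 0" by (simp add: add_pos_nonneg)
  then have l0: "0 < l" and l1: "l \<le> 1" by (simp_all add: l)
  have X0: "locally_absolutely_continuous (X 0)" using X unfolding solves_ode_def by blast
  obtain N1 where N1: "negligible N1" "\<And>t. 0 \<le> t \<Longrightarrow> t \<notin> N1 \<Longrightarrow> (X 0 has_vector_derivative f t (X 0 t) (u0 t)) (at t within {0..})"
    using X[of 0] unfolding solves_ode_def AE_time_iff by blast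
  obtain N2 where N2: "negligible N2" "\<And>t. 0 \<le> t \<Longrightarrow> t \<notin> N2 \<Longrightarrow>
     (costate L has_vector_derivative - (costate L t v* fx t (X 0 t) (u0 t) + gx t (X 0 t) (u0 t))) (at t within {0..})"
    using costate_derivative_ae by metis
  obtain N3 where N3: "negligible N3" "\<And>t p. 0 \<le> t \<Longrightarrow> t \<notin> N3 \<Longrightarrow> p \<in> U t \<Longrightarrow>
     costate L t \<bullet> f t (X 0 t) p + g t (X 0 t) p \<le> costate L t \<bullet> f t (X 0 t) (u0 t) + g t (X 0 t) (u0 t)"
    using maximum_condition_ae by metis
  have "AE t in lebesgue_on {0..}.
           (x0 has_vector_derivative f t (x0 t) (u0 t)) (at t within {0..}) \<and>
           (\<exists>Hx. GDERIV (\<lambda>y. hamiltonian f g y t (u0 t) l (l *\<^sub>R costate L t)) (x0 t) :> Hx \<and>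
                 ((\<lambda>t. l *\<^sub>R costate L t) has_vector_derivative - Hx) (at t within {0..})) \<and>
           (SUP p\<in>U t. hamiltonian f g (x0 t) t p l (l *\<^sub>R costate L t)) =
             hamiltonian f g (x0 t) t (u0 t) l (l *\<^sub>R costate L t)"
    unfolding AE_time_iff
  proof (intro exI[of _ "N1 \<union> N2 \<union> N3"] conjI allI impI)
    show "negligible (N1 \<union> N2 \<union> N3)" by (intro negligible_Un N1(1) N2(1) N3(1))
    fix t assume t: "0 \<le> t" "t \<notin> N1 \<union> N2 \<union> N3"
    have "(X 0 has_vector_derivative f t (x0 t) (u0 t)) (at t within {0..})" using N1(2)[of t] t x0 by simp
    then show "(x0 has_vector_derivative f t (x0 t) (u0 t)) (at t within {0..})"
      by (rule has_vector_derivative_transform[rotated 2]) (use t x0 in auto)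
    show "\<exists>Hx. GDERIV (\<lambda>y. hamiltonian f g y t (u0 t) l (l *\<^sub>R costate L t)) (x0 t) :> Hx \<and>
                 ((\<lambda>t. l *\<^sub>R costate L t) has_vector_derivative - Hx) (at t within {0..})"
    proof (intro exI conjI)
      show "GDERIV (\<lambda>y. hamiltonian f g y t (u0 t) l (l *\<^sub>R costate L t)) (x0 t) :>
          (l *\<^sub>R costate L t) v* fx t (x0 t) (u0 t) + l *\<^sub>R gx t (x0 t) (u0 t)"
        by (rule hamiltonian_gradient) (use t u0_in in auto)
      have "((\<lambda>t. l *\<^sub>R costate L t) has_vector_derivative
          l *\<^sub>R - (costate L t v* fx t (X 0 t) (u0 t) + gx t (X 0 t) (u0 t))) (at t within {0..})"
        using N2(2)[of t] t by (auto intro!: derivative_eq_intros)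
      then show "((\<lambda>t. l *\<^sub>R costate L t) has_vector_derivative
          - ((l *\<^sub>R costate L t) v* fx t (x0 t) (u0 t) + l *\<^sub>R gx t (x0 t) (u0 t))) (at t within {0..})"
        using t x0 by (simp add: scaleR_vector_matrix_assoc scaleR_diff_right)
    qed
    have ham: "hamiltonian f g (x0 t) t p l (l *\<^sub>R costate L t) = l * (costate L t \<bullet> f t (X 0 t) p + g t (X 0 t) p)" for p
      using t x0 by (simp add: hamiltonian_def algebra_simps)
    show "(SUP p\<in>U t. hamiltonian f g (x0 t) t p l (l *\<^sub>R costate L t)) =
             hamiltonian f g (x0 t) t (u0 t) l (l *\<^sub>R costate L t)"
      unfolding ham
      by (rule cSup_eq_maximum) (use t u0_in l0 N3(2)[of t] in \<open>auto intro!: mult_left_mono\<close>)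
  qed
  moreover have "locally_absolutely_continuous (\<lambda>t. l *\<^sub>R costate L t)"
    by (rule lac_lipschitz[OF costate_lac[of L], of l]) (use l0 in \<open>simp_all flip: scaleR_diff_right\<close>)
  moreover have "locally_absolutely_continuous x0" by (rule lac_cong[OF _ X0]) (simp add: x0)
  moreover have "norm (l *\<^sub>R costate L 0) + l = 1"
  proof -
    have "norm (l *\<^sub>R costate L 0) + l = l * (1 + norm L)" using l0 by (simp add: costate_0 algebra_simps)
    then show ?thesis using pos by (simp add: l)
  qed
  ultimately show ?thesis
    unfolding maximum_principle_solutions_def using u0 l0 l1 x0[of 0] by (simp add: X_0)
qed

text \<open>
  Transversality forces \<open>\<psi> 0 = l L\<close>, and the normalization then fixes \<open>l\<close>.
\<close>

lemma maximum_principle_solution_unique: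
  assumes x0: "\<And>t. 0 \<le> t \<Longrightarrow> x0 t = X 0 t"
    and sol: "(x0, u0, l, \<psi>) \<in> maximum_principle_solutions U f g"
    and trans: "((\<lambda>t. \<psi> t v* A 0 t) \<longlongrightarrow> 0) at_top"
  shows "l = 1 / (1 + norm L)" and "0 \<le> t \<Longrightarrow> \<psi> t = l *\<^sub>R costate L t"
proof -
  have ac: "locally_absolutely_continuous \<psi>" and norm1: "norm (\<psi> 0) + l = 1" and l0: "0 \<le> l"
    using sol unfolding maximum_principle_solutions_def by auto
  have "AE t in lebesgue_on {0..}. \<exists>Hx. GDERIV (\<lambda>y. hamiltonian f g y t (u0 t) l (\<psi> t)) (x0 t) :> Hx \<and>
                 (\<psi> has_vector_derivative - Hx) (at t within {0..})"
    using sol unfolding maximum_principle_solutions_def by auto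
  then obtain N where N: "negligible N" "\<And>t. 0 \<le> t \<Longrightarrow> t \<notin> N \<Longrightarrow>
      \<exists>Hx. GDERIV (\<lambda>y. hamiltonian f g y t (u0 t) l (\<psi> t)) (x0 t) :> Hx \<and> (\<psi> has_vector_derivative - Hx) (at t within {0..})"
    unfolding AE_time_iff by blast
  have "AE t in lebesgue_on {0..}. (\<psi> has_vector_derivative
        - (\<psi> t v* fx t (X 0 t) (u0 t) + l *\<^sub>R gx t (X 0 t) (u0 t))) (at t within {0..})"
    unfolding AE_time_iff
  proof (intro exI[of _ N] conjI allI impI N(1))
    fix t assume t: "0 \<le> t" "t \<notin> N"
    then obtain Hx where Hx: "GDERIV (\<lambda>y. hamiltonian f g y t (u0 t) l (\<psi> t)) (x0 t) :> Hx"
      "(\<psi> has_vector_derivative - Hx) (at t within {0..})" using N(2) by blast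
    have "Hx = \<psi> t v* fx t (x0 t) (u0 t) + l *\<^sub>R gx t (x0 t) (u0 t)"
      by (rule GDERIV_unique[OF Hx(1) hamiltonian_gradient]) (use t u0_in in auto)
    then show "(\<psi> has_vector_derivative
        - (\<psi> t v* fx t (X 0 t) (u0 t) + l *\<^sub>R gx t (X 0 t) (u0 t))) (at t within {0..})"
      using Hx(2) t x0 by simp
  qed
  then have eq: "\<psi> t v* A 0 t = \<psi> 0 - l *\<^sub>R I 0 t" if "0 \<le> t" for t
    using costate_unique[OF ac _ that] by blast
  have "((\<lambda>t. \<psi> 0 - l *\<^sub>R I 0 t) \<longlongrightarrow> 0) at_top"
  proof (rule Lim_transform_eventually[OF trans])
    show "\<forall>\<^sub>F t in at_top. \<psi> t v* A 0 t = \<psi> 0 - l *\<^sub>R I 0 t"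
      using eventually_ge_at_top[of 0] by eventually_elim (rule eq)
  qed
  moreover have "((\<lambda>t. \<psi> 0 - l *\<^sub>R I 0 t) \<longlongrightarrow> \<psi> 0 - l *\<^sub>R L) at_top"
    by (intro tendsto_intros I_0_limit)
  ultimately have "\<psi> 0 - l *\<^sub>R L = 0" using tendsto_unique trivial_limit_at_top_linorder by blast
  then have \<psi>0: "\<psi> 0 = l *\<^sub>R L" by simp
  have "l * (1 + norm L) = 1" using norm1 l0 by (simp add: \<psi>0 algebra_simps)
  moreover have "1 + norm L \<noteq> 0" using norm_ge_zero[of L] by linarith
  ultimately show "l = 1 / (1 + norm L)" by (simp add: nonzero_eq_divide_eq)
  assume t: "0 \<le> t"
  have "\<psi> t = (\<psi> t v* A 0 t) v* A_inv t" using t by (simp add: vector_matrix_mul_assoc A_inv_right)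
  also have "\<dots> = l *\<^sub>R costate L t"
    using t by (simp add: eq \<psi>0 costate_def scaleR_vector_matrix_assoc flip: scaleR_diff_right)
  finally show "\<psi> t = l *\<^sub>R costate L t" .
qed

end

theorem theorem2:
  fixes U :: "real \<Rightarrow> 'u::euclidean_space set"
    and f :: "real \<Rightarrow> real ^ 'm \<Rightarrow> 'u \<Rightarrow> real ^ 'm"
    and g :: "real \<Rightarrow> real ^ 'm \<Rightarrow> 'u \<Rightarrow> real"
    and fx :: "real \<Rightarrow> real ^ 'm \<Rightarrow> 'u \<Rightarrow> real ^ 'm ^ 'm"
    and gx :: "real \<Rightarrow> real ^ 'm \<Rightarrow> 'u \<Rightarrow> real ^ 'm"
    and \<phi> :: "(real \<Rightarrow> 'u) \<Rightarrow> real \<Rightarrow> real ^ 'm"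
    and x0 :: "real \<Rightarrow> real ^ 'm"
    and u0 :: "real \<Rightarrow> 'u"
    and X :: "real ^ 'm \<Rightarrow> real \<Rightarrow> real ^ 'm"
    and A :: "real ^ 'm \<Rightarrow> real \<Rightarrow> real ^ 'm ^ 'm"
    and I :: "real ^ 'm \<Rightarrow> real \<Rightarrow> real ^ 'm"
    and L :: "real ^ 'm"
  assumes "condition_u U"
    and "condition_fg U f g"
    and "condition_partial U f g fx gx"
    and "\<And>u. u \<in> selectors U \<Longrightarrow> solves_ode (\<lambda>t y. f t y (u t)) 0 (\<phi> u)"
    and "\<And>u T. u \<in> selectors U \<Longrightarrow> T \<ge> 0 \<Longrightarrow>
           (\<lambda>t. g t (\<phi> u t) (u t)) absolutely_integrable_on {0..T}"
    and "uniformly_overtaking_optimal U g \<phi> u0"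
    and "\<And>t. t \<ge> 0 \<Longrightarrow> x0 t = \<phi> u0 t"
    and "\<And>\<xi>. solves_ode (\<lambda>t y. f t y (u0 t)) \<xi> (X \<xi>)"
    and "\<And>\<xi>. solves_ode (\<lambda>t B. fx t (X \<xi> t) (u0 t) ** B) (mat 1) (A \<xi>)"
    and "\<And>\<xi> T. T \<ge> 0 \<Longrightarrow>
           (\<lambda>t. gx t (X \<xi> t) (u0 t) v* A \<xi> t) absolutely_integrable_on {0..T}"
    and "\<And>\<xi> T. T \<ge> 0 \<Longrightarrow> I \<xi> T = integral {0..T} (\<lambda>t. gx t (X \<xi> t) (u0 t) v* A \<xi> t)"
    and "((\<lambda>(t, \<xi>). I \<xi> t) \<longlongrightarrow> L) (at_top \<times>\<^sub>F at 0)"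
    and "has_improper_integral (\<lambda>t. gx t (x0 t) (u0 t) v* A 0 t) L 0"
  shows "\<exists>l0 \<psi>0.
      (x0, u0, l0, \<psi>0) \<in> maximum_principle_solutions U f g \<and>
      ((\<lambda>t. \<psi>0 t v* A 0 t) \<longlongrightarrow> 0) at_top \<and>
      (\<forall>l1 \<psi>1. (x0, u0, l1, \<psi>1) \<in> maximum_principle_solutions U f g \<longrightarrow>
         ((\<lambda>t. \<psi>1 t v* A 0 t) \<longlongrightarrow> 0) at_top \<longrightarrow>
         l1 = l0 \<and> (\<forall>t\<ge>0. \<psi>1 t = \<psi>0 t)) \<and>
      (\<exists>c>0. c * l0 = 1 \<and>
         (\<forall>T\<ge>0. invertible (A 0 T) \<and>
            (\<exists>v. has_improper_integral (\<lambda>t. gx t (x0 t) (u0 t) v* A 0 t) v T \<and>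
                 c *\<^sub>R \<psi>0 T = v v* matrix_inv (A 0 T))))"
proof -
  have u0: "u0 \<in> selectors U"
    using assms(6) by (simp add: uniformly_overtaking_optimal_def)
  interpret ref: reference_process U f g fx gx u0 X A
    by unfold_locales (fact assms(1) assms(2) assms(3) u0 assms(8) assms(9) assms(10))+
  have x0_X: "x0 t = X 0 t" if t: "0 \<le> t" for t
    using ref.trajectory_stability[OF u0 assms(4)[OF u0] u0 assms(8)[of 0], of 0 t t 0 t] t
      solves_ode_0[OF assms(4)[OF u0]] assms(7)[OF t]
    by (simp add: ref.X_0)
  have I_eq: "I \<xi> T = ref.I \<xi> T" if "0 \<le> T" for \<xi> T
    using assms(11)[OF that] by (simp add: ref.I_def ref.grad_def[abs_def])
  have grad_eq: "gx t (x0 t) (u0 t) v* A 0 t = ref.grad 0 t" if "0 \<le> t" for t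
    using x0_X[OF that] by (simp add: ref.grad_def)
  have lim: "((\<lambda>(t, \<xi>). ref.I \<xi> t) \<longlongrightarrow> L) (at_top \<times>\<^sub>F at 0)"
  proof (rule Lim_transform_eventually[OF assms(12)])
    have "\<forall>\<^sub>F p in at_top \<times>\<^sub>F at (0::real^'m). 0 \<le> (fst p :: real)"
      unfolding eventually_prod_filter
      by (intro exI[of _ "\<lambda>t. 0 \<le> t"] exI[of _ "\<lambda>_. True"]) (auto simp: eventually_ge_at_top)
    then show "\<forall>\<^sub>F p in at_top \<times>\<^sub>F at 0. (case p of (t, \<xi>) \<Rightarrow> I \<xi> t) = (case p of (t, \<xi>) \<Rightarrow> ref.I \<xi> t)"
      by eventually_elim (auto simp: I_eq)
  qed
  have lim0: "(ref.I 0 \<longlongrightarrow> L) at_top"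
  proof (rule Lim_transform_eventually)
    show "((\<lambda>T. integral {0..T} (\<lambda>t. gx t (x0 t) (u0 t) v* A 0 t)) \<longlongrightarrow> L) at_top"
      using assms(13) by (simp add: has_improper_integral_def)
    show "\<forall>\<^sub>F T in at_top. integral {0..T} (\<lambda>t. gx t (x0 t) (u0 t) v* A 0 t) = ref.I 0 T"
      unfolding ref.I_def by (intro always_eventually allI integral_cong) (simp add: grad_eq)
  qed
  interpret opt: optimal_process U f g fx gx u0 X A \<phi> L
    by unfold_locales (fact assms(4) assms(5) assms(6) lim lim0)+
  define l0 where "l0 = 1 / (1 + norm L)"
  define c where "c = 1 + norm L"
  have c: "c > 0" "c * l0 = 1" using norm_ge_zero[of L] by (auto simp: c_def l0_def add_pos_nonneg add_nonneg_eq_0_iff)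
  define \<psi>0 where "\<psi>0 t = l0 *\<^sub>R ref.costate L t" for t
  show ?thesis
  proof (rule exI[of _ l0], rule exI[of _ \<psi>0], intro conjI allI impI)
    show "(x0, u0, l0, \<psi>0) \<in> maximum_principle_solutions U f g"
      unfolding \<psi>0_def by (rule opt.normalized_costate_solution[OF l0_def x0_X])
    show "((\<lambda>t. \<psi>0 t v* A 0 t) \<longlongrightarrow> 0) at_top"
      using tendsto_scaleR[OF tendsto_const[of l0] opt.costate_vanishes] by (simp add: \<psi>0_def scaleR_vector_matrix_assoc)
  next
    fix l1 \<psi>1 assume sol: "(x0, u0, l1, \<psi>1) \<in> maximum_principle_solutions U f g" "((\<lambda>t. \<psi>1 t v* A 0 t) \<longlongrightarrow> 0) at_top"
    note uniq = opt.maximum_principle_solution_unique[OF x0_X sol]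
    show "l1 = l0" using uniq(1) by (simp add: l0_def)
    then show "\<psi>1 t = \<psi>0 t" if "0 \<le> t" for t using uniq(2)[OF _ that] by (simp add: \<psi>0_def)
  next
    show "\<exists>c>0. c * l0 = 1 \<and> (\<forall>T\<ge>0. invertible (A 0 T) \<and>
            (\<exists>v. has_improper_integral (\<lambda>t. gx t (x0 t) (u0 t) v* A 0 t) v T \<and>
                 c *\<^sub>R \<psi>0 T = v v* matrix_inv (A 0 T)))"
    proof (intro exI[of _ c] conjI allI impI c)
      fix T :: real assume T: "0 \<le> T"
      show "invertible (A 0 T)" using T by (rule ref.A_invertible)
      show "\<exists>v. has_improper_integral (\<lambda>t. gx t (x0 t) (u0 t) v* A 0 t) v T \<and>
                 c *\<^sub>R \<psi>0 T = v v* matrix_inv (A 0 T)"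
      proof (intro exI[of _ "L - ref.I 0 T"] conjI)
        show "c *\<^sub>R \<psi>0 T = (L - ref.I 0 T) v* matrix_inv (A 0 T)"
          using c(2) by (simp add: \<psi>0_def ref.costate_def ref.A_inv_def)
        have cong: "integral {T..T'} (\<lambda>t. gx t (x0 t) (u0 t) v* A 0 t) = integral {T..T'} (ref.grad 0)" for T'
          using T by (intro integral_cong) (simp add: grad_eq)
        have abs_cong: "(\<lambda>t. gx t (x0 t) (u0 t) v* A 0 t) absolutely_integrable_on {T..T'}
            \<longleftrightarrow> ref.grad 0 absolutely_integrable_on {T..T'}" for T'
          using T by (intro set_integrable_cong) (auto simp: grad_eq)
        show "has_improper_integral (\<lambda>t. gx t (x0 t) (u0 t) v* A 0 t) (L - ref.I 0 T) T"
          using opt.tail_improper_integral[OF T] unfolding has_improper_integral_def cong abs_cong .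
      qed
    qed
  qed
qed

end
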